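(* Let $\frac{3+\sqrt{21}}{2}<D<4$ and let $p\equiv 1\pmod 4$ be a prime such that $$p>\max\left\{5^{\frac{4D}{4-D}},\ 2^{\frac{4D(D-1)}{D^2-3D-3}}\right\}.$$ Let $\Phi_{p,D}=\{x\mapsto (p+1)^{-1/D}A_{\omega_j}x+t_j\}_{j=1}^{p+1}$ be the IFS on $\mathbb R^4$ defined in the context. Then the uniform self-similar measure $\nu\in\mathcal P(\mathbb R^4)$ with respect to $\Phi_{p,D}$ satisfies: (1) $\dim_H\nu=\dim_2\nu=D<4$; in particular, $\nu\perp\mathrm{Leb}_{\mathbb R^4}$. (2) For every $V\in G_{4,1}$, $\pi_V\nu\ll\mathrm{Leb}_V$ and $\pi_V\nu\in L^2(V)$.
   Context: For a prime $p\equiv 1\pmod 4$, let $$\Omega_p:=\Big\{\tfrac{1}{\sqrt p}(a,b,c,d)\in S^3: a,b,c,d\in\mathbb Z,\ a^2+b^2+c^2+d^2=p,\ a>0\text{ odd},\ b,c,d\text{ even}\Big\},$$ which has $p+1$ elements, enumerated (in any order) as $\Omega_p=\{\omega_1,\dots,\omega_{p+1}\}$. Identify $\mathbb R^4$ with the quaternions $\mathbb H$; for $\omega=\frac1{\sqrt p}(a,b,c,d)\in\Omega_p$ let $A_\omega x=\omega x$ (left quaternion multiplication), i.e. $$A_\omega=\frac1{\sqrt p}\begin{pmatrix} a & -b & -c & -d \\ b & a & -d & c \\ c & d & a & -b \\ d & -c & b & a \end{pmatrix}\in\mathrm{SO}(4).$$ Let $M=\lceil (p+1)^{1/4}\rceil$.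 For $1\le j\le p+1$ write $j-1=n_1(j)+Mn_2(j)+M^2n_3(j)+M^3n_4(j)$ with integers $0\le n_i(j)\le M-1$, and put $t_j=(n_1(j),n_2(j),n_3(j),n_4(j))$. The uniform self-similar measure is the unique Borel probability measure with $\nu=\frac1{p+1}\sum_{j} f_j\nu$ (push-forwards), $f_j$ the maps of $\Phi_{p,D}$. $\dim_H\nu:=\inf\{\dim_HA:\nu(A)>0\}$; $\dim_2\nu:=\sup\{\alpha:\iint|x-y|^{-\alpha}d\nu(x)d\nu(y)<\infty\}$. $G_{4,1}$ is the space of lines through $0$ in $\mathbb R^4$, $\pi_V$ is the orthogonal projection onto $V$, $\pi_V\nu$ the push-forward; $\pi_V\nu\in L^2(V)$ means it has an $L^2$ density. *)

theory Defs
  imports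
    "HOL-Probability.Probability"
    "HOL-Number_Theory.Cong"
begin

section \<open>The iterated function system\<close>

definition Omega :: "nat \<Rightarrow> (real ^ 4) set" where
  "Omega p = {(1 / sqrt (real p)) *\<^sub>R vector [of_int a, of_int b, of_int c, of_int d] | a b c d :: int.
     a\<^sup>2 + b\<^sup>2 + c\<^sup>2 + d\<^sup>2 = int p \<and> a > 0 \<and> odd a \<and> even b \<and> even c \<and> even d}"

text \<open>The matrix of left multiplication by the quaternion
  \<open>w$1 + (w$2) i + (w$3) j + (w$4) k\<close> with respect to \<open>1, i, j, k\<close>.\<close>

definition left_mult :: "real ^ 4 \<Rightarrow> real ^ 4 ^ 4" where
  "left_mult w = vector
    [vector [w $ 1, - (w $ 2), - (w $ 3), - (w $ 4)],
     vector [w $ 2,    w $ 1,  - (w $ 4),    w $ 3 ],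
     vector [w $ 3,    w $ 4,     w $ 1,  - (w $ 2)],
     vector [w $ 4, - (w $ 3),    w $ 2,     w $ 1 ]]"

definition base_M :: "nat \<Rightarrow> nat" where
  "base_M p = nat \<lceil>real (p + 1) powr (1 / 4)\<rceil>"

text \<open>\<open>digit p i j\<close> is the coefficient of \<open>M ^ (i - 1)\<close> in the base-\<open>M\<close> expansion of \<open>j - 1\<close>,
  where \<open>M = base_M p\<close>; it is used for \<open>1 \<le> i \<le> 4\<close> and \<open>1 \<le> j \<le> p + 1 \<le> M ^ 4\<close>.\<close>

definition digit :: "nat \<Rightarrow> nat \<Rightarrow> nat \<Rightarrow> nat" where
  "digit p i j = (j - 1) div base_M p ^ (i - 1) mod base_M p"

lemma digit_less: "digit p i j < base_M p"
proof -
  have "real (p + 1) powr (1 / 4) > 0" by simp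
  hence "base_M p > 0" by (simp add: base_M_def)
  thus ?thesis by (simp add: digit_def)
qed

lemma digit_expansion:
  assumes "j \<in> {1..p + 1}"
  shows "j - 1 = digit p 1 j + base_M p * digit p 2 j + base_M p ^ 2 * digit p 3 j
                 + base_M p ^ 3 * digit p 4 j"
proof -
  define M where "M = base_M p"
  have "real (p + 1) powr (1 / 4) \<le> real M"
    unfolding M_def base_M_def by linarith
  hence "(real (p + 1) powr (1 / 4)) ^ 4 \<le> real M ^ 4"
    by (intro power_mono) auto
  moreover have "(real (p + 1) powr (1 / 4)) ^ 4 = real (p + 1)"
    by (simp add: powr_power)
  ultimately have "real (p + 1) \<le> real (M ^ 4)"
    by (metis of_nat_power)
  hence "p + 1 \<le> M ^ 4"
    using of_nat_le_iff by blast
  hence "j - 1 < M ^ 4"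
    using assms by auto
  hence "(j - 1) div M ^ 3 < M"
    by (auto simp: less_mult_imp_div_less power4_eq_xxxx power3_eq_cube)
  hence d4: "(j - 1) div M ^ 3 mod M = (j - 1) div M ^ 3" by simp
  define q1 q2 q3 where "q1 = (j - 1) div M" and "q2 = q1 div M" and "q3 = q2 div M"
  have "j - 1 = M * q1 + (j - 1) mod M" "q1 = M * q2 + q1 mod M" "q2 = M * q3 + q2 mod M"
    unfolding q1_def q2_def q3_def by simp_all
  hence e: "j - 1 = M * (M * (M * q3 + q2 mod M) + q1 mod M) + (j - 1) mod M"
    by simp
  have "digit p 1 j = (j - 1) mod M" "digit p 2 j = q1 mod M" "digit p 3 j = q2 mod M"
       "digit p 4 j = q3"
    using d4 unfolding digit_def M_def[symmetric] q1_def q2_def q3_def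
    by (simp_all add: power2_eq_square power3_eq_cube div_mult2_eq)
  thus ?thesis
    unfolding M_def[symmetric]
    by (subst e) (simp add: power2_eq_square power3_eq_cube algebra_simps)
qed

definition transl :: "nat \<Rightarrow> nat \<Rightarrow> real ^ 4" where
  "transl p j = vector [real (digit p 1 j), real (digit p 2 j), real (digit p 3 j), real (digit p 4 j)]"

definition Phi :: "nat \<Rightarrow> real \<Rightarrow> (nat \<Rightarrow> real ^ 4) \<Rightarrow> nat \<Rightarrow> real ^ 4 \<Rightarrow> real ^ 4" where
  "Phi p D \<omega> j x = (real (p + 1) powr (- 1 / D)) *\<^sub>R (left_mult (\<omega> j) *v x) + transl p j"

definition is_uniform_self_similar :: "nat set \<Rightarrow> (nat \<Rightarrow> 'a \<Rightarrow> 'a) \<Rightarrow> ('a :: topological_space) measure \<Rightarrow> bool" where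
  "is_uniform_self_similar J f \<nu> \<longleftrightarrow> prob_space \<nu> \<and> sets \<nu> = sets borel \<and>
     (\<forall>A \<in> sets borel. emeasure \<nu> A = (\<Sum>j\<in>J. emeasure (distr \<nu> borel (f j)) A) / of_nat (card J))"

definition uniform_self_similar_measure :: "nat set \<Rightarrow> (nat \<Rightarrow> 'a \<Rightarrow> 'a) \<Rightarrow> ('a :: topological_space) measure" where
  "uniform_self_similar_measure J f = (THE \<nu>. is_uniform_self_similar J f \<nu>)"

section \<open>Dimensions\<close>

text \<open>\<open>|U|\<^sup>s\<close> with the conventions \<open>|{}|\<^sup>0 = 0\<close> and \<open>|U|\<^sup>0 = 1\<close> for \<open>U \<noteq> {}\<close>, whereas
  \<open>0 powr 0 = 0\<close>. Since \<^const>\<open>diameter\<close> is a real number, covers are required below to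
  consist of bounded sets.\<close>

definition diam_powr :: "('a :: metric_space) set \<Rightarrow> real \<Rightarrow> ennreal" where
  "diam_powr U s = (if U = {} then 0 else if s = 0 then 1 else ennreal (diameter U powr s))"

definition hausdorff_premeasure :: "real \<Rightarrow> real \<Rightarrow> ('a :: metric_space) set \<Rightarrow> ennreal" where
  "hausdorff_premeasure s \<delta> A =
     (INF U \<in> {U :: nat \<Rightarrow> 'a set. A \<subseteq> (\<Union>i. U i) \<and> (\<forall>i. bounded (U i) \<and> diameter (U i) \<le> \<delta>)}.
        (\<Sum>i. diam_powr (U i) s))"

definition hausdorff_measure :: "real \<Rightarrow> ('a :: metric_space) set \<Rightarrow> ennreal" where
  "hausdorff_measure s A = (SUP \<delta> \<in> {0<..}. hausdorff_premeasure s \<delta> A)"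

definition hausdorff_dim :: "('a :: metric_space) set \<Rightarrow> ereal" where
  "hausdorff_dim A = (INF s \<in> {s. 0 \<le> s \<and> hausdorff_measure s A = 0}. ereal s)"

definition hausdorff_dim_measure :: "('a :: metric_space) measure \<Rightarrow> ereal" where
  "hausdorff_dim_measure \<nu> = (INF A \<in> {A \<in> sets \<nu>. emeasure \<nu> A > 0}. hausdorff_dim A)"

text \<open>\<open>|x - y|\<close> to the power \<open>-\<alpha>\<close> with values in \<open>[0, \<infinity>]\<close>; the diagonal needs care
  because \<open>0 powr (- \<alpha>) = 0\<close>.\<close>

definition riesz_kernel :: "real \<Rightarrow> 'a :: metric_space \<Rightarrow> 'a \<Rightarrow> ennreal" where
  "riesz_kernel \<alpha> x y =
     (if x = y then (if \<alpha> > 0 then \<infinity> else if \<alpha> = 0 then 1 else 0)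
      else ennreal (dist x y powr (- \<alpha>)))"

definition correlation_dim :: "('a :: metric_space) measure \<Rightarrow> ereal" where
  "correlation_dim \<nu> =
     (SUP \<alpha> \<in> {\<alpha>. (\<integral>\<^sup>+ x. \<integral>\<^sup>+ y. riesz_kernel \<alpha> x y \<partial>\<nu> \<partial>\<nu>) < \<infinity>}. ereal \<alpha>)"

section \<open>Singularity, projections and densities\<close>

definition mutually_singular :: "'a measure \<Rightarrow> 'a measure \<Rightarrow> bool" where
  "mutually_singular M N \<longleftrightarrow>
     (\<exists>A. A \<in> sets M \<and> A \<in> sets N \<and> emeasure M A = 0 \<and> emeasure N (space N - A) = 0)"

definition grassmannian :: "nat \<Rightarrow> ('a :: euclidean_space) set set" where
  "grassmannian k = {V. subspace V \<and> dim V = k}"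

definition orth_proj :: "('a :: euclidean_space) set \<Rightarrow> 'a \<Rightarrow> 'a" where
  "orth_proj V x = (THE y. y \<in> V \<and> (\<forall>v\<in>V. orthogonal (x - y) v))"

definition proj_measure :: "('a :: euclidean_space) set \<Rightarrow> 'a measure \<Rightarrow> 'a measure" where
  "proj_measure V \<nu> = distr \<nu> (restrict_space borel V) (orth_proj V)"

text \<open>Lebesgue measure on the Borel sets of a line \<open>V\<close> through 0, transported from \<open>\<real>\<close> by
  \<open>t \<mapsto> t u\<close> with \<open>u\<close> a unit vector of \<open>V\<close>. There are two choices of \<open>u\<close>, and they give the same
  measure.\<close>

definition line_lebesgue :: "('a :: euclidean_space) set \<Rightarrow> 'a measure" where
  "line_lebesgue V =
     distr lborel (restrict_space borel V) (\<lambda>t :: real. t *\<^sub>R (SOME u. u \<in> V \<and> norm u = 1))"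

definition has_L2_density :: "'a measure \<Rightarrow> 'a measure \<Rightarrow> bool" where
  "has_L2_density M N \<longleftrightarrow>
     (\<exists>g :: 'a \<Rightarrow> real. g \<in> borel_measurable M \<and> (\<forall>x \<in> space M. 0 \<le> g x) \<and>
        integrable M (\<lambda>x. (g x)\<^sup>2) \<and> N = density M (\<lambda>x. ennreal (g x)))"

end

theory Submission
  imports Defs
begin

text \<open>The lower bound on \<open>p\<close> forces the images of a large ball under distinct maps of the system
to be a positive distance apart, so a set of diameter \<open>d\<close> has \<open>\<nu>\<close>-measure at most a constant times
\<open>d powr D\<close> (\<open>frostman\<close>). Hence every set of positive measure has Hausdorff dimension at least \<open>D\<close>, and
the Riesz energies of order below \<open>D\<close> are finite. In the other direction self-similarity multiplies the
\<open>\<alpha>\<close>-energy by at least \<open>r powr (D - \<alpha>)\<close>, which exceeds 1 for \<open>\<alpha> > D\<close>, so that energy is infinite; and the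
attractor is covered by \<open>(p + 1) ^ n\<close> sets of diameter comparable to \<open>r ^ n\<close>, which bounds its dimension
and makes it a Lebesgue null set.

For the projection to the line spanned by a unit vector \<open>u\<close> it is enough that \<open>F (t u)\<close> is integrable in \<open>t\<close>,
where \<open>F\<close> is the squared modulus of the Fourier transform of \<open>\<nu>\<close> (\<open>L2_ft_imp_L2_density\<close>). Self-similarity
and the Cauchy--Schwarz inequality bound \<open>F (t u)\<close> by the average, over all words of length \<open>n\<close> in the
generators, of \<open>F\<close> at the points \<open>(r ^ n * t) v\<close>, where \<open>v\<close> is the image of \<open>u\<close> under the conjugate of the
product of the word, divided by \<open>p powr (n / 2)\<close>. Two arithmetic facts enter:

  \<^item> The products are integer quaternions of norm \<open>p ^ n\<close>. Distinct ones differ by a vector of length at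
    least 1, so the resulting directions \<open>v\<close> are \<open>p powr (- n / 2)\<close>-separated (\<open>directions_separated\<close>).
  \<^item> A given quaternion of norm \<open>p ^ n\<close> is the product of at most \<open>2 ^ n * p powr (n / 2)\<close> words
    (\<open>word_count_le_sqrt\<close>), because a quaternion that \<open>p\<close> does not divide has at most one generator as left
    factor (\<open>left_divisor_unique\<close>).

So at frequencies of size \<open>\<rho> = p powr (n / 2)\<close> the points \<open>s v\<close> are 1-separated. Since \<open>\<nu>\<close> has compact support,
its Fourier transform varies at unit scale only, and the sum of \<open>F\<close> over such points, integrated over \<open>s\<close>
from \<open>\<rho>\<close> to \<open>K \<rho>\<close>, is at most a constant times the integral of \<open>F\<close> over a ball of radius comparable to \<open>\<rho>\<close>.
The latter is at most a constant times \<open>\<rho> powr (4 - \<alpha>)\<close> times the \<open>\<alpha>\<close>-energy (\<open>sphere_sieve\<close>). Altogether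
the integral of \<open>F (t u)\<close> over the \<open>n\<close>-th of the intervals \<open>[K ^ n, K ^ (n + 1)]\<close>, where \<open>K = sqrt p / r\<close>, is at
most a constant times \<open>\<theta> ^ n\<close> with
\<open>\<theta> = 2 * sqrt p * sqrt p powr (4 - \<alpha>) / (r * (p + 1))\<close>. As \<open>\<alpha>\<close> tends to \<open>D\<close>, this is roughly
\<open>2 * p powr (- (D\<^sup>2 - 3 * D - 2) / (2 * D))\<close>, and it is less than 1 for a suitable \<open>\<alpha> < D\<close> because
\<open>D\<^sup>2 - 3 * D > 3\<close> and \<open>p\<close> is large (\<open>ft_line_square_integrable\<close>).\<close>

section \<open>Fourier transforms of finite measures and Gaussian weights\<close>

definition ft :: "'a::euclidean_space measure \<Rightarrow> 'a \<Rightarrow> complex" where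
  "ft M \<xi> = (\<integral>x. cis (\<xi> \<bullet> x) \<partial>M)"

lemma measurable_cis_inner [measurable]:
  "(\<lambda>x. cis (f x \<bullet> g x)) \<in> borel_measurable M"
  if [measurable]: "f \<in> borel_measurable M" "g \<in> borel_measurable M"
  for f g :: "'b \<Rightarrow> 'a::euclidean_space"
proof -
  have [measurable]: "cis \<in> borel_measurable borel"
    by (intro borel_measurable_continuous_onI continuous_intros)
  show ?thesis by measurable
qed

lemma borel_measurable_ft [measurable]:
  assumes "sigma_finite_measure M" and [measurable_cong]: "sets M = sets borel"
  shows "ft M \<in> borel_measurable borel"
proof -
  interpret sigma_finite_measure M by fact
  show ?thesis unfolding ft_def by measurable
qed

lemma gauss_fourier_1d:
  fixes z \<sigma> :: real assumes "\<sigma> > 0"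
  shows "integrable lborel (\<lambda>t. exp (- t\<^sup>2 / (2 * \<sigma>\<^sup>2)))"
    and "(\<integral>t. exp (- t\<^sup>2 / (2 * \<sigma>\<^sup>2)) *\<^sub>R cis (z * t) \<partial>lborel)
       = complex_of_real (sqrt (2 * pi) * \<sigma> * exp (- \<sigma>\<^sup>2 * z\<^sup>2 / 2))"
proof -
  have nd: "exp (- t\<^sup>2 / (2 * \<sigma>\<^sup>2)) = (sqrt (2 * pi) * \<sigma>) * normal_density 0 \<sigma> t" for t
    using assms by (simp add: normal_density_def real_sqrt_mult)
  show "integrable lborel (\<lambda>t. exp (- t\<^sup>2 / (2 * \<sigma>\<^sup>2)))"
    unfolding nd by (intro integrable_mult_right integrable_normal_density assms)
  have "complex_of_real (exp (- (\<sigma> * z)\<^sup>2 / 2)) = char std_normal_distribution (\<sigma> * z)"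
    by (simp add: char_std_normal_distribution)
  also have "\<dots> = (\<integral>x. std_normal_density x *\<^sub>R cis (\<sigma> * z * x) \<partial>lborel)"
    unfolding char_def by (subst integral_density) (auto simp: cis_conv_exp)
  also have "\<dots> = (\<integral>x. (1 / sqrt (2 * pi)) *\<^sub>R (exp (- (0 + \<sigma> * x)\<^sup>2 / (2 * \<sigma>\<^sup>2)) *\<^sub>R cis (z * (0 + \<sigma> * x))) \<partial>lborel)"
    using assms
    by (intro Bochner_Integration.integral_cong) (auto simp: std_normal_density_def power_mult_distrib mult_ac)
  also have "\<dots> = (1 / sqrt (2 * pi)) *\<^sub>R (\<integral>x. (exp (- (0 + \<sigma> * x)\<^sup>2 / (2 * \<sigma>\<^sup>2)) *\<^sub>R cis (z * (0 + \<sigma> * x))) \<partial>lborel)"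
    by (rule integral_scaleR_right)
  finally have 1: "complex_of_real (exp (- (\<sigma> * z)\<^sup>2 / 2)) =
     (1 / sqrt (2 * pi)) *\<^sub>R (\<integral>x. (exp (- (0 + \<sigma> * x)\<^sup>2 / (2 * \<sigma>\<^sup>2)) *\<^sub>R cis (z * (0 + \<sigma> * x))) \<partial>lborel)" .
  have "(\<integral>t. exp (- t\<^sup>2 / (2 * \<sigma>\<^sup>2)) *\<^sub>R cis (z * t) \<partial>lborel)
     = \<bar>\<sigma>\<bar> *\<^sub>R (\<integral>x. (exp (- (0 + \<sigma> * x)\<^sup>2 / (2 * \<sigma>\<^sup>2)) *\<^sub>R cis (z * (0 + \<sigma> * x))) \<partial>lborel)"
    using assms by (intro lborel_integral_real_affine) auto
  also have "\<dots> = (sqrt (2 * pi) * \<sigma>) *\<^sub>R complex_of_real (exp (- (\<sigma> * z)\<^sup>2 / 2))"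
    unfolding 1 using assms by simp
  finally show "(\<integral>t. exp (- t\<^sup>2 / (2 * \<sigma>\<^sup>2)) *\<^sub>R cis (z * t) \<partial>lborel)
       = complex_of_real (sqrt (2 * pi) * \<sigma> * exp (- \<sigma>\<^sup>2 * z\<^sup>2 / 2))"
    by (simp add: power_mult_distrib scaleR_conv_of_real)
qed

text \<open>The Gaussian and the character both factor over the coordinates, so this is a product of
one-dimensional integrals.\<close>

lemma gauss_fourier:
  fixes z :: "'a::euclidean_space" assumes "\<sigma> > 0"
  shows "integrable lborel (\<lambda>t::'a. exp (- (norm t)\<^sup>2 / (2 * \<sigma>\<^sup>2)))" (is ?A)
    and "(\<integral>t. exp (- (norm t)\<^sup>2 / (2 * \<sigma>\<^sup>2)) *\<^sub>R cis (z \<bullet> t) \<partial>lborel)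
       = complex_of_real ((sqrt (2 * pi) * \<sigma>) ^ DIM('a) * exp (- \<sigma>\<^sup>2 * (norm z)\<^sup>2 / 2))" (is ?B)
proof -
  interpret product_sigma_finite "\<lambda>b::'a. lborel :: real measure" ..
  have n2: "(norm t)\<^sup>2 = (\<Sum>b\<in>Basis. (t \<bullet> b)\<^sup>2)" for t :: 'a
    unfolding power2_norm_eq_inner by (subst euclidean_inner) (simp add: power2_eq_square)
  have prod: "exp (- (norm t)\<^sup>2 / (2 * \<sigma>\<^sup>2)) = (\<Prod>b\<in>Basis. exp (- (t \<bullet> b)\<^sup>2 / (2 * \<sigma>\<^sup>2)))" for t :: 'a
    unfolding n2 by (simp add: exp_sum[symmetric] sum_negf sum_divide_distrib)
  have cis_sum: "cis (\<Sum>b\<in>B. h b) = (\<Prod>b\<in>B. cis (h b))" if "finite B" for B :: "'a set" and h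
    using that by induction (auto simp: cis_mult[symmetric])
  have prod': "exp (- (norm t)\<^sup>2 / (2 * \<sigma>\<^sup>2)) *\<^sub>R cis (z \<bullet> t)
     = (\<Prod>b\<in>Basis. exp (- (t \<bullet> b)\<^sup>2 / (2 * \<sigma>\<^sup>2)) *\<^sub>R cis ((z \<bullet> b) * (t \<bullet> b)))" for t
    unfolding prod euclidean_inner[of z t] scaleR_conv_of_real by (simp add: cis_sum prod.distrib)
  have int: "integrable lborel (\<lambda>x. exp (- x\<^sup>2 / (2 * \<sigma>\<^sup>2)) *\<^sub>R cis (c * x))" for c
    by (rule Bochner_Integration.integrable_bound[OF gauss_fourier_1d(1)[OF assms]])
      (auto simp: cis_conv_exp)
  have "integrable (\<Pi>\<^sub>M b\<in>Basis. lborel) (\<lambda>x. \<Prod>b\<in>(Basis::'a set). exp (- (x b)\<^sup>2 / (2 * \<sigma>\<^sup>2)))"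
    by (rule product_integrable_prod) (auto intro!: gauss_fourier_1d(1)[OF assms, simplified])
  thus ?A
    unfolding prod lborel_eq[where 'a='a]
    by (subst integrable_distr_eq) (auto cong: prod.cong)
  have "(\<integral>t. exp (- (norm t)\<^sup>2 / (2 * \<sigma>\<^sup>2)) *\<^sub>R cis (z \<bullet> t) \<partial>lborel)
     = (\<integral>f. (\<Prod>b\<in>Basis. exp (- (f b)\<^sup>2 / (2 * \<sigma>\<^sup>2)) *\<^sub>R cis ((z \<bullet> b) * f b)) \<partial>(\<Pi>\<^sub>M b\<in>Basis. lborel))"
    unfolding prod' lborel_eq[where 'a='a]
    by (subst integral_distr) (auto simp: cis_conv_exp cong: prod.cong)
  also have "\<dots> = (\<Prod>b\<in>Basis. (\<integral>x. exp (- x\<^sup>2 / (2 * \<sigma>\<^sup>2)) *\<^sub>R cis ((z \<bullet> b) * x) \<partial>lborel))"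
    by (rule product_integral_prod) (simp, rule int)
  also have "\<dots> = complex_of_real ((sqrt (2 * pi) * \<sigma>) ^ DIM('a) * exp (- \<sigma>\<^sup>2 * (norm z)\<^sup>2 / 2))"
  proof -
    have "exp (- \<sigma>\<^sup>2 * (norm z)\<^sup>2 / 2) = exp (\<Sum>b\<in>Basis. - \<sigma>\<^sup>2 * (z \<bullet> b)\<^sup>2 / 2)"
      unfolding n2 by (simp add: sum_distrib_left sum_divide_distrib sum_negf)
    also have "\<dots> = (\<Prod>b\<in>Basis. exp (- \<sigma>\<^sup>2 * (z \<bullet> b)\<^sup>2 / 2))" by (rule exp_sum) simp
    finally have "(\<Prod>b\<in>Basis. sqrt (2 * pi) * \<sigma> * exp (- \<sigma>\<^sup>2 * (z \<bullet> b)\<^sup>2 / 2))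
        = (sqrt (2 * pi) * \<sigma>) ^ DIM('a) * exp (- \<sigma>\<^sup>2 * (norm z)\<^sup>2 / 2)"
      by (simp only: prod.distrib prod_constant power_mult_distrib)
    thus ?thesis unfolding gauss_fourier_1d(2)[OF assms] of_real_prod[symmetric] by (simp only:)
  qed
  finally show ?B .
qed

lemma gauss_nn_integral:
  assumes "\<sigma> > 0"
  shows "(\<integral>\<^sup>+t. ennreal (exp (- (norm (t::'a::euclidean_space))\<^sup>2 / (2 * \<sigma>\<^sup>2))) \<partial>lborel) = ennreal ((sqrt (2 * pi) * \<sigma>) ^ DIM('a))"
proof -
  have "complex_of_real (\<integral>t. exp (- (norm (t::'a))\<^sup>2 / (2 * \<sigma>\<^sup>2)) \<partial>lborel)
      = (\<integral>t. complex_of_real (exp (- (norm (t::'a))\<^sup>2 / (2 * \<sigma>\<^sup>2))) \<partial>lborel)"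
    by (rule integral_complex_of_real[symmetric])
  also have "\<dots> = complex_of_real ((sqrt (2 * pi) * \<sigma>) ^ DIM('a))"
    using gauss_fourier(2)[OF assms, of "0::'a"] by (simp add: scaleR_conv_of_real)
  finally have "(\<integral>t. exp (- (norm (t::'a))\<^sup>2 / (2 * \<sigma>\<^sup>2)) \<partial>lborel) = (sqrt (2 * pi) * \<sigma>) ^ DIM('a)"
    using of_real_eq_iff by blast
  thus ?thesis
    by (subst nn_integral_eq_integral[OF gauss_fourier(1)[OF assms]]) auto
qed

text \<open>The squared modulus of the transform is the transform of the difference of two independent points, and
integrating it against a Gaussian turns the character into a Gaussian of inverse width. This converts
an average of the transform over frequencies up to \<open>\<sigma>\<close> into an energy of \<open>M\<close> at scale \<open>1 / \<sigma>\<close>.\<close>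

lemma gauss_weighted_ft:
  fixes M :: "'a::euclidean_space measure"
  assumes M: "finite_measure M" "sets M = sets borel" and \<sigma>: "\<sigma> > 0"
  shows "(\<integral>\<^sup>+\<xi>. ennreal ((norm (ft M \<xi>))\<^sup>2 * exp (- (norm \<xi>)\<^sup>2 / (2 * \<sigma>\<^sup>2))) \<partial>lborel)
       = ennreal ((sqrt (2 * pi) * \<sigma>) ^ DIM('a)) *
         (\<integral>\<^sup>+x. \<integral>\<^sup>+y. ennreal (exp (- \<sigma>\<^sup>2 * (dist x y)\<^sup>2 / 2)) \<partial>M \<partial>M)"
proof -
  interpret finite_measure M by fact
  note [measurable_cong] = M(2)
  interpret P: pair_sigma_finite M M ..
  interpret PF: finite_measure "M \<Otimes>\<^sub>M M" by (rule finite_measure_pair_measure) unfold_locales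
  interpret PP: pair_sigma_finite lborel "M \<Otimes>\<^sub>M M" ..
  let ?g = "\<lambda>\<xi>::'a. exp (- (norm \<xi>)\<^sup>2 / (2 * \<sigma>\<^sup>2))"
  let ?c = "(sqrt (2 * pi) * \<sigma>) ^ DIM('a)"
  have [measurable]: "ft M \<in> borel_measurable borel"
    by (rule borel_measurable_ft) (auto simp: M sigma_finite_measure_axioms)
  have sq: "complex_of_real ((norm (ft M \<xi>))\<^sup>2) = (\<integral>z. cis (\<xi> \<bullet> (fst z - snd z)) \<partial>(M \<Otimes>\<^sub>M M))" for \<xi>
  proof -
    have "complex_of_real ((norm (ft M \<xi>))\<^sup>2) = ft M \<xi> * cnj (ft M \<xi>)"
      by (rule complex_norm_square)
    also have "\<dots> = (\<integral>x. cis (\<xi> \<bullet> x) * cnj (ft M \<xi>) \<partial>M)"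
      unfolding ft_def by (rule integral_mult_left_zero[symmetric])
    also have "cnj (ft M \<xi>) = (\<integral>y. cnj (cis (\<xi> \<bullet> y)) \<partial>M)"
      unfolding ft_def by simp
    also have "(\<integral>x. cis (\<xi> \<bullet> x) * (\<integral>y. cnj (cis (\<xi> \<bullet> y)) \<partial>M) \<partial>M)
        = (\<integral>x. (\<integral>y. cis (\<xi> \<bullet> x) * cnj (cis (\<xi> \<bullet> y)) \<partial>M) \<partial>M)"
      by (simp only: integral_mult_right_zero)
    also have "\<dots> = (\<integral>x. (\<integral>y. cis (\<xi> \<bullet> (fst (x,y) - snd (x,y))) \<partial>M) \<partial>M)"
      by (simp add: cis_cnj cis_mult inner_diff_right)
    also have "\<dots> = (\<integral>z. cis (\<xi> \<bullet> (fst z - snd z)) \<partial>(M \<Otimes>\<^sub>M M))"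
      by (rule P.integral_fst') (auto intro!: PF.integrable_const_bound[where B=1])
    finally show ?thesis .
  qed
  have gi: "integrable lborel ?g" by (rule gauss_fourier(1)[OF \<sigma>])
  have int: "integrable (lborel \<Otimes>\<^sub>M (M \<Otimes>\<^sub>M M)) (\<lambda>(\<xi>,z). ?g \<xi> *\<^sub>R cis (\<xi> \<bullet> (fst z - snd z)))"
  proof (rule PP.Fubini_integrable)
    show "integrable lborel (\<lambda>\<xi>. \<integral>z. norm (case (\<xi>,z) of (\<xi>, z) \<Rightarrow> ?g \<xi> *\<^sub>R cis (\<xi> \<bullet> (fst z - snd z))) \<partial>(M \<Otimes>\<^sub>M M))"
      using gi by simp
    show "AE \<xi> in lborel. integrable (M \<Otimes>\<^sub>M M) (\<lambda>z. case (\<xi>,z) of (\<xi>, z) \<Rightarrow> ?g \<xi> *\<^sub>R cis (\<xi> \<bullet> (fst z - snd z)))"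
      by (intro AE_I2) (simp, intro integrable_scaleR_right impI PF.integrable_const_bound[where B=1], auto)
  qed measurable
  have eq1: "complex_of_real ((norm (ft M \<xi>))\<^sup>2 * ?g \<xi>) = (\<integral>z. ?g \<xi> *\<^sub>R cis (\<xi> \<bullet> (fst z - snd z)) \<partial>(M \<Otimes>\<^sub>M M))" for \<xi>
    unfolding integral_scaleR_right sq[symmetric] by (simp add: scaleR_conv_of_real)
  have eq2: "(\<integral>\<xi>. ?g \<xi> *\<^sub>R cis (\<xi> \<bullet> w) \<partial>lborel) = complex_of_real (?c * exp (- \<sigma>\<^sup>2 * (norm w)\<^sup>2 / 2))" for w
  proof -
    have *: "(\<lambda>\<xi>. ?g \<xi> *\<^sub>R cis (\<xi> \<bullet> w)) = (\<lambda>\<xi>. ?g \<xi> *\<^sub>R cis (w \<bullet> \<xi>))"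
      by (rule ext, subst inner_commute, rule refl)
    show ?thesis unfolding * by (rule gauss_fourier(2)[OF \<sigma>])
  qed
  have "(\<integral>\<xi>. complex_of_real ((norm (ft M \<xi>))\<^sup>2 * ?g \<xi>) \<partial>lborel)
      = (\<integral>\<xi>. (\<integral>z. ?g \<xi> *\<^sub>R cis (\<xi> \<bullet> (fst z - snd z)) \<partial>(M \<Otimes>\<^sub>M M)) \<partial>lborel)"
    unfolding eq1 ..
  also have "\<dots> = (\<integral>z. (\<integral>\<xi>. ?g \<xi> *\<^sub>R cis (\<xi> \<bullet> (fst z - snd z)) \<partial>lborel) \<partial>(M \<Otimes>\<^sub>M M))"
    by (rule PP.Fubini_integral[symmetric, OF int])
  also have "\<dots> = (\<integral>z. complex_of_real (?c * exp (- \<sigma>\<^sup>2 * (norm (fst z - snd z))\<^sup>2 / 2)) \<partial>(M \<Otimes>\<^sub>M M))"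
    unfolding eq2 ..
  finally have "(\<integral>\<xi>. ((norm (ft M \<xi>))\<^sup>2 * ?g \<xi>) \<partial>lborel) = (\<integral>z. (?c * exp (- \<sigma>\<^sup>2 * (norm (fst z - snd z))\<^sup>2 / 2)) \<partial>(M \<Otimes>\<^sub>M M))"
    unfolding integral_complex_of_real using of_real_eq_iff by blast
  moreover have "integrable lborel (\<lambda>\<xi>. (norm (ft M \<xi>))\<^sup>2 * ?g \<xi>)"
  proof (rule Bochner_Integration.integrable_bound)
    show "integrable lborel (\<lambda>\<xi>::'a. (measure M (space M))\<^sup>2 * ?g \<xi>)" using gi by simp
    have "norm (ft M \<xi>) \<le> measure M (space M)" for \<xi>
      unfolding ft_def using integral_norm_bound[of M "\<lambda>x. cis (\<xi> \<bullet> x)"] by simp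
    thus "AE \<xi> in lborel. norm ((norm (ft M \<xi>))\<^sup>2 * ?g \<xi>) \<le> norm ((measure M (space M))\<^sup>2 * ?g \<xi>)"
      by (intro AE_I2) (auto intro!: mult_right_mono power_mono)
  qed auto
  ultimately have "(\<integral>\<^sup>+\<xi>. ennreal ((norm (ft M \<xi>))\<^sup>2 * ?g \<xi>) \<partial>lborel) = ennreal (\<integral>z. (?c * exp (- \<sigma>\<^sup>2 * (norm (fst z - snd z))\<^sup>2 / 2)) \<partial>(M \<Otimes>\<^sub>M M))"
    by (subst nn_integral_eq_integral) auto
  also have "\<dots> = (\<integral>\<^sup>+z. ennreal (?c * exp (- \<sigma>\<^sup>2 * (norm (fst z - snd z))\<^sup>2 / 2)) \<partial>(M \<Otimes>\<^sub>M M))"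
  proof (intro nn_integral_eq_integral[symmetric] PF.integrable_const_bound[where B="?c"] AE_I2)
    fix z :: "'a \<times> 'a"
    have "?c * exp (- \<sigma>\<^sup>2 * (norm (fst z - snd z))\<^sup>2 / 2) \<le> ?c * 1"
      using \<sigma> by (intro mult_left_mono) auto
    thus "norm (?c * exp (- \<sigma>\<^sup>2 * (norm (fst z - snd z))\<^sup>2 / 2)) \<le> ?c" using \<sigma> by simp
  qed (use \<sigma> in auto)
  also have "\<dots> = (\<integral>\<^sup>+z. ennreal ?c * ennreal (exp (- \<sigma>\<^sup>2 * (norm (fst z - snd z))\<^sup>2 / 2)) \<partial>(M \<Otimes>\<^sub>M M))"
    using \<sigma> by (intro nn_integral_cong ennreal_mult) auto
  also have "\<dots> = ennreal ?c * (\<integral>\<^sup>+z. ennreal (exp (- \<sigma>\<^sup>2 * (norm (fst z - snd z))\<^sup>2 / 2)) \<partial>(M \<Otimes>\<^sub>M M))"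
    by (rule nn_integral_cmult) auto
  also have "(\<integral>\<^sup>+z. ennreal (exp (- \<sigma>\<^sup>2 * (norm (fst z - snd z))\<^sup>2 / 2)) \<partial>(M \<Otimes>\<^sub>M M))
     = (\<integral>\<^sup>+x. \<integral>\<^sup>+y. ennreal (exp (- \<sigma>\<^sup>2 * (dist x y)\<^sup>2 / 2)) \<partial>M \<partial>M)"
  proof -
    have "(\<integral>\<^sup>+x. \<integral>\<^sup>+y. (\<lambda>z. ennreal (exp (- \<sigma>\<^sup>2 * (norm (fst z - snd z))\<^sup>2 / 2))) (x, y) \<partial>M \<partial>M)
        = (\<integral>\<^sup>+z. ennreal (exp (- \<sigma>\<^sup>2 * (norm (fst z - snd z))\<^sup>2 / 2)) \<partial>(M \<Otimes>\<^sub>M M))"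
      by (rule nn_integral_fst) measurable
    thus ?thesis by (simp only: fst_conv snd_conv dist_norm)
  qed
  finally show ?thesis .
qed

lemma Cauchy_Schwarz_gauss:
  fixes h :: "'a::euclidean_space \<Rightarrow> complex"
  assumes [measurable]: "h \<in> borel_measurable borel" and B: "\<And>x. norm (h x) \<le> B"
  shows "ennreal ((norm (\<integral>\<zeta>. exp (- (norm \<zeta>)\<^sup>2 / 2) *\<^sub>R h \<zeta> \<partial>lborel))\<^sup>2)
    \<le> ennreal (sqrt (2 * pi) ^ DIM('a)) * (\<integral>\<^sup>+\<zeta>. ennreal (exp (- (norm \<zeta>)\<^sup>2 / 2) * (norm (h \<zeta>))\<^sup>2) \<partial>lborel)"
proof -
  let ?e = "\<lambda>\<zeta>::'a. exp (- (norm \<zeta>)\<^sup>2 / 4)"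
  have e2: "exp (- (norm \<zeta>)\<^sup>2 / 2) = ?e \<zeta> * ?e \<zeta>" for \<zeta> by (simp flip: exp_add)
  have gi: "integrable lborel (\<lambda>\<zeta>::'a. exp (- (norm \<zeta>)\<^sup>2 / 2))"
    using gauss_fourier(1)[of 1] by simp
  have gn: "(\<integral>\<^sup>+\<zeta>. ennreal (exp (- (norm (\<zeta>::'a))\<^sup>2 / 2)) \<partial>lborel) = ennreal (sqrt (2 * pi) ^ DIM('a))"
    using gauss_nn_integral[of 1, where 'a='a] by simp
  have hi: "integrable lborel (\<lambda>\<zeta>::'a. exp (- (norm \<zeta>)\<^sup>2 / 2) *\<^sub>R h \<zeta>)"
  proof (rule Bochner_Integration.integrable_bound)
    show "integrable lborel (\<lambda>\<zeta>::'a. B * exp (- (norm \<zeta>)\<^sup>2 / 2))" using gi by simp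
    have "0 \<le> B" using B[of 0] norm_ge_zero order_trans by blast
    thus "AE \<zeta> in lborel. norm (exp (- (norm (\<zeta>::'a))\<^sup>2 / 2) *\<^sub>R h \<zeta>) \<le> norm (B * exp (- (norm \<zeta>)\<^sup>2 / 2))"
      using B by (intro AE_I2) (auto simp: mult.commute)
  qed auto
  have "ennreal (norm (\<integral>\<zeta>. exp (- (norm \<zeta>)\<^sup>2 / 2) *\<^sub>R h \<zeta> \<partial>lborel))
      \<le> (\<integral>\<^sup>+\<zeta>. norm (exp (- (norm (\<zeta>::'a))\<^sup>2 / 2) *\<^sub>R h \<zeta>) \<partial>lborel)"
    by (rule integral_norm_bound_ennreal[OF hi])
  also have "\<dots> = (\<integral>\<^sup>+\<zeta>. ennreal (?e \<zeta>) * ennreal (?e \<zeta> * norm (h \<zeta>)) \<partial>lborel)"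
    by (intro nn_integral_cong) (simp add: e2 mult.assoc del: minus_divide_left divide_minus_left flip: ennreal_mult)
  finally have "(ennreal (norm (\<integral>\<zeta>. exp (- (norm \<zeta>)\<^sup>2 / 2) *\<^sub>R h \<zeta> \<partial>lborel)))\<^sup>2
      \<le> (\<integral>\<^sup>+\<zeta>. ennreal (?e \<zeta>) * ennreal (?e \<zeta> * norm (h \<zeta>)) \<partial>lborel)\<^sup>2"
    by (rule power_mono) simp
  also have "\<dots> \<le> (\<integral>\<^sup>+\<zeta>. (ennreal (?e \<zeta>))\<^sup>2 \<partial>lborel) * (\<integral>\<^sup>+\<zeta>. (ennreal (?e \<zeta> * norm (h \<zeta>)))\<^sup>2 \<partial>lborel)"
    by (rule Cauchy_Schwarz_nn_integral) auto
  also have "(\<integral>\<^sup>+\<zeta>. (ennreal (?e \<zeta>))\<^sup>2 \<partial>lborel) = ennreal (sqrt (2 * pi) ^ DIM('a))"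
    unfolding gn[symmetric] e2 by (intro nn_integral_cong) (simp only: power2_eq_square ennreal_mult exp_ge_zero)
  also have "(\<integral>\<^sup>+\<zeta>. (ennreal (?e \<zeta> * norm (h \<zeta>)))\<^sup>2 \<partial>lborel)
      = (\<integral>\<^sup>+\<zeta>. ennreal (exp (- (norm \<zeta>)\<^sup>2 / 2) * (norm (h \<zeta>))\<^sup>2) \<partial>lborel)"
  proof (rule nn_integral_cong)
    fix \<zeta>
    have "(?e \<zeta> * norm (h \<zeta>)) * (?e \<zeta> * norm (h \<zeta>)) = exp (- (norm \<zeta>)\<^sup>2 / 2) * (norm (h \<zeta>))\<^sup>2"
      unfolding e2 by (simp only: power2_eq_square mult_ac)
    thus "(ennreal (?e \<zeta> * norm (h \<zeta>)))\<^sup>2 = ennreal (exp (- (norm \<zeta>)\<^sup>2 / 2) * (norm (h \<zeta>))\<^sup>2)"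
      by (subst power2_eq_square) (simp only: ennreal_mult[symmetric] mult_nonneg_nonneg exp_ge_zero norm_ge_zero)
  qed
  finally show ?thesis by (simp add: ennreal_power)
qed

lemma nn_integral_lborel_reflect:
  fixes f :: "'a::euclidean_space \<Rightarrow> ennreal"
  assumes [measurable]: "f \<in> borel_measurable borel"
  shows "(\<integral>\<^sup>+x. f (a - x) \<partial>lborel) = (\<integral>\<^sup>+x. f x \<partial>lborel)"
proof -
  have "lborel = density (distr lborel borel (\<lambda>x. a + (\<Sum>j\<in>Basis. ((-1) * (x \<bullet> j)) *\<^sub>R j))) (\<lambda>_::'a. (\<Prod>j\<in>Basis. \<bar>-1::real\<bar>))"
    using lborel_affine_euclidean[where c="\<lambda>_. -1" and t=a] by simp
  also have "(\<lambda>x. a + (\<Sum>j\<in>Basis. ((-1) * (x \<bullet> j)) *\<^sub>R j)) = (\<lambda>x::'a. a - x)"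
    by (auto simp: sum_negf euclidean_representation)
  finally have "lborel = distr lborel borel (\<lambda>x::'a. a - x)" by (simp add: density_1)
  hence "(\<integral>\<^sup>+x. f x \<partial>lborel) = (\<integral>\<^sup>+x. f x \<partial>distr lborel borel (\<lambda>x::'a. a - x))" by simp
  also have "\<dots> = (\<integral>\<^sup>+x. f (a - x) \<partial>lborel)" by (subst nn_integral_distr) auto
  finally show ?thesis by simp
qed

text \<open>The reciprocal of a Gaussian, truncated to a ball that carries the measure. A measure \<open>M\<close> on that ball
is the standard Gaussian times its reweighted version, so the transform of \<open>M\<close> is the convolution of
the reweighted transform with a Gaussian; the truncation keeps the reweighted measure finite.\<close>

definition gauss_weight :: "real \<Rightarrow> 'a::euclidean_space \<Rightarrow> real" where
  "gauss_weight L x = (if norm x \<le> L then exp ((norm x)\<^sup>2 / 2) else 0)"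

lemma gauss_weight_measurable [measurable]: "gauss_weight L \<in> borel_measurable borel"
  unfolding gauss_weight_def by measurable

lemma gauss_weight_nonneg [simp]: "0 \<le> gauss_weight L x"
  by (simp add: gauss_weight_def)

lemma gauss_weight_le: "gauss_weight L x \<le> exp (L\<^sup>2 / 2)"
proof (cases "norm x \<le> L")
  case True
  hence "(norm x)\<^sup>2 \<le> L\<^sup>2" by (intro power_mono) auto
  thus ?thesis by (simp add: gauss_weight_def)
qed (simp add: gauss_weight_def)

definition gauss_reweight :: "real \<Rightarrow> 'a::euclidean_space measure \<Rightarrow> 'a measure" where
  "gauss_reweight L M = density M (\<lambda>x. ennreal (gauss_weight L x))"

lemma gauss_reweight:
  fixes M :: "'a::euclidean_space measure"
  assumes M: "finite_measure M" "sets M = sets borel"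
  shows "finite_measure (gauss_reweight L M)" and "sets (gauss_reweight L M) = sets borel"
    and "\<And>f. f \<in> borel_measurable borel \<Longrightarrow> (\<integral>\<^sup>+x. f x \<partial>gauss_reweight L M) \<le> ennreal (exp (L\<^sup>2 / 2)) * (\<integral>\<^sup>+x. f x \<partial>M)"
proof -
  interpret finite_measure M by fact
  note [measurable_cong] = M(2)
  show s: "sets (gauss_reweight L M) = sets borel" using M by (simp add: gauss_reweight_def)
  show le: "(\<integral>\<^sup>+x. f x \<partial>gauss_reweight L M) \<le> ennreal (exp (L\<^sup>2 / 2)) * (\<integral>\<^sup>+x. f x \<partial>M)"
    if [measurable]: "f \<in> borel_measurable borel" for f
  proof -
    have "(\<integral>\<^sup>+x. f x \<partial>gauss_reweight L M) = (\<integral>\<^sup>+x. ennreal (gauss_weight L x) * f x \<partial>M)"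
      unfolding gauss_reweight_def by (rule nn_integral_density) auto
    also have "\<dots> \<le> (\<integral>\<^sup>+x. ennreal (exp (L\<^sup>2 / 2)) * f x \<partial>M)"
      by (intro nn_integral_mono mult_right_mono ennreal_leI gauss_weight_le) auto
    also have "\<dots> = ennreal (exp (L\<^sup>2 / 2)) * (\<integral>\<^sup>+x. f x \<partial>M)"
      by (rule nn_integral_cmult) auto
    finally show ?thesis .
  qed
  show "finite_measure (gauss_reweight L M)"
  proof
    have "emeasure (gauss_reweight L M) (space (gauss_reweight L M)) = (\<integral>\<^sup>+x. 1 \<partial>gauss_reweight L M)" by simp
    also have "\<dots> \<le> ennreal (exp (L\<^sup>2 / 2)) * (\<integral>\<^sup>+x. 1 \<partial>M)" by (rule le) auto
    also have "\<dots> < \<infinity>" by (simp add: ennreal_mult_less_top) (simp add: less_top[symmetric])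
    finally show "emeasure (gauss_reweight L M) (space (gauss_reweight L M)) \<noteq> \<infinity>" by simp
  qed
qed

text \<open>The quantitative form of the statement that the transform of a compactly supported measure is
essentially constant at unit scale: a point value is dominated by a Gaussian average around it, at the
price of replacing \<open>M\<close> by the comparable measure \<open>gauss_reweight L M\<close>.\<close>

lemma ft_smoothing:
  fixes M :: "'a::euclidean_space measure"
  assumes M: "finite_measure M" "sets M = sets borel" and L: "AE x in M. norm x \<le> L"
  shows "ennreal ((norm (ft M \<xi>))\<^sup>2) \<le> ennreal (1 / sqrt (2 * pi) ^ DIM('a)) *
     (\<integral>\<^sup>+\<zeta>. ennreal (exp (- (norm (\<xi> - \<zeta>))\<^sup>2 / 2) * (norm (ft (gauss_reweight L M) \<zeta>))\<^sup>2) \<partial>lborel)"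
proof -
  interpret finite_measure M by fact
  note [measurable_cong] = M(2)
  let ?M' = "gauss_reweight L M"
  interpret M': finite_measure ?M' by (rule gauss_reweight(1)[OF M])
  interpret PP: pair_sigma_finite M "lborel :: 'a measure" ..
  have [measurable]: "ft ?M' \<in> borel_measurable borel"
    by (rule borel_measurable_ft) (auto simp: gauss_reweight(2)[OF M] M'.sigma_finite_measure_axioms)
  let ?c = "sqrt (2 * pi) ^ DIM('a)"
  let ?w = "gauss_weight L :: 'a \<Rightarrow> real"
  let ?g = "\<lambda>x::'a. exp (- (norm x)\<^sup>2 / 2) :: real"
  have gi: "integrable lborel ?g" using gauss_fourier(1)[of 1] by simp
  have ft': "ft ?M' \<eta> = (\<integral>x. ?w x *\<^sub>R cis (\<eta> \<bullet> x) \<partial>M)" for \<eta>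
    unfolding ft_def gauss_reweight_def by (rule integral_density) auto
  have ftB: "norm (ft ?M' \<eta>) \<le> measure ?M' (space ?M')" for \<eta>
    unfolding ft_def using integral_norm_bound[of ?M' "\<lambda>x. cis (\<eta> \<bullet> x)"] by simp
  have g: "(\<integral>\<zeta>. ?g \<zeta> *\<^sub>R cis ((\<xi> - \<zeta>) \<bullet> x) \<partial>lborel) = (?c * ?g x) *\<^sub>R cis (\<xi> \<bullet> x)" for x
  proof -
    have "(\<integral>\<zeta>. ?g \<zeta> *\<^sub>R cis ((\<xi> - \<zeta>) \<bullet> x) \<partial>lborel) = (\<integral>\<zeta>. (?g \<zeta> *\<^sub>R cis ((- x) \<bullet> \<zeta>)) * cis (\<xi> \<bullet> x) \<partial>lborel)"
      by (intro Bochner_Integration.integral_cong) (simp_all add: cis_mult inner_diff_left inner_commute[of x])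
    also have "\<dots> = (\<integral>\<zeta>. (?g \<zeta> *\<^sub>R cis ((- x) \<bullet> \<zeta>)) \<partial>lborel) * cis (\<xi> \<bullet> x)"
      by (rule integral_mult_left_zero)
    also have "\<dots> = (?c * ?g x) *\<^sub>R cis (\<xi> \<bullet> x)"
      using gauss_fourier(2)[of 1 "-x"] by (simp add: scaleR_conv_of_real)
    finally show ?thesis .
  qed
  have int: "integrable (M \<Otimes>\<^sub>M lborel) (\<lambda>(x,\<zeta>). ?w x *\<^sub>R ?g \<zeta> *\<^sub>R cis ((\<xi> - \<zeta>) \<bullet> x))"
  proof (rule PP.Fubini_integrable)
    have "integrable M (\<lambda>x. ?w x * (\<integral>\<zeta>. ?g \<zeta> \<partial>lborel))"
      by (intro integrable_mult_left integrable_const_bound[where B="exp (L\<^sup>2/2)"]) (auto intro: gauss_weight_le)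
    thus "integrable M (\<lambda>x. \<integral>\<zeta>. norm (case (x, \<zeta>) of (x, \<zeta>) \<Rightarrow> ?w x *\<^sub>R ?g \<zeta> *\<^sub>R cis ((\<xi> - \<zeta>) \<bullet> x)) \<partial>lborel)"
      by simp
    show "AE x in M. integrable lborel (\<lambda>\<zeta>. case (x, \<zeta>) of (x, \<zeta>) \<Rightarrow> ?w x *\<^sub>R ?g \<zeta> *\<^sub>R cis ((\<xi> - \<zeta>) \<bullet> x))"
    proof (rule AE_I2)
      fix x
      have "integrable lborel (\<lambda>\<zeta>. ?g \<zeta> *\<^sub>R cis ((\<xi> - \<zeta>) \<bullet> x))"
        by (rule Bochner_Integration.integrable_bound[OF gi]) auto
      thus "integrable lborel (\<lambda>\<zeta>. case (x, \<zeta>) of (x, \<zeta>) \<Rightarrow> ?w x *\<^sub>R ?g \<zeta> *\<^sub>R cis ((\<xi> - \<zeta>) \<bullet> x))"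
        unfolding split_conv by (rule integrable_scaleR_right)
    qed
  qed measurable
  have "complex_of_real ?c * ft M \<xi> = (\<integral>x. complex_of_real ?c * cis (\<xi> \<bullet> x) \<partial>M)"
    unfolding ft_def by (rule integral_mult_right_zero[symmetric])
  also have "\<dots> = (\<integral>x. ?w x *\<^sub>R (\<integral>\<zeta>. ?g \<zeta> *\<^sub>R cis ((\<xi> - \<zeta>) \<bullet> x) \<partial>lborel) \<partial>M)"
    unfolding g
  proof (rule integral_cong_AE)
    have "exp ((norm x)\<^sup>2 / 2) * exp (- (norm x)\<^sup>2 / 2) = 1" for x :: 'a by (simp flip: exp_add)
    hence *: "complex_of_real (exp ((norm x)\<^sup>2 / 2)) * complex_of_real (exp (- (norm x)\<^sup>2 / 2)) = 1" for x :: 'a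
      by (simp only: of_real_mult[symmetric] of_real_1)
    show "AE x in M. complex_of_real ?c * cis (\<xi> \<bullet> x) = ?w x *\<^sub>R (?c * ?g x) *\<^sub>R cis (\<xi> \<bullet> x)"
      using L
    proof eventually_elim
      case (elim x)
      have "?w x *\<^sub>R (?c * ?g x) *\<^sub>R cis (\<xi> \<bullet> x) = complex_of_real ?c * cis (\<xi> \<bullet> x)
         * (complex_of_real (exp ((norm x)\<^sup>2 / 2)) * complex_of_real (exp (- (norm x)\<^sup>2 / 2)))"
        using elim by (simp only: gauss_weight_def if_True scaleR_conv_of_real of_real_mult mult_ac)
      thus ?case unfolding * by simp
    qed
  qed measurable
  also have "\<dots> = (\<integral>x. (\<integral>\<zeta>. ?w x *\<^sub>R ?g \<zeta> *\<^sub>R cis ((\<xi> - \<zeta>) \<bullet> x) \<partial>lborel) \<partial>M)"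
    by (subst integral_scaleR_right) (rule refl)
  also have "\<dots> = (\<integral>\<zeta>. (\<integral>x. ?w x *\<^sub>R ?g \<zeta> *\<^sub>R cis ((\<xi> - \<zeta>) \<bullet> x) \<partial>M) \<partial>lborel)"
    by (rule PP.Fubini_integral[OF int, symmetric])
  also have "\<dots> = (\<integral>\<zeta>. (\<integral>x. ?g \<zeta> *\<^sub>R ?w x *\<^sub>R cis ((\<xi> - \<zeta>) \<bullet> x) \<partial>M) \<partial>lborel)"
    by (simp add: mult.commute)
  also have "\<dots> = (\<integral>\<zeta>. ?g \<zeta> *\<^sub>R ft ?M' (\<xi> - \<zeta>) \<partial>lborel)"
    by (subst integral_scaleR_right) (simp add: ft')
  finally have eq: "complex_of_real ?c * ft M \<xi> = (\<integral>\<zeta>. ?g \<zeta> *\<^sub>R ft ?M' (\<xi> - \<zeta>) \<partial>lborel)" .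
  have "ennreal ((norm (complex_of_real ?c * ft M \<xi>))\<^sup>2) \<le> ennreal ?c * (\<integral>\<^sup>+\<zeta>. ennreal (?g \<zeta> * (norm (ft ?M' (\<xi> - \<zeta>)))\<^sup>2) \<partial>lborel)"
    unfolding eq by (rule Cauchy_Schwarz_gauss) (auto intro: ftB)
  also have "(\<integral>\<^sup>+\<zeta>. ennreal (?g \<zeta> * (norm (ft ?M' (\<xi> - \<zeta>)))\<^sup>2) \<partial>lborel)
      = (\<integral>\<^sup>+\<zeta>. (\<lambda>\<eta>. ennreal (?g (\<xi> - \<eta>) * (norm (ft ?M' \<eta>))\<^sup>2)) (\<xi> - \<zeta>) \<partial>lborel)" by simp
  also have "\<dots> = (\<integral>\<^sup>+\<zeta>. ennreal (?g (\<xi> - \<zeta>) * (norm (ft ?M' \<zeta>))\<^sup>2) \<partial>lborel)"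
    by (rule nn_integral_lborel_reflect) simp
  finally have le: "ennreal ((norm (complex_of_real ?c * ft M \<xi>))\<^sup>2) \<le> ennreal ?c * (\<integral>\<^sup>+\<zeta>. ennreal (?g (\<xi> - \<zeta>) * (norm (ft ?M' \<zeta>))\<^sup>2) \<partial>lborel)" .
  have c: "?c > 0" by simp
  have "ennreal ((norm (ft M \<xi>))\<^sup>2) = ennreal (1 / ?c\<^sup>2) * ennreal ((norm (complex_of_real ?c * ft M \<xi>))\<^sup>2)"
    using c by (simp add: norm_mult norm_power power_mult_distrib field_simps flip: ennreal_mult)
  also have "\<dots> \<le> ennreal (1 / ?c\<^sup>2) * (ennreal ?c * (\<integral>\<^sup>+\<zeta>. ennreal (?g (\<xi> - \<zeta>) * (norm (ft ?M' \<zeta>))\<^sup>2) \<partial>lborel))"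
    by (intro mult_left_mono le) auto
  also have "\<dots> = ennreal (1 / ?c) * (\<integral>\<^sup>+\<zeta>. ennreal (?g (\<xi> - \<zeta>) * (norm (ft ?M' \<zeta>))\<^sup>2) \<partial>lborel)"
    using c by (simp add: power2_eq_square mult.assoc[symmetric] flip: ennreal_mult)
  finally show ?thesis .
qed

section \<open>A sieve inequality on spheres\<close>

text \<open>Balls of radius \<open>1 / 2\<close> around 1-separated points are disjoint, and on such a ball a slightly wider
Gaussian dominates the value at the centre; so the sum is at most a constant times a Gaussian integral.\<close>

lemma separated_gauss_sum:
  "\<exists>C>0. \<forall>X (\<xi>::'a::euclidean_space). finite X \<longrightarrow> (\<forall>v\<in>X. \<forall>w\<in>X. v \<noteq> w \<longrightarrow> 1 \<le> dist v w) \<longrightarrow>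
     (\<Sum>v\<in>X. exp (- (dist v \<xi>)\<^sup>2 / 6)) \<le> C"
proof -
  define vol where "vol = measure lborel (ball (0::'a) (1/2))"
  have vol: "emeasure lborel (ball v (1/2)) = ennreal vol" for v :: 'a
    by (simp add: vol_def emeasure_ball content_ball)
  have vol0: "vol > 0" unfolding vol_def by (simp add: content_ball_pos)
  define C where "C = exp (1/24) * (sqrt (2 * pi) * sqrt 6) ^ DIM('a) / vol"
  have "(\<Sum>v\<in>X. exp (- (dist v \<xi>)\<^sup>2 / 6)) \<le> C"
    if X: "finite X" and sep: "\<forall>v\<in>X. \<forall>w\<in>X. v \<noteq> w \<longrightarrow> 1 \<le> dist v w" for X and \<xi> :: 'a
  proof -
    let ?h = "\<lambda>\<eta>. exp (1/24) * exp (- (norm (\<xi> - \<eta>))\<^sup>2 / 12) :: real"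
    have pt: "exp (- (dist v \<xi>)\<^sup>2 / 6) \<le> ?h \<eta>" if "\<eta> \<in> ball v (1/2)" for v \<eta>
    proof -
      have "norm (\<xi> - \<eta>) \<le> dist v \<xi> + 1/2"
        using that dist_triangle[of \<xi> \<eta> v] by (auto simp: dist_norm norm_minus_commute)
      hence "(norm (\<xi> - \<eta>))\<^sup>2 \<le> (dist v \<xi> + 1/2)\<^sup>2" by (intro power_mono) auto
      also have "\<dots> \<le> 2 * (dist v \<xi>)\<^sup>2 + 1/2"
        using zero_le_power2[of "dist v \<xi> - 1/2"] by (simp add: power2_eq_square algebra_simps)
      finally show ?thesis by (simp flip: exp_add)
    qed
    have [measurable]: "ball v (1/2) \<in> sets borel" for v :: 'a by simp
    have "ennreal ((\<Sum>v\<in>X. exp (- (dist v \<xi>)\<^sup>2 / 6)) * vol) = (\<Sum>v\<in>X. ennreal (exp (- (dist v \<xi>)\<^sup>2 / 6)) * ennreal vol)"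
      using vol0 by (simp add: sum_distrib_right sum_ennreal flip: ennreal_mult)
    also have "\<dots> = (\<Sum>v\<in>X. \<integral>\<^sup>+\<eta>. ennreal (exp (- (dist v \<xi>)\<^sup>2 / 6)) * indicator (ball v (1/2)) \<eta> \<partial>lborel)"
      by (simp add: vol nn_integral_cmult_indicator)
    also have "\<dots> \<le> (\<Sum>v\<in>X. \<integral>\<^sup>+\<eta>. ennreal (?h \<eta>) * indicator (ball v (1/2)) \<eta> \<partial>lborel)"
    proof (intro sum_mono nn_integral_mono)
      fix v \<eta> show "ennreal (exp (- (dist v \<xi>)\<^sup>2 / 6)) * indicator (ball v (1/2)) \<eta> \<le> ennreal (?h \<eta>) * indicator (ball v (1/2)) \<eta>"
        using pt[of \<eta> v] by (cases "\<eta> \<in> ball v (1/2)") (auto intro!: ennreal_leI)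
    qed
    also have "\<dots> = (\<integral>\<^sup>+\<eta>. (\<Sum>v\<in>X. ennreal (?h \<eta>) * indicator (ball v (1/2)) \<eta>) \<partial>lborel)"
      by (rule nn_integral_sum[symmetric]) measurable
    also have "\<dots> \<le> (\<integral>\<^sup>+\<eta>. ennreal (?h \<eta>) \<partial>lborel)"
    proof (rule nn_integral_mono)
      fix \<eta> :: 'a
      have "(\<Sum>v\<in>X. indicator (ball v (1/2)) \<eta>) = (of_nat (card {v\<in>X. \<eta> \<in> ball v (1/2)}) :: ennreal)"
        using X by (simp add: indicator_def sum.If_cases Int_def)
      also have "card {v\<in>X. \<eta> \<in> ball v (1/2)} \<le> 1"
      proof -
        have "v = w" if "v \<in> X" "w \<in> X" "\<eta> \<in> ball v (1/2)" "\<eta> \<in> ball w (1/2)" for v w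
          using sep that dist_triangle2[of v w \<eta>] by fastforce
        thus ?thesis using X by (auto simp: card_le_Suc0_iff_eq)
      qed
      hence "(of_nat (card {v\<in>X. \<eta> \<in> ball v (1/2)}) :: ennreal) \<le> of_nat 1" by (intro of_nat_mono)
      finally have "(\<Sum>v\<in>X. indicator (ball v (1/2)) \<eta>) \<le> (1::ennreal)" by simp
      hence "ennreal (?h \<eta>) * (\<Sum>v\<in>X. indicator (ball v (1/2)) \<eta>) \<le> ennreal (?h \<eta>) * 1"
        by (rule mult_left_mono) simp
      thus "(\<Sum>v\<in>X. ennreal (?h \<eta>) * indicator (ball v (1/2)) \<eta>) \<le> ennreal (?h \<eta>)"
        by (simp add: sum_distrib_left)
    qed
    also have "\<dots> = (\<integral>\<^sup>+\<eta>. ennreal (exp (1/24) * exp (- (norm (\<eta>::'a))\<^sup>2 / 12)) \<partial>lborel)"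
      by (rule nn_integral_lborel_reflect[of "\<lambda>\<eta>. ennreal (exp (1/24) * exp (- (norm \<eta>)\<^sup>2 / 12))"]) measurable
    also have "\<dots> = (\<integral>\<^sup>+\<eta>. ennreal (exp (1/24)) * ennreal (exp (- (norm (\<eta>::'a))\<^sup>2 / (2 * (sqrt 6)\<^sup>2))) \<partial>lborel)"
      by (simp add: ennreal_mult)
    also have "\<dots> = ennreal (exp (1/24)) * ennreal ((sqrt (2 * pi) * sqrt 6) ^ DIM('a))"
      using gauss_nn_integral[of "sqrt 6", where 'a='a] by (subst nn_integral_cmult) auto
    finally have "(\<Sum>v\<in>X. exp (- (dist v \<xi>)\<^sup>2 / 6)) * vol \<le> exp (1/24) * (sqrt (2 * pi) * sqrt 6) ^ DIM('a)"
      by (simp flip: ennreal_mult)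
    thus ?thesis using vol0 by (simp add: C_def field_simps)
  qed
  moreover have "C > 0" using vol0 by (simp add: C_def)
  ultimately show ?thesis by blast
qed

text \<open>For each radius \<open>s\<close> the points \<open>s v\<close> are 1-separated. The Gaussian is split into three equal
factors: one makes the sum over \<open>V\<close> bounded, one forces \<open>s\<close> to be within unit distance of the norm
of \<open>\<zeta>\<close> and thereby makes the integral over the long interval of radii bounded, and the last one
localizes \<open>\<zeta>\<close> to a ball of radius comparable to \<open>K * \<rho>\<close>.\<close>

lemma sphere_gauss_bound:
  fixes V :: "'a::euclidean_space set"
  assumes C: "\<And>X (\<xi>::'a). finite X \<Longrightarrow> (\<forall>v\<in>X. \<forall>w\<in>X. v \<noteq> w \<longrightarrow> 1 \<le> dist v w) \<Longrightarrow>
     (\<Sum>v\<in>X. exp (- (dist v \<xi>)\<^sup>2 / 6)) \<le> C"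
    and \<rho>: "1 \<le> \<rho>" and K: "1 \<le> K" and V: "finite V" "\<And>v. v \<in> V \<Longrightarrow> norm v = 1"
      "\<And>v w. v \<in> V \<Longrightarrow> w \<in> V \<Longrightarrow> v \<noteq> w \<Longrightarrow> 1 / \<rho> \<le> dist v w"
  shows "(\<integral>\<^sup>+s\<in>{\<rho>..K * \<rho>}. ennreal (\<Sum>v\<in>V. exp (- (norm (s *\<^sub>R v - \<zeta>))\<^sup>2 / 2)) \<partial>lborel)
     \<le> ennreal (C * exp (1/6) * (sqrt (2 * pi) * sqrt 3) * exp (- (norm \<zeta>)\<^sup>2 / (12 * K\<^sup>2 * \<rho>\<^sup>2)))"
proof -
  let ?E = "C * exp (1/6) * exp (- (norm \<zeta>)\<^sup>2 / (12 * K\<^sup>2 * \<rho>\<^sup>2))"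
  have C0: "0 \<le> C" using C[of "{}"] by simp
  have *: "(\<Sum>v\<in>V. exp (- (norm (s *\<^sub>R v - \<zeta>))\<^sup>2 / 2)) \<le> ?E * exp (- (norm \<zeta> - s)\<^sup>2 / 6)"
    if s: "\<rho> \<le> s" "s \<le> K * \<rho>" for s
  proof -
    have s0: "s > 0" using s \<rho> by simp
    have K\<rho>: "1 \<le> K * \<rho>" using \<rho> K by (metis mult_mono' mult_1 zero_le_one)
    hence K\<rho>2: "1 \<le> K\<^sup>2 * \<rho>\<^sup>2" using power_mono[of 1 "K * \<rho>" 2] by (simp add: power_mult_distrib)
    have pt: "exp (- (norm (s *\<^sub>R v - \<zeta>))\<^sup>2 / 2) \<le>
        exp (- (norm (s *\<^sub>R v - \<zeta>))\<^sup>2 / 6) * (exp (- (norm \<zeta> - s)\<^sup>2 / 6) * (exp (1/6) * exp (- (norm \<zeta>)\<^sup>2 / (12 * K\<^sup>2 * \<rho>\<^sup>2))))"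
      if v: "v \<in> V" for v
    proof -
      let ?d = "norm (s *\<^sub>R v - \<zeta>)"
      have ns: "norm (s *\<^sub>R v) = s" using V(2)[OF v] s0 by simp
      have "\<bar>norm \<zeta> - s\<bar> \<le> ?d" using norm_triangle_ineq3[of \<zeta> "s *\<^sub>R v"] ns by (simp add: norm_minus_commute)
      hence a: "(norm \<zeta> - s)\<^sup>2 \<le> ?d\<^sup>2" using power_mono[of "\<bar>norm \<zeta> - s\<bar>" ?d 2] by simp
      have "(norm \<zeta>)\<^sup>2 \<le> (s + ?d)\<^sup>2"
        using norm_triangle_ineq2[of \<zeta> "s *\<^sub>R v"] ns by (intro power_mono) (auto simp: norm_minus_commute)
      also have "\<dots> \<le> 2 * s\<^sup>2 + 2 * ?d\<^sup>2"
        using zero_le_power2[of "s - ?d"] by (simp add: power2_eq_square algebra_simps)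
      also have "s\<^sup>2 \<le> (K * \<rho>)\<^sup>2" using s s0 by (intro power_mono) auto
      finally have "(norm \<zeta>)\<^sup>2 \<le> 2 * (K\<^sup>2 * \<rho>\<^sup>2) + 2 * ?d\<^sup>2" by (simp add: power_mult_distrib)
      also have "?d\<^sup>2 \<le> ?d\<^sup>2 * (K\<^sup>2 * \<rho>\<^sup>2)" using K\<rho>2 by (simp add: mult_le_cancel_left1)
      finally have "(norm \<zeta>)\<^sup>2 \<le> (2 + 2 * ?d\<^sup>2) * (K\<^sup>2 * \<rho>\<^sup>2)" by (simp add: algebra_simps)
      hence "(norm \<zeta>)\<^sup>2 / (12 * (K\<^sup>2 * \<rho>\<^sup>2)) \<le> (2 + 2 * ?d\<^sup>2) / 12"
        using K\<rho>2 by (simp add: divide_simps)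
      hence "- ?d\<^sup>2 / 2 \<le> - ?d\<^sup>2 / 6 + (- (norm \<zeta> - s)\<^sup>2 / 6 + (1 / 6 + - (norm \<zeta>)\<^sup>2 / (12 * K\<^sup>2 * \<rho>\<^sup>2)))"
        using a by (simp add: mult.assoc)
      thus ?thesis unfolding exp_add[symmetric] by (simp only: exp_le_cancel_iff)
    qed
    have "(\<Sum>v\<in>V. exp (- (norm (s *\<^sub>R v - \<zeta>))\<^sup>2 / 2)) \<le> (\<Sum>v\<in>V. exp (- (norm (s *\<^sub>R v - \<zeta>))\<^sup>2 / 6)) * (exp (- (norm \<zeta> - s)\<^sup>2 / 6) * (exp (1/6) * exp (- (norm \<zeta>)\<^sup>2 / (12 * K\<^sup>2 * \<rho>\<^sup>2))))"
      unfolding sum_distrib_right by (intro sum_mono pt)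
    also have "(\<Sum>v\<in>V. exp (- (norm (s *\<^sub>R v - \<zeta>))\<^sup>2 / 6)) = (\<Sum>w\<in>(\<lambda>v. s *\<^sub>R v) ` V. exp (- (dist w \<zeta>)\<^sup>2 / 6))"
      using s0 by (subst sum.reindex) (auto simp: inj_on_def dist_norm)
    also have "\<dots> \<le> C"
    proof (rule C)
      show "\<forall>a\<in>(\<lambda>v. s *\<^sub>R v) ` V. \<forall>b\<in>(\<lambda>v. s *\<^sub>R v) ` V. a \<noteq> b \<longrightarrow> 1 \<le> dist a b"
      proof (intro ballI impI)
        fix a b assume "a \<in> (\<lambda>v. s *\<^sub>R v) ` V" "b \<in> (\<lambda>v. s *\<^sub>R v) ` V" "a \<noteq> b"
        then obtain v w where vw: "v \<in> V" "w \<in> V" "v \<noteq> w" and ab: "a = s *\<^sub>R v" "b = s *\<^sub>R w" by auto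
        have "dist a b = s * dist v w" unfolding ab dist_norm scaleR_diff_right[symmetric] using s0 by simp
        also have "\<dots> \<ge> \<rho> * (1 / \<rho>)" using V(3)[OF vw] s \<rho> by (intro mult_mono) auto
        finally show "1 \<le> dist a b" using \<rho> by simp
      qed
    qed (use V in auto)
    finally show ?thesis by (simp add: mult_ac)
  qed
  have "(\<integral>\<^sup>+s\<in>{\<rho>..K * \<rho>}. ennreal (\<Sum>v\<in>V. exp (- (norm (s *\<^sub>R v - \<zeta>))\<^sup>2 / 2)) \<partial>lborel)
     \<le> (\<integral>\<^sup>+s. ennreal ?E * ennreal (exp (- (norm (norm \<zeta> - s))\<^sup>2 / (2 * (sqrt 3)\<^sup>2))) \<partial>lborel)"
    using C0 * by (intro nn_integral_mono) (auto simp: indicator_def ennreal_mult[symmetric] intro!: ennreal_leI)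
  also have "\<dots> = ennreal ?E * (\<integral>\<^sup>+s. ennreal (exp (- (norm (norm \<zeta> - s))\<^sup>2 / (2 * (sqrt 3)\<^sup>2))) \<partial>lborel)"
    by (rule nn_integral_cmult) measurable
  also have "(\<integral>\<^sup>+s. ennreal (exp (- (norm (norm \<zeta> - s))\<^sup>2 / (2 * (sqrt 3)\<^sup>2))) \<partial>lborel)
     = (\<integral>\<^sup>+s. ennreal (exp (- (norm (s::real))\<^sup>2 / (2 * (sqrt 3)\<^sup>2))) \<partial>lborel)"
    by (rule nn_integral_lborel_reflect[of "\<lambda>s. ennreal (exp (- (norm s)\<^sup>2 / (2 * (sqrt 3)\<^sup>2)))"]) measurable
  also have "\<dots> = ennreal (sqrt (2 * pi) * sqrt 3)"
    by (subst gauss_nn_integral) auto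
  finally show ?thesis using C0 by (simp add: ennreal_mult[symmetric] mult_ac)
qed

lemma exp_neg_sq_le_powr:
  fixes t \<alpha> :: real assumes "0 < t" "0 < \<alpha>" "\<alpha> \<le> 4"
  shows "exp (- t\<^sup>2) \<le> 2 * t powr (- \<alpha>)"
proof -
  have "t powr \<alpha> \<le> 2 * exp (t\<^sup>2)"
  proof (cases "t \<le> 1")
    case True
    hence "t powr \<alpha> \<le> 1" using assms by (simp add: powr_le1)
    also have "1 \<le> 2 * exp (t\<^sup>2)" using one_le_exp_iff[of "t\<^sup>2"] zero_le_power2[of t] by linarith
    finally show ?thesis .
  next
    case False
    hence "t powr \<alpha> \<le> t powr 4" using assms by (intro powr_mono) auto
    also have "\<dots> = (t\<^sup>2)\<^sup>2" using assms by (simp add: powr_numeral)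
    also have "\<dots> \<le> 2 * exp (t\<^sup>2)"
      using exp_lower_Taylor_quadratic[of "t\<^sup>2"] zero_le_power2[of t] by linarith
    finally show ?thesis .
  qed
  thus ?thesis using assms by (simp add: exp_minus powr_minus field_simps)
qed

lemma gauss_le_riesz:
  fixes x y :: "'a::metric_space"
  assumes "0 < \<alpha>" "\<alpha> \<le> 4" "1 \<le> \<rho>" "\<rho> \<le> \<sigma>"
  shows "ennreal (exp (- \<sigma>\<^sup>2 * (dist x y)\<^sup>2)) \<le> ennreal (2 * \<rho> powr (- \<alpha>)) * riesz_kernel \<alpha> x y"
proof (cases "x = y")
  case True
  thus ?thesis using assms by (simp add: riesz_kernel_def ennreal_mult_top)
next
  case False
  have "\<sigma>\<^sup>2 * (dist x y)\<^sup>2 \<ge> \<rho>\<^sup>2 * (dist x y)\<^sup>2" using assms by (intro mult_right_mono power_mono) auto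
  hence "exp (- \<sigma>\<^sup>2 * (dist x y)\<^sup>2) \<le> exp (- (\<rho> * dist x y)\<^sup>2)" by (simp add: power_mult_distrib)
  also have "\<dots> \<le> 2 * (\<rho> * dist x y) powr (- \<alpha>)" using assms False by (intro exp_neg_sq_le_powr) auto
  also have "\<dots> = (2 * \<rho> powr (- \<alpha>)) * dist x y powr (- \<alpha>)" using assms by (simp add: powr_mult)
  finally show ?thesis using False by (simp add: riesz_kernel_def ennreal_mult[symmetric])
qed

lemma riesz_kernel_measurable [measurable]:
  fixes f g :: "'b \<Rightarrow> 'a::{metric_space,second_countable_topology}"
  assumes [measurable]: "f \<in> borel_measurable N" "g \<in> borel_measurable N"
  shows "(\<lambda>z. riesz_kernel \<alpha> (f z) (g z)) \<in> borel_measurable N"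
  unfolding riesz_kernel_def by measurable

text \<open>A large sieve inequality for radial segments: for directions that are separated at scale \<open>1 / \<rho>\<close>, the
sum of line integrals of the squared transform is controlled by its integral over a ball of radius
comparable to \<open>\<rho>\<close>, which a Riesz energy bounds. The constant depends on \<open>M\<close> only through the radius \<open>L\<close>.\<close>

lemma sphere_sieve:
  fixes M :: "'a::euclidean_space measure" and \<alpha> :: real
  assumes M: "finite_measure M" "sets M = sets borel" and L: "AE x in M. norm x \<le> L"
    and K: "1 \<le> K" and \<alpha>: "0 < \<alpha>" "\<alpha> \<le> 4"
  shows "\<exists>C\<ge>0. \<forall>\<rho> (V::'a set). 1 \<le> \<rho> \<longrightarrow> finite V \<longrightarrow> (\<forall>v\<in>V. norm v = 1) \<longrightarrow>
      (\<forall>v\<in>V. \<forall>w\<in>V. v \<noteq> w \<longrightarrow> 1 / \<rho> \<le> dist v w) \<longrightarrow>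
      (\<integral>\<^sup>+s\<in>{\<rho>..K * \<rho>}. (\<Sum>v\<in>V. ennreal ((norm (ft M (s *\<^sub>R v)))\<^sup>2)) \<partial>lborel)
      \<le> ennreal (C * \<rho> powr (real DIM('a) - \<alpha>)) * (\<integral>\<^sup>+x. \<integral>\<^sup>+y. riesz_kernel \<alpha> x y \<partial>M \<partial>M)"
proof -
  interpret finite_measure M by fact
  note [measurable_cong] = M(2)
  let ?M' = "gauss_reweight L M"
  interpret M': finite_measure ?M' by (rule gauss_reweight(1)[OF M])
  note [measurable_cong] = gauss_reweight(2)[OF M, of L]
  have [measurable]: "ft ?M' \<in> borel_measurable borel"
    by (rule borel_measurable_ft) (auto simp: gauss_reweight(2)[OF M] M'.sigma_finite_measure_axioms)
  have [measurable]: "ft M \<in> borel_measurable borel"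
    by (rule borel_measurable_ft) (auto simp: M sigma_finite_measure_axioms)
  obtain C1 where C1: "C1 > 0" "\<And>X (\<xi>::'a). finite X \<Longrightarrow> (\<forall>v\<in>X. \<forall>w\<in>X. v \<noteq> w \<longrightarrow> 1 \<le> dist v w) \<Longrightarrow>
     (\<Sum>v\<in>X. exp (- (dist v \<xi>)\<^sup>2 / 6)) \<le> C1"
    using separated_gauss_sum[where 'a='a] by blast
  define c where "c = 1 / sqrt (2 * pi) ^ DIM('a)"
  define C2 where "C2 = C1 * exp (1/6) * (sqrt (2 * pi) * sqrt 3)"
  define C3 where "C3 = c * C2 * (sqrt (2 * pi) * (sqrt 6 * K)) ^ DIM('a) * exp (L\<^sup>2 / 2) * exp (L\<^sup>2 / 2) * 2"
  have c0: "c > 0" "C2 > 0" using C1(1) by (auto simp: c_def C2_def)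
  have "C3 \<ge> 0" using c0 K by (auto simp: C3_def)
  have "(\<integral>\<^sup>+s\<in>{\<rho>..K * \<rho>}. (\<Sum>v\<in>V. ennreal ((norm (ft M (s *\<^sub>R v)))\<^sup>2)) \<partial>lborel)
      \<le> ennreal (C3 * \<rho> powr (real DIM('a) - \<alpha>)) * (\<integral>\<^sup>+x. \<integral>\<^sup>+y. riesz_kernel \<alpha> x y \<partial>M \<partial>M)"
    if \<rho>: "1 \<le> \<rho>" and V: "finite V" "\<forall>v\<in>V. norm v = 1" "\<forall>v\<in>V. \<forall>w\<in>V. v \<noteq> w \<longrightarrow> 1 / \<rho> \<le> dist v w"
    for \<rho> and V :: "'a set"
  proof -
    let ?F = "\<lambda>\<zeta>. (norm (ft ?M' \<zeta>))\<^sup>2"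
    define \<sigma> where "\<sigma> = sqrt 6 * K * \<rho>"
    have \<sigma>: "\<sigma> > 0" "2 * \<sigma>\<^sup>2 = 12 * K\<^sup>2 * \<rho>\<^sup>2" using K \<rho> by (auto simp: \<sigma>_def power_mult_distrib)
    let ?R = "\<integral>\<^sup>+x. \<integral>\<^sup>+y. riesz_kernel \<alpha> x y \<partial>M \<partial>M"
    have "(\<integral>\<^sup>+s\<in>{\<rho>..K * \<rho>}. (\<Sum>v\<in>V. ennreal ((norm (ft M (s *\<^sub>R v)))\<^sup>2)) \<partial>lborel)
      \<le> (\<integral>\<^sup>+s. \<integral>\<^sup>+\<zeta>. ennreal c * (ennreal (\<Sum>v\<in>V. exp (- (norm (s *\<^sub>R v - \<zeta>))\<^sup>2 / 2)) * indicator {\<rho>..K * \<rho>} s * ennreal (?F \<zeta>)) \<partial>lborel \<partial>lborel)"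
    proof (rule nn_integral_mono)
      fix s
      have "(\<Sum>v\<in>V. ennreal ((norm (ft M (s *\<^sub>R v)))\<^sup>2)) \<le> (\<Sum>v\<in>V. ennreal c * (\<integral>\<^sup>+\<zeta>. ennreal (exp (- (norm (s *\<^sub>R v - \<zeta>))\<^sup>2 / 2) * ?F \<zeta>) \<partial>lborel))"
        unfolding c_def by (intro sum_mono ft_smoothing M L)
      also have "\<dots> = ennreal c * (\<Sum>v\<in>V. (\<integral>\<^sup>+\<zeta>. ennreal (exp (- (norm (s *\<^sub>R v - \<zeta>))\<^sup>2 / 2) * ?F \<zeta>) \<partial>lborel))"
        by (rule sum_distrib_left[symmetric])
      also have "(\<Sum>v\<in>V. (\<integral>\<^sup>+\<zeta>. ennreal (exp (- (norm (s *\<^sub>R v - \<zeta>))\<^sup>2 / 2) * ?F \<zeta>) \<partial>lborel))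
         = (\<integral>\<^sup>+\<zeta>. (\<Sum>v\<in>V. ennreal (exp (- (norm (s *\<^sub>R v - \<zeta>))\<^sup>2 / 2) * ?F \<zeta>)) \<partial>lborel)"
        by (rule nn_integral_sum[symmetric]) measurable
      also have "\<dots> = (\<integral>\<^sup>+\<zeta>. ennreal (\<Sum>v\<in>V. exp (- (norm (s *\<^sub>R v - \<zeta>))\<^sup>2 / 2)) * ennreal (?F \<zeta>) \<partial>lborel)"
        by (intro nn_integral_cong) (simp add: sum_distrib_right sum_nonneg flip: ennreal_mult)
      also have "ennreal c * \<dots> = (\<integral>\<^sup>+\<zeta>. ennreal c * (ennreal (\<Sum>v\<in>V. exp (- (norm (s *\<^sub>R v - \<zeta>))\<^sup>2 / 2)) * ennreal (?F \<zeta>)) \<partial>lborel)"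
        by (rule nn_integral_cmult[symmetric]) measurable
      finally show "(\<Sum>v\<in>V. ennreal ((norm (ft M (s *\<^sub>R v)))\<^sup>2)) * indicator {\<rho>..K * \<rho>} s
         \<le> (\<integral>\<^sup>+\<zeta>. ennreal c * (ennreal (\<Sum>v\<in>V. exp (- (norm (s *\<^sub>R v - \<zeta>))\<^sup>2 / 2)) * indicator {\<rho>..K * \<rho>} s * ennreal (?F \<zeta>)) \<partial>lborel)"
        by (cases "s \<in> {\<rho>..K * \<rho>}") simp_all
    qed
    also have "\<dots> = (\<integral>\<^sup>+\<zeta>. \<integral>\<^sup>+s. ennreal c * (ennreal (\<Sum>v\<in>V. exp (- (norm (s *\<^sub>R v - \<zeta>))\<^sup>2 / 2)) * indicator {\<rho>..K * \<rho>} s * ennreal (?F \<zeta>)) \<partial>lborel \<partial>lborel)"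
    proof (rule lborel_pair.Fubini')
      show "(\<lambda>(\<zeta>, s). ennreal c * (ennreal (\<Sum>v\<in>V. exp (- (norm (s *\<^sub>R v - \<zeta>))\<^sup>2 / 2)) * indicator {\<rho>..K * \<rho>} s * ennreal (?F \<zeta>))) \<in> borel_measurable (lborel \<Otimes>\<^sub>M lborel)"
        by measurable
    qed
    also have "\<dots> = (\<integral>\<^sup>+\<zeta>. ennreal c * ((\<integral>\<^sup>+s\<in>{\<rho>..K * \<rho>}. ennreal (\<Sum>v\<in>V. exp (- (norm (s *\<^sub>R v - \<zeta>))\<^sup>2 / 2)) \<partial>lborel) * ennreal (?F \<zeta>)) \<partial>lborel)"
    proof (rule nn_integral_cong)
      fix \<zeta> :: 'a
      let ?A = "\<lambda>s. ennreal (\<Sum>v\<in>V. exp (- (norm (s *\<^sub>R v - \<zeta>))\<^sup>2 / 2)) * indicator {\<rho>..K * \<rho>} s"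
      have "(\<integral>\<^sup>+s. ennreal c * (?A s * ennreal (?F \<zeta>)) \<partial>lborel) = ennreal c * (\<integral>\<^sup>+s. ?A s * ennreal (?F \<zeta>) \<partial>lborel)"
        by (rule nn_integral_cmult) measurable
      also have "(\<integral>\<^sup>+s. ?A s * ennreal (?F \<zeta>) \<partial>lborel) = (\<integral>\<^sup>+s. ?A s \<partial>lborel) * ennreal (?F \<zeta>)"
        by (rule nn_integral_multc) measurable
      finally show "(\<integral>\<^sup>+s. ennreal c * (?A s * ennreal (?F \<zeta>)) \<partial>lborel) = ennreal c * ((\<integral>\<^sup>+s. ?A s \<partial>lborel) * ennreal (?F \<zeta>))" .
    qed
    also have "\<dots> \<le> (\<integral>\<^sup>+\<zeta>. ennreal c * (ennreal (C2 * exp (- (norm \<zeta>)\<^sup>2 / (12 * K\<^sup>2 * \<rho>\<^sup>2))) * ennreal (?F \<zeta>)) \<partial>lborel)"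
      unfolding C2_def
      by (intro nn_integral_mono mult_left_mono mult_right_mono sphere_gauss_bound C1(2) \<rho> K V(1)) (use V in auto)
    also have "\<dots> = (\<integral>\<^sup>+\<zeta>. ennreal (c * C2) * ennreal (?F \<zeta> * exp (- (norm \<zeta>)\<^sup>2 / (2 * \<sigma>\<^sup>2))) \<partial>lborel)"
      unfolding \<sigma>(2) using c0 by (intro nn_integral_cong) (simp add: ennreal_mult[symmetric] mult_ac)
    also have "\<dots> = ennreal (c * C2) * (\<integral>\<^sup>+\<zeta>. ennreal (?F \<zeta> * exp (- (norm \<zeta>)\<^sup>2 / (2 * \<sigma>\<^sup>2))) \<partial>lborel)"
      by (rule nn_integral_cmult) measurable
    also have "(\<integral>\<^sup>+\<zeta>. ennreal (?F \<zeta> * exp (- (norm \<zeta>)\<^sup>2 / (2 * \<sigma>\<^sup>2))) \<partial>lborel)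
       = ennreal ((sqrt (2 * pi) * \<sigma>) ^ DIM('a)) * (\<integral>\<^sup>+x. \<integral>\<^sup>+y. ennreal (exp (- \<sigma>\<^sup>2 * (dist x y)\<^sup>2 / 2)) \<partial>?M' \<partial>?M')"
      by (rule gauss_weighted_ft[OF gauss_reweight(1,2)[OF M] \<sigma>(1)])
    also have "(\<integral>\<^sup>+x. \<integral>\<^sup>+y. ennreal (exp (- \<sigma>\<^sup>2 * (dist x y)\<^sup>2 / 2)) \<partial>?M' \<partial>?M')
       \<le> (\<integral>\<^sup>+x. \<integral>\<^sup>+y. ennreal (2 * \<rho> powr (- \<alpha>)) * riesz_kernel \<alpha> x y \<partial>?M' \<partial>?M')"
    proof (intro nn_integral_mono)
      fix x y :: 'a
      have "\<rho> \<le> sqrt 3 * (K * \<rho>)"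
      proof -
        have "1 * (1 * \<rho>) \<le> sqrt 3 * (K * \<rho>)" using K \<rho> by (intro mult_mono) auto
        thus ?thesis by simp
      qed
      hence "ennreal (exp (- (sqrt 3 * (K * \<rho>))\<^sup>2 * (dist x y)\<^sup>2)) \<le> ennreal (2 * \<rho> powr (- \<alpha>)) * riesz_kernel \<alpha> x y"
        by (intro gauss_le_riesz \<alpha> \<rho>)
      thus "ennreal (exp (- \<sigma>\<^sup>2 * (dist x y)\<^sup>2 / 2)) \<le> ennreal (2 * \<rho> powr (- \<alpha>)) * riesz_kernel \<alpha> x y"
        by (simp add: \<sigma>_def power_mult_distrib mult_ac)
    qed
    also have "\<dots> \<le> (\<integral>\<^sup>+x. ennreal (exp (L\<^sup>2 / 2)) * (\<integral>\<^sup>+y. ennreal (2 * \<rho> powr (- \<alpha>)) * riesz_kernel \<alpha> x y \<partial>M) \<partial>?M')"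
    proof (intro nn_integral_mono gauss_reweight(3) M)
      fix x :: 'a
      show "(\<lambda>y. ennreal (2 * \<rho> powr (- \<alpha>)) * riesz_kernel \<alpha> x y) \<in> borel_measurable borel"
        by measurable
    qed
    also have "\<dots> \<le> ennreal (exp (L\<^sup>2 / 2)) * (\<integral>\<^sup>+x. ennreal (exp (L\<^sup>2 / 2)) * (\<integral>\<^sup>+y. ennreal (2 * \<rho> powr (- \<alpha>)) * riesz_kernel \<alpha> x y \<partial>M) \<partial>M)"
    proof (intro gauss_reweight(3) M)
      have [measurable]: "(\<lambda>x. \<integral>\<^sup>+y. ennreal (2 * \<rho> powr (- \<alpha>)) * riesz_kernel \<alpha> x y \<partial>M) \<in> borel_measurable borel"
        by (rule borel_measurable_nn_integral) measurable
      show "(\<lambda>x. ennreal (exp (L\<^sup>2 / 2)) * (\<integral>\<^sup>+y. ennreal (2 * \<rho> powr (- \<alpha>)) * riesz_kernel \<alpha> x y \<partial>M)) \<in> borel_measurable borel"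
        by measurable
    qed
    also have "\<dots> = ennreal (exp (L\<^sup>2 / 2)) * (ennreal (exp (L\<^sup>2 / 2)) * (ennreal (2 * \<rho> powr (- \<alpha>)) * ?R))"
    proof -
      have "(\<integral>\<^sup>+y. ennreal (2 * \<rho> powr (- \<alpha>)) * riesz_kernel \<alpha> x y \<partial>M) = ennreal (2 * \<rho> powr (- \<alpha>)) * (\<integral>\<^sup>+y. riesz_kernel \<alpha> x y \<partial>M)" for x
        by (rule nn_integral_cmult) measurable
      thus ?thesis by (simp add: nn_integral_cmult)
    qed
    finally have "(\<integral>\<^sup>+s\<in>{\<rho>..K * \<rho>}. (\<Sum>v\<in>V. ennreal ((norm (ft M (s *\<^sub>R v)))\<^sup>2)) \<partial>lborel)
       \<le> ennreal (c * C2) * (ennreal ((sqrt (2 * pi) * \<sigma>) ^ DIM('a)) * (ennreal (exp (L\<^sup>2 / 2)) * (ennreal (exp (L\<^sup>2 / 2)) * (ennreal (2 * \<rho> powr (- \<alpha>)) * ?R))))"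
      by (simp add: mult_left_mono)
    also have "\<dots> = ennreal (c * C2 * (sqrt (2 * pi) * \<sigma>) ^ DIM('a) * exp (L\<^sup>2 / 2) * exp (L\<^sup>2 / 2) * (2 * \<rho> powr (- \<alpha>))) * ?R"
      using c0 \<sigma>(1) by (simp add: ennreal_mult mult.assoc)
    also have "c * C2 * (sqrt (2 * pi) * \<sigma>) ^ DIM('a) * exp (L\<^sup>2 / 2) * exp (L\<^sup>2 / 2) * (2 * \<rho> powr (- \<alpha>))
       = C3 * (\<rho> ^ DIM('a) * \<rho> powr (- \<alpha>))"
      by (simp add: C3_def \<sigma>_def power_mult_distrib mult_ac)
    also have "\<rho> ^ DIM('a) * \<rho> powr (- \<alpha>) = \<rho> powr (real DIM('a) - \<alpha>)"
      using \<rho> by (simp add: powr_realpow[symmetric] powr_add[symmetric])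
    finally show ?thesis .
  qed
  thus ?thesis using \<open>C3 \<ge> 0\<close> by blast
qed

section \<open>Square integrable Fourier transforms and densities\<close>

text \<open>By outer regularity the inequality extends from open sets to all Borel sets; applied to complements it
becomes an equality. The lemma serves twice: for the uniqueness of the self-similar measure and for
identifying the limit density, where only one-sided estimates on open sets come naturally.\<close>

lemma prob_measure_eqI_open:
  fixes M N :: "'a::polish_space measure"
  assumes M: "prob_space M" "sets M = sets borel" and N: "prob_space N" "sets N = sets borel"
    and le: "\<And>U. open U \<Longrightarrow> emeasure M U \<le> emeasure N U"
  shows "M = N"
proof (rule measure_eqI)
  interpret M: prob_space M by fact
  interpret N: prob_space N by fact
  have sp: "space M = UNIV" "space N = UNIV"
    using sets_eq_imp_space_eq[OF M(2)] sets_eq_imp_space_eq[OF N(2)] by auto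
  have *: "emeasure M B \<le> emeasure N B" if B: "B \<in> sets borel" for B
  proof -
    have "emeasure M B = (INF U \<in> {U. B \<subseteq> U \<and> open U}. emeasure M U)"
      by (rule outer_regular[OF M(2) _ B]) simp
    also have "\<dots> \<le> (INF U \<in> {U. B \<subseteq> U \<and> open U}. emeasure N U)"
      using le by (intro INF_mono) auto
    also have "\<dots> = emeasure N B"
      by (rule outer_regular[OF N(2) _ B, symmetric]) simp
    finally show ?thesis .
  qed
  show "sets M = sets N" using M N by simp
  fix A assume "A \<in> sets M"
  hence A: "A \<in> sets borel" using M by simp
  hence "emeasure M (UNIV - A) \<le> emeasure N (UNIV - A)" by (intro *) auto
  hence "1 - M.prob A \<le> 1 - N.prob A"
    using A M(2) N(2) M.prob_compl[of A] N.prob_compl[of A]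
    by (simp add: sp M.emeasure_eq_measure N.emeasure_eq_measure)
  hence "emeasure N A \<le> emeasure M A" by (simp add: M.emeasure_eq_measure N.emeasure_eq_measure)
  with *[OF A] show "emeasure M A = emeasure N A" by (rule antisym)
qed

lemma nn_integral_AE_limit_le:
  fixes H :: "nat \<Rightarrow> 'a \<Rightarrow> ennreal"
  assumes hm: "\<And>j. H j \<in> borel_measurable M" and hc: "AE x in M. (\<lambda>j. H j x) \<longlonglongrightarrow> h x"
    and le: "\<And>j. j \<ge> k \<Longrightarrow> (\<integral>\<^sup>+x. H j x \<partial>M) \<le> B"
  shows "(\<integral>\<^sup>+x. h x \<partial>M) \<le> B"
proof -
  have "(\<integral>\<^sup>+x. h x \<partial>M) = (\<integral>\<^sup>+x. liminf (\<lambda>j. H j x) \<partial>M)"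
  proof (rule nn_integral_cong_AE)
    show "AE x in M. h x = liminf (\<lambda>j. H j x)"
      using hc by eventually_elim (simp add: lim_imp_Liminf)
  qed
  also have "\<dots> \<le> liminf (\<lambda>j. \<integral>\<^sup>+x. H j x \<partial>M)" using hm by (rule nn_integral_liminf)
  also have "\<dots> \<le> liminf (\<lambda>j. B)"
    using le by (intro Liminf_mono) (auto simp: eventually_sequentially)
  also have "\<dots> = B" by (simp add: Liminf_const)
  finally show ?thesis .
qed

text \<open>The squared \<open>L\<^sup>2\<close> norm of \<open>\<mu>\<close> after convolution with a centred Gaussian of variance \<open>\<tau> / 2\<close>; see
\<open>nn_integral_mollified_mult\<close>.\<close>

definition gauss_energy :: "real measure \<Rightarrow> real \<Rightarrow> ennreal" where
  "gauss_energy \<mu> \<tau> = (\<integral>\<^sup>+x. \<integral>\<^sup>+y. ennreal (normal_density 0 (sqrt \<tau>) (x - y)) \<partial>\<mu> \<partial>\<mu>)"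

lemma gauss_energy_eq_ft:
  assumes M: "finite_measure \<mu>" "sets \<mu> = sets borel" and \<tau>: "\<tau> > 0"
  shows "gauss_energy \<mu> \<tau> = ennreal (1 / (2 * pi)) * (\<integral>\<^sup>+t. ennreal ((norm (ft \<mu> t))\<^sup>2 * exp (- \<tau> * t\<^sup>2 / 2)) \<partial>lborel)"
proof -
  interpret finite_measure \<mu> by fact
  note [measurable_cong] = M(2)
  define \<sigma> where "\<sigma> = 1 / sqrt \<tau>"
  have \<sigma>: "\<sigma> > 0" "1 / (2 * \<sigma>\<^sup>2) = \<tau> / 2" "\<sigma>\<^sup>2 = 1 / \<tau>" using \<tau> by (auto simp: \<sigma>_def power_divide)
  have 1: "normal_density 0 (sqrt \<tau>) (x - y) = (1 / sqrt (2 * pi * \<tau>)) * exp (- \<sigma>\<^sup>2 * (dist x y)\<^sup>2 / 2)" for x y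
    using \<tau> by (simp add: normal_density_def \<sigma>(3) dist_real_def)
  have 2: "(norm (ft \<mu> t))\<^sup>2 * exp (- (norm t)\<^sup>2 / (2 * \<sigma>\<^sup>2)) = (norm (ft \<mu> t))\<^sup>2 * exp (- \<tau> * t\<^sup>2 / 2)" for t
  proof -
    have "- (norm t)\<^sup>2 / (2 * \<sigma>\<^sup>2) = - (t\<^sup>2 * (1 / (2 * \<sigma>\<^sup>2)))" by simp
    also have "\<dots> = - \<tau> * t\<^sup>2 / 2" unfolding \<sigma>(2) by simp
    finally show ?thesis by simp
  qed
  let ?I = "\<integral>\<^sup>+x. \<integral>\<^sup>+y. ennreal (exp (- \<sigma>\<^sup>2 * (dist x y)\<^sup>2 / 2)) \<partial>\<mu> \<partial>\<mu>"
  have "gauss_energy \<mu> \<tau> = (\<integral>\<^sup>+x. ennreal (1 / sqrt (2 * pi * \<tau>)) * (\<integral>\<^sup>+y. ennreal (exp (- \<sigma>\<^sup>2 * (dist x y)\<^sup>2 / 2)) \<partial>\<mu>) \<partial>\<mu>)"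
    unfolding gauss_energy_def 1
  proof (rule nn_integral_cong)
    fix x
    have "(\<integral>\<^sup>+y. ennreal ((1 / sqrt (2 * pi * \<tau>)) * exp (- \<sigma>\<^sup>2 * (dist x y)\<^sup>2 / 2)) \<partial>\<mu>)
      = (\<integral>\<^sup>+y. ennreal (1 / sqrt (2 * pi * \<tau>)) * ennreal (exp (- \<sigma>\<^sup>2 * (dist x y)\<^sup>2 / 2)) \<partial>\<mu>)"
      using \<tau> by (intro nn_integral_cong ennreal_mult) auto
    also have "\<dots> = ennreal (1 / sqrt (2 * pi * \<tau>)) * (\<integral>\<^sup>+y. ennreal (exp (- \<sigma>\<^sup>2 * (dist x y)\<^sup>2 / 2)) \<partial>\<mu>)"
      by (rule nn_integral_cmult) measurable
    finally show "(\<integral>\<^sup>+y. ennreal ((1 / sqrt (2 * pi * \<tau>)) * exp (- \<sigma>\<^sup>2 * (dist x y)\<^sup>2 / 2)) \<partial>\<mu>) = \<dots>" .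
  qed
  also have "\<dots> = ennreal (1 / sqrt (2 * pi * \<tau>)) * ?I"
    by (rule nn_integral_cmult) measurable
  also have "\<dots> = ennreal (1 / (2 * pi)) * (ennreal (sqrt (2 * pi) * \<sigma>) * ?I)"
  proof -
    have "1 / (2 * pi) * (sqrt (2 * pi) * \<sigma>) = 1 / sqrt (2 * pi * \<tau>)"
      using \<tau> by (simp add: \<sigma>_def real_sqrt_mult field_simps)
    thus ?thesis using \<sigma>(1) by (simp add: mult.assoc[symmetric] ennreal_mult[symmetric])
  qed
  also have "ennreal (sqrt (2 * pi) * \<sigma>) * ?I = (\<integral>\<^sup>+t. ennreal ((norm (ft \<mu> t))\<^sup>2 * exp (- (norm t)\<^sup>2 / (2 * \<sigma>\<^sup>2))) \<partial>lborel)"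
    by (subst gauss_weighted_ft[OF M \<sigma>(1)]) simp
  finally show ?thesis unfolding 2 .
qed

lemma normal_density_reflect: "normal_density 0 \<sigma> (x - y) = normal_density 0 \<sigma> (y - x)"
  by (simp add: normal_density_def power2_commute)

lemma normal_density_convolve:
  assumes "\<sigma> > 0" "\<tau> > 0"
  shows "(\<integral>\<^sup>+x. ennreal (normal_density 0 \<sigma> (x - y)) * ennreal (normal_density 0 \<tau> (x - z)) \<partial>lborel)
    = ennreal (normal_density 0 (sqrt (\<sigma>\<^sup>2 + \<tau>\<^sup>2)) (y - z))"
proof -
  have "(\<integral>\<^sup>+x. ennreal (normal_density 0 \<sigma> (x - y)) * ennreal (normal_density 0 \<tau> (x - z)) \<partial>lborel)
     = (\<integral>\<^sup>+x. ennreal (normal_density 0 \<sigma> ((z + 1 * x) - y)) * ennreal (normal_density 0 \<tau> ((z + 1 * x) - z)) \<partial>lborel)"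
    by (subst nn_integral_real_affine[where c=1 and t=z]) auto
  also have "\<dots> = (\<integral>\<^sup>+x. ennreal (normal_density 0 \<sigma> ((y - z) - x) * normal_density 0 \<tau> x) \<partial>lborel)"
    using normal_density_reflect[of \<sigma>]
    by (intro nn_integral_cong) (simp add: ennreal_mult[symmetric] normal_density_reflect[of \<sigma> _ y] algebra_simps)
  also have "\<dots> = ennreal (normal_density 0 (sqrt (\<sigma>\<^sup>2 + \<tau>\<^sup>2)) (y - z))"
    using fun_cong[OF conv_normal_density_zero_mean[OF assms], of "y - z"] by simp
  finally show ?thesis .
qed

definition mollified :: "real measure \<Rightarrow> real \<Rightarrow> real \<Rightarrow> real" where
  "mollified \<mu> \<epsilon> x = (\<integral>y. normal_density 0 \<epsilon> (x - y) \<partial>\<mu>)"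

context
  fixes \<mu> :: "real measure"
  assumes prob: "prob_space \<mu>" and sets_\<mu>: "sets \<mu> = sets borel"
begin

interpretation prob_space \<mu> by (rule prob)
interpretation sigma_finite_measure \<mu> by unfold_locales
interpretation L\<mu>: pair_sigma_finite lborel \<mu> ..

lemma mollified_measurable [measurable]: "mollified \<mu> \<epsilon> \<in> borel_measurable borel"
proof -
  note [measurable_cong] = sets_\<mu>
  show ?thesis unfolding mollified_def by measurable
qed

lemma mollified_nonneg [simp]: "0 \<le> mollified \<mu> \<epsilon> x"
  unfolding mollified_def by (intro integral_nonneg_AE) auto

lemma ennreal_mollified:
  assumes "\<epsilon> > 0"
  shows "ennreal (mollified \<mu> \<epsilon> x) = (\<integral>\<^sup>+y. ennreal (normal_density 0 \<epsilon> (x - y)) \<partial>\<mu>)"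
proof -
  note [measurable_cong] = sets_\<mu>
  have b: "normal_density 0 \<epsilon> z \<le> 1 / sqrt (2 * pi * \<epsilon>\<^sup>2)" for z
    using assms by (simp add: normal_density_def divide_right_mono)
  have "integrable \<mu> (\<lambda>y. normal_density 0 \<epsilon> (x - y))"
    using b by (intro integrable_const_bound[where B="1 / sqrt (2 * pi * \<epsilon>\<^sup>2)"]) auto
  thus ?thesis unfolding mollified_def by (intro nn_integral_eq_integral[symmetric]) auto
qed

lemma nn_integral_mollified_times:
  assumes "\<epsilon> > 0" and [measurable]: "h \<in> borel_measurable borel"
  shows "(\<integral>\<^sup>+x. h x * ennreal (mollified \<mu> \<epsilon> x) \<partial>lborel)
       = (\<integral>\<^sup>+y. \<integral>\<^sup>+x. h x * ennreal (normal_density 0 \<epsilon> (x - y)) \<partial>lborel \<partial>\<mu>)"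
proof -
  note [measurable_cong] = sets_\<mu>
  have "(\<integral>\<^sup>+x. h x * ennreal (mollified \<mu> \<epsilon> x) \<partial>lborel) = (\<integral>\<^sup>+x. \<integral>\<^sup>+y. h x * ennreal (normal_density 0 \<epsilon> (x - y)) \<partial>\<mu> \<partial>lborel)"
  proof (rule nn_integral_cong)
    fix x
    show "h x * ennreal (mollified \<mu> \<epsilon> x) = (\<integral>\<^sup>+y. h x * ennreal (normal_density 0 \<epsilon> (x - y)) \<partial>\<mu>)"
      unfolding ennreal_mollified[OF assms(1)] by (rule nn_integral_cmult[symmetric]) measurable
  qed
  also have "\<dots> = (\<integral>\<^sup>+y. \<integral>\<^sup>+x. h x * ennreal (normal_density 0 \<epsilon> (x - y)) \<partial>lborel \<partial>\<mu>)"
  proof (rule L\<mu>.Fubini'[symmetric])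
    show "(\<lambda>(x, y). h x * ennreal (normal_density 0 \<epsilon> (x - y))) \<in> borel_measurable (lborel \<Otimes>\<^sub>M \<mu>)"
      by measurable
  qed
  finally show ?thesis .
qed

lemma nn_integral_mollified_mult:
  assumes "\<epsilon> > 0" "\<delta> > 0"
  shows "(\<integral>\<^sup>+x. ennreal (mollified \<mu> \<epsilon> x * mollified \<mu> \<delta> x) \<partial>lborel) = gauss_energy \<mu> (\<epsilon>\<^sup>2 + \<delta>\<^sup>2)"
proof -
  note [measurable_cong] = sets_\<mu>
  have "(\<integral>\<^sup>+x. ennreal (mollified \<mu> \<epsilon> x * mollified \<mu> \<delta> x) \<partial>lborel)
      = (\<integral>\<^sup>+y. \<integral>\<^sup>+x. ennreal (mollified \<mu> \<epsilon> x) * ennreal (normal_density 0 \<delta> (x - y)) \<partial>lborel \<partial>\<mu>)"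
    using nn_integral_mollified_times[OF assms(2), of "\<lambda>x. ennreal (mollified \<mu> \<epsilon> x)"] by (simp add: ennreal_mult)
  also have "\<dots> = (\<integral>\<^sup>+y. \<integral>\<^sup>+x. ennreal (normal_density 0 \<delta> (x - y)) * ennreal (mollified \<mu> \<epsilon> x) \<partial>lborel \<partial>\<mu>)"
    by (simp add: mult.commute)
  also have "\<dots> = (\<integral>\<^sup>+y. \<integral>\<^sup>+z. \<integral>\<^sup>+x. ennreal (normal_density 0 \<delta> (x - y)) * ennreal (normal_density 0 \<epsilon> (x - z)) \<partial>lborel \<partial>\<mu> \<partial>\<mu>)"
    by (subst nn_integral_mollified_times[OF assms(1)]) auto
  also have "\<dots> = gauss_energy \<mu> (\<epsilon>\<^sup>2 + \<delta>\<^sup>2)"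
    unfolding gauss_energy_def normal_density_convolve[OF assms(2,1)] by (simp add: add.commute)
  finally show ?thesis .
qed

lemma nn_integral_mollified:
  assumes "\<epsilon> > 0"
  shows "(\<integral>\<^sup>+x. ennreal (mollified \<mu> \<epsilon> x) \<partial>lborel) = 1"
proof -
  have "(\<integral>\<^sup>+x. ennreal (mollified \<mu> \<epsilon> x) \<partial>lborel) = (\<integral>\<^sup>+y. \<integral>\<^sup>+x. ennreal (normal_density 0 \<epsilon> (x - y)) \<partial>lborel \<partial>\<mu>)"
    using nn_integral_mollified_times[OF assms, of "\<lambda>_. 1"] by simp
  also have "\<dots> = (\<integral>\<^sup>+y. 1 \<partial>\<mu>)"
  proof (rule nn_integral_cong)
    fix y
    have "(\<integral>\<^sup>+x. ennreal (normal_density 0 \<epsilon> (x - y)) \<partial>lborel) = (\<integral>\<^sup>+x. ennreal (normal_density y \<epsilon> x) \<partial>lborel)"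
      by (simp add: normal_density_def)
    also have "\<dots> = 1"
      using prob_space.emeasure_space_1[OF prob_space_normal_density[OF assms, of y]]
      by (simp add: emeasure_density)
    finally show "(\<integral>\<^sup>+x. ennreal (normal_density 0 \<epsilon> (x - y)) \<partial>lborel) = 1" .
  qed
  finally show ?thesis by (simp add: emeasure_space_1)
qed

text \<open>The mollified measure is the law of \<open>y + \<epsilon> k * z\<close> with \<open>y\<close> distributed as \<open>\<mu>\<close> and \<open>z\<close> a standard normal
variable. If \<open>y\<close> lies in the open set \<open>U\<close>, so does \<open>y + \<epsilon> k * z\<close> for large \<open>k\<close>, and Fatou's lemma applies.\<close>

lemma emeasure_open_le_liminf_mollified:
  assumes \<epsilon>: "\<And>k::nat. \<epsilon> k > 0" "\<epsilon> \<longlonglongrightarrow> 0" and U: "open U"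
  shows "emeasure \<mu> U \<le> liminf (\<lambda>k. \<integral>\<^sup>+x. indicator U x * ennreal (mollified \<mu> (\<epsilon> k) x) \<partial>lborel)"
proof -
  note [measurable_cong] = sets_\<mu>
  have [measurable]: "U \<in> sets borel" using U by auto
  have scale: "(\<integral>\<^sup>+x. indicator U x * ennreal (normal_density 0 (\<epsilon> k) (x - y)) \<partial>lborel)
     = (\<integral>\<^sup>+z. indicator U (y + \<epsilon> k * z) * ennreal (std_normal_density z) \<partial>lborel)" for k y
  proof -
    have "(\<integral>\<^sup>+x. indicator U x * ennreal (normal_density 0 (\<epsilon> k) (x - y)) \<partial>lborel)
      = ennreal \<bar>\<epsilon> k\<bar> * (\<integral>\<^sup>+z. indicator U (y + \<epsilon> k * z) * ennreal (normal_density 0 (\<epsilon> k) (y + \<epsilon> k * z - y)) \<partial>lborel)"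
      using \<epsilon>(1)[of k] by (intro nn_integral_real_affine) auto
    also have "\<dots> = (\<integral>\<^sup>+z. ennreal \<bar>\<epsilon> k\<bar> * (indicator U (y + \<epsilon> k * z) * ennreal (normal_density 0 (\<epsilon> k) (y + \<epsilon> k * z - y))) \<partial>lborel)"
      by (rule nn_integral_cmult[symmetric]) measurable
    also have "\<dots> = (\<integral>\<^sup>+z. indicator U (y + \<epsilon> k * z) * ennreal (std_normal_density z) \<partial>lborel)"
    proof (rule nn_integral_cong)
      fix z
      have "\<bar>\<epsilon> k\<bar> * normal_density 0 (\<epsilon> k) (y + \<epsilon> k * z - y) = std_normal_density z"
        using \<epsilon>(1)[of k] by (simp add: normal_density_def power_mult_distrib real_sqrt_mult)
      thus "ennreal \<bar>\<epsilon> k\<bar> * (indicator U (y + \<epsilon> k * z) * ennreal (normal_density 0 (\<epsilon> k) (y + \<epsilon> k * z - y)))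
         = indicator U (y + \<epsilon> k * z) * ennreal (std_normal_density z)"
        by (cases "y + \<epsilon> k * z \<in> U") (simp_all add: ennreal_mult[symmetric])
    qed
    finally show ?thesis .
  qed
  have std: "(\<integral>\<^sup>+z. ennreal (std_normal_density z) \<partial>lborel) = 1"
    using prob_space.emeasure_space_1[OF prob_space_normal_density[of 1 0]] by (simp add: emeasure_density)
  have "emeasure \<mu> U = (\<integral>\<^sup>+y. indicator U y * (\<integral>\<^sup>+z. ennreal (std_normal_density z) \<partial>lborel) \<partial>\<mu>)"
    unfolding std by (simp add: sets_\<mu>)
  also have "\<dots> = (\<integral>\<^sup>+y. \<integral>\<^sup>+z. indicator U y * ennreal (std_normal_density z) \<partial>lborel \<partial>\<mu>)"
    by (intro nn_integral_cong nn_integral_cmult[symmetric]) auto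
  also have "\<dots> \<le> (\<integral>\<^sup>+y. \<integral>\<^sup>+z. liminf (\<lambda>k. indicator U (y + \<epsilon> k * z) * ennreal (std_normal_density z)) \<partial>lborel \<partial>\<mu>)"
  proof (intro nn_integral_mono)
    fix y z
    show "indicator U y * ennreal (std_normal_density z) \<le> liminf (\<lambda>k. indicator U (y + \<epsilon> k * z) * ennreal (std_normal_density z))"
    proof (cases "y \<in> U")
      case True
      have "(\<lambda>k. y + \<epsilon> k * z) \<longlonglongrightarrow> y + 0 * z" by (intro tendsto_intros \<epsilon>)
      hence "eventually (\<lambda>k. y + \<epsilon> k * z \<in> U) sequentially" using U True by (auto dest: topological_tendstoD)
      hence "eventually (\<lambda>k. indicator U y * ennreal (std_normal_density z) \<le> indicator U (y + \<epsilon> k * z) * ennreal (std_normal_density z)) sequentially"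
        by eventually_elim (simp add: True)
      thus ?thesis by (rule Liminf_bounded)
    qed simp
  qed
  also have "\<dots> \<le> (\<integral>\<^sup>+y. liminf (\<lambda>k. \<integral>\<^sup>+z. indicator U (y + \<epsilon> k * z) * ennreal (std_normal_density z) \<partial>lborel) \<partial>\<mu>)"
    by (intro nn_integral_mono nn_integral_liminf) measurable
  also have "\<dots> \<le> liminf (\<lambda>k. \<integral>\<^sup>+y. \<integral>\<^sup>+z. indicator U (y + \<epsilon> k * z) * ennreal (std_normal_density z) \<partial>lborel \<partial>\<mu>)"
    by (intro nn_integral_liminf) measurable
  also have "\<dots> = liminf (\<lambda>k. \<integral>\<^sup>+x. indicator U x * ennreal (mollified \<mu> (\<epsilon> k) x) \<partial>lborel)"
    by (simp add: scale[symmetric] nn_integral_mollified_times[OF \<epsilon>(1)])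
  finally show ?thesis .
qed

text \<open>The Gaussian mollifications of \<open>\<mu>\<close> have inner products \<open>a (\<tau> j / 2 + \<tau> k / 2)\<close>, where \<open>a\<close> decreases and
tends at 0 to a multiple of the squared \<open>L\<^sup>2\<close> norm of the transform. Hence they form a Cauchy sequence in
\<open>L\<^sup>2\<close>; along a fast subsequence they converge almost everywhere, and the limit is the density.\<close>

theorem L2_ft_imp_L2_density:
  assumes fin: "(\<integral>\<^sup>+t. ennreal ((norm (ft \<mu> t))\<^sup>2) \<partial>lborel) < \<infinity>"
  shows "\<exists>g::real \<Rightarrow> real. g \<in> borel_measurable borel \<and> (\<forall>x. 0 \<le> g x) \<and> integrable lborel (\<lambda>x. (g x)\<^sup>2) \<and>
    \<mu> = density lborel (\<lambda>x. ennreal (g x))"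
proof -
  note [measurable_cong] = sets_\<mu>
  have fm: "finite_measure \<mu>" by unfold_locales
  have [measurable]: "ft \<mu> \<in> borel_measurable borel"
    by (rule borel_measurable_ft) (auto simp: sets_\<mu> sigma_finite_measure_axioms)
  let ?f = "\<lambda>t. ennreal ((norm (ft \<mu> t))\<^sup>2)"
  let ?F = "\<lambda>\<tau> t. ennreal ((norm (ft \<mu> t))\<^sup>2 * exp (- \<tau> * t\<^sup>2 / 2))"
  define a where "a \<tau> = enn2real (gauss_energy \<mu> \<tau>)" for \<tau>
  define a0 where "a0 = enn2real (ennreal (1 / (2 * pi)) * (\<integral>\<^sup>+t. ?f t \<partial>lborel))"
  have a0: "ennreal (1 / (2 * pi)) * (\<integral>\<^sup>+t. ?f t \<partial>lborel) = ennreal a0"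
    using fin by (simp add: a0_def ennreal_mult_less_top)
  have E_mono: "gauss_energy \<mu> \<tau>' \<le> gauss_energy \<mu> \<tau>" if "0 < \<tau>" "\<tau> \<le> \<tau>'" for \<tau> \<tau>'
  proof -
    have "\<tau> * t\<^sup>2 \<le> \<tau>' * t\<^sup>2" for t :: real using that by (intro mult_right_mono) auto
    thus ?thesis
      unfolding gauss_energy_eq_ft[OF fm sets_\<mu> that(1)] gauss_energy_eq_ft[OF fm sets_\<mu> less_le_trans[OF that]]
      by (intro mult_left_mono nn_integral_mono ennreal_leI) auto
  qed
  have E_le: "gauss_energy \<mu> \<tau> \<le> ennreal a0" if "0 < \<tau>" for \<tau>
    unfolding gauss_energy_eq_ft[OF fm sets_\<mu> that] a0[symmetric] using that
    by (intro mult_left_mono nn_integral_mono ennreal_leI mult_right_le_one_le) auto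
  have E_eq: "gauss_energy \<mu> \<tau> = ennreal (a \<tau>)" if "0 < \<tau>" for \<tau>
  proof -
    have "gauss_energy \<mu> \<tau> < \<top>" using E_le[OF that] le_less_trans ennreal_less_top by blast
    thus ?thesis by (simp add: a_def)
  qed
  have a_nonneg: "0 \<le> a \<tau>" and a0_nonneg: "0 \<le> a0" for \<tau> by (auto simp: a_def a0_def)
  have a_le: "a \<tau> \<le> a0" if "0 < \<tau>" for \<tau>
    using E_le[OF that] E_eq[OF that] a0_nonneg by simp
  have a_mono: "a \<tau>' \<le> a \<tau>" if "0 < \<tau>" "\<tau> \<le> \<tau>'" for \<tau> \<tau>'
    using E_mono[OF that] E_eq[OF that(1)] E_eq[OF less_le_trans[OF that]] a_nonneg by simp
  have a_lim: "(\<lambda>n. a (1 / real (Suc n))) \<longlonglongrightarrow> a0"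
  proof -
    have "(\<lambda>n. \<integral>\<^sup>+t. ?F (1 / real (Suc n)) t \<partial>lborel) \<longlonglongrightarrow> (\<integral>\<^sup>+t. ?f t \<partial>lborel)"
    proof (rule nn_integral_dominated_convergence[where w="?f"])
      show "AE t in lborel. (\<lambda>n. ?F (1 / real (Suc n)) t) \<longlonglongrightarrow> ?f t"
      proof (rule AE_I2)
        fix t :: real
        have "(\<lambda>n. (norm (ft \<mu> t))\<^sup>2 * exp (- (1 / real (Suc n)) * t\<^sup>2 / 2)) \<longlonglongrightarrow> (norm (ft \<mu> t))\<^sup>2 * exp (- 0 * t\<^sup>2 / 2)"
          using LIMSEQ_inverse_real_of_nat by (intro tendsto_intros) (simp_all add: inverse_eq_divide)
        thus "(\<lambda>n. ?F (1 / real (Suc n)) t) \<longlonglongrightarrow> ?f t" by (intro tendsto_ennrealI) simp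
      qed
      show "AE t in lborel. ?F (1 / real (Suc n)) t \<le> ?f t" for n
        by (intro AE_I2 ennreal_leI mult_right_le_one_le) auto
    qed (use fin in auto)
    hence "(\<lambda>n. ennreal (1 / (2 * pi)) * (\<integral>\<^sup>+t. ?F (1 / real (Suc n)) t \<partial>lborel)) \<longlonglongrightarrow> ennreal a0"
      unfolding a0[symmetric] by (intro ennreal_tendsto_cmult) auto
    hence "(\<lambda>n. gauss_energy \<mu> (1 / real (Suc n))) \<longlonglongrightarrow> ennreal a0"
      by (subst gauss_energy_eq_ft[OF fm sets_\<mu>]) auto
    hence "(\<lambda>n. ennreal (a (1 / real (Suc n)))) \<longlonglongrightarrow> ennreal a0"
      by (simp add: E_eq)
    thus ?thesis using a_nonneg a0_nonneg by (simp add: tendsto_ennreal_iff)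
  qed
  have "\<exists>\<tau>>0. \<tau> \<le> 1 / real (Suc k) \<and> a0 - (1/4) ^ k \<le> a \<tau>" for k
  proof -
    have "eventually (\<lambda>n. a0 - (1/4) ^ k < a (1 / real (Suc n))) sequentially"
      by (rule order_tendstoD(1)[OF a_lim]) simp
    moreover have "eventually (\<lambda>n. k \<le> n) sequentially" by (rule eventually_ge_at_top)
    ultimately have "eventually (\<lambda>n. a0 - (1/4) ^ k < a (1 / real (Suc n)) \<and> k \<le> n) sequentially"
      by eventually_elim simp
    then obtain n where "a0 - (1/4) ^ k < a (1 / real (Suc n))" "k \<le> n"
      using eventually_happens'[OF sequentially_bot] by blast
    thus ?thesis by (intro exI[of _ "1 / real (Suc n)"]) (auto simp: frac_le)
  qed
  then obtain \<tau> where \<tau>: "\<And>k. 0 < \<tau> k" "\<And>k. \<tau> k \<le> 1 / real (Suc k)" "\<And>k. a0 - (1/4) ^ k \<le> a (\<tau> k)"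
    by metis
  define \<epsilon> where "\<epsilon> k = sqrt (\<tau> k / 2)" for k
  have \<epsilon>: "0 < \<epsilon> k" "(\<epsilon> k)\<^sup>2 = \<tau> k / 2" for k using \<tau>(1)[of k] by (auto simp: \<epsilon>_def)
  have inv_lim: "(\<lambda>k. 1 / real (Suc k)) \<longlonglongrightarrow> 0" using LIMSEQ_inverse_real_of_nat by (simp add: inverse_eq_divide)
  have "\<tau> \<longlonglongrightarrow> 0"
    by (rule tendsto_sandwich[OF _ _ tendsto_const inv_lim])
       (auto intro!: always_eventually less_imp_le[OF \<tau>(1)] \<tau>(2)[unfolded of_nat_Suc])
  hence "(\<lambda>k. sqrt (\<tau> k / 2)) \<longlonglongrightarrow> sqrt (0 / 2)" by (intro tendsto_intros) auto
  hence \<epsilon>_lim: "\<epsilon> \<longlonglongrightarrow> 0" by (simp add: \<epsilon>_def[abs_def])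
  define G where "G k = mollified \<mu> (\<epsilon> k)" for k
  have [measurable]: "G k \<in> borel_measurable borel" for k by (simp add: G_def)
  have G0: "0 \<le> G k x" for k x by (simp add: G_def)
  have G1: "(\<integral>\<^sup>+x. ennreal (G k x) \<partial>lborel) = 1" for k unfolding G_def by (rule nn_integral_mollified[OF \<epsilon>(1)])
  have GG: "(\<integral>\<^sup>+x. ennreal (G j x * G k x) \<partial>lborel) = ennreal (a (\<tau> j / 2 + \<tau> k / 2))" for j k
    unfolding G_def nn_integral_mollified_mult[OF \<epsilon>(1) \<epsilon>(1)] \<epsilon>(2) using \<tau>(1)[of j] \<tau>(1)[of k] by (intro E_eq) auto
  have GGi: "integrable lborel (\<lambda>x. G j x * G k x)" for j k
    by (rule integrableI_nn_integral_finite[OF _ _ GG]) (auto simp: G0 a_nonneg)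
  have GGe: "(\<integral>x. G j x * G k x \<partial>lborel) = a (\<tau> j / 2 + \<tau> k / 2)" for j k
    by (subst integral_eq_nn_integral) (auto simp: GG G0 a_nonneg)
  have diff: "(\<integral>\<^sup>+x. ennreal ((G j x - G k x)\<^sup>2) \<partial>lborel) \<le> ennreal (2 * (1/4) ^ k)" if jk: "k \<le> j" for j k
  proof -
    have sq: "(G j x - G k x)\<^sup>2 = G j x * G j x + G k x * G k x - 2 * (G j x * G k x)" for x
      by (simp add: power2_eq_square algebra_simps)
    have "(\<integral>\<^sup>+x. ennreal ((G j x - G k x)\<^sup>2) \<partial>lborel) = ennreal (\<integral>x. (G j x - G k x)\<^sup>2 \<partial>lborel)"
    proof (rule nn_integral_eq_integral)
      show "integrable lborel (\<lambda>x. (G j x - G k x)\<^sup>2)" unfolding sq by (simp add: GGi)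
    qed simp
    also have "(\<integral>x. (G j x - G k x)\<^sup>2 \<partial>lborel) = a (\<tau> j) + a (\<tau> k) - 2 * a (\<tau> j / 2 + \<tau> k / 2)"
      unfolding sq by (simp add: GGi GGe)
    also have "\<dots> \<le> 2 * (1/4) ^ k"
    proof -
      have "a (max (\<tau> j) (\<tau> k)) \<le> a (\<tau> j / 2 + \<tau> k / 2)"
        using \<tau>(1)[of j] \<tau>(1)[of k] by (intro a_mono) (auto simp: max_def)
      moreover have "a0 - (1/4) ^ k \<le> a (max (\<tau> j) (\<tau> k))"
      proof (cases "\<tau> j \<le> \<tau> k")
        case True thus ?thesis using \<tau>(3)[of k] by (simp add: max_absorb2)
      next
        case False
        have "(1/4::real) ^ j \<le> (1/4) ^ k" using jk by (intro power_decreasing) auto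
        moreover have max: "max (\<tau> j) (\<tau> k) = \<tau> j" using False by simp
        ultimately show ?thesis unfolding max using \<tau>(3)[of j] by linarith
      qed
      ultimately show ?thesis using a_le[OF \<tau>(1), of j] a_le[OF \<tau>(1), of k] by simp
    qed
    finally show ?thesis by (simp add: ennreal_leI)
  qed
  have conv: "AE x in lborel. convergent (\<lambda>k. G k x)"
  proof -
    \<comment> \<open>The squared norms of the increments decay like \<open>4 powr (- k)\<close>, so they remain summable with weights
      \<open>2 ^ k\<close>; pointwise this makes the increments themselves summable.\<close>
    let ?S = "\<lambda>x. \<Sum>k. ennreal (2 ^ k * (G (Suc k) x - G k x)\<^sup>2)"
    have "(\<integral>\<^sup>+x. ?S x \<partial>lborel) = (\<Sum>k. \<integral>\<^sup>+x. ennreal (2 ^ k * (G (Suc k) x - G k x)\<^sup>2) \<partial>lborel)"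
      by (rule nn_integral_suminf) measurable
    also have "\<dots> \<le> (\<Sum>k. ennreal (2 * (1/2) ^ k))"
    proof (intro suminf_le summableI)
      fix k
      have "(\<integral>\<^sup>+x. ennreal (2 ^ k * (G (Suc k) x - G k x)\<^sup>2) \<partial>lborel) = ennreal (2 ^ k) * (\<integral>\<^sup>+x. ennreal ((G (Suc k) x - G k x)\<^sup>2) \<partial>lborel)"
        by (subst nn_integral_cmult[symmetric]) (auto simp: ennreal_mult)
      also have "\<dots> \<le> ennreal (2 ^ k) * ennreal (2 * (1/4) ^ k)"
        by (intro mult_left_mono diff) auto
      also have "\<dots> = ennreal (2 * (1/2) ^ k)"
        by (simp add: ennreal_mult[symmetric] power_divide power_mult_distrib[symmetric] field_simps)
      finally show "(\<integral>\<^sup>+x. ennreal (2 ^ k * (G (Suc k) x - G k x)\<^sup>2) \<partial>lborel) \<le> ennreal (2 * (1/2) ^ k)" .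
    qed
    also have "\<dots> < \<infinity>"
      by (subst suminf_ennreal2) (auto intro!: summable_mult summable_geometric)
    finally have "AE x in lborel. ?S x \<noteq> \<infinity>"
      by (intro nn_integral_noteq_infinite) auto
    thus ?thesis
    proof eventually_elim
      case (elim x)
      define d where "d k = G (Suc k) x - G k x" for k
      define B where "B = enn2real (?S x)"
      have "?S x < \<top>" using elim unfolding infinity_ennreal_def less_top .
      from ennreal_enn2real[OF this] have B: "?S x = ennreal B" "B \<ge> 0"
        unfolding B_def by (rule sym, intro enn2real_nonneg)
      have "norm (d k) \<le> sqrt B * (1 / sqrt 2) ^ k" for k
      proof -
        have "ennreal (2 ^ k * (d k)\<^sup>2) = (\<Sum>i\<in>{k}. ennreal (2 ^ i * (G (Suc i) x - G i x)\<^sup>2))" by (simp add: d_def)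
        also have "\<dots> \<le> ?S x" by (rule sum_le_suminf) auto
        finally have "2 ^ k * (d k)\<^sup>2 \<le> B" using B by simp
        hence "sqrt (2 ^ k * (d k)\<^sup>2) \<le> sqrt B" by simp
        hence "sqrt 2 ^ k * \<bar>d k\<bar> \<le> sqrt B" by (simp only: real_sqrt_mult real_sqrt_power[symmetric] real_sqrt_abs)
        thus ?thesis by (simp add: power_divide field_simps)
      qed
      moreover have "summable (\<lambda>k. sqrt B * (1 / sqrt 2) ^ k)"
        by (intro summable_mult summable_geometric) simp
      ultimately have "summable d" by (rule summable_comparison_test'[where N=0, rotated])
      hence "convergent (\<lambda>n. \<Sum>k<n. d k)" by (simp add: summable_iff_convergent)
      hence "convergent (\<lambda>n. G 0 x + (\<Sum>k<n. d k))" by (intro convergent_add convergent_const)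
      moreover have "G 0 x + (\<Sum>k<n. d k) = G n x" for n unfolding d_def by (induction n) auto
      ultimately show ?case by simp
    qed
  qed
  define g where "g x = max 0 (lim (\<lambda>k. G k x))" for x
  have g_meas [measurable]: "g \<in> borel_measurable borel" unfolding g_def by measurable
  have g0: "0 \<le> g x" for x by (simp add: g_def)
  have lim: "AE x in lborel. (\<lambda>k. G k x) \<longlonglongrightarrow> g x"
    using conv
  proof eventually_elim
    case (elim x)
    hence l: "(\<lambda>k. G k x) \<longlonglongrightarrow> lim (\<lambda>k. G k x)" by (simp add: convergent_LIMSEQ_iff)
    moreover have "0 \<le> lim (\<lambda>k. G k x)" by (rule LIMSEQ_le_const[OF l]) (auto simp: G0)
    ultimately show ?case by (simp add: g_def)
  qed
  have g_int: "(\<integral>\<^sup>+x. ennreal (g x) \<partial>lborel) \<le> 1"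
  proof (rule nn_integral_AE_limit_le[where H="\<lambda>j x. ennreal (G j x)" and k=0])
    show "AE x in lborel. (\<lambda>j. ennreal (G j x)) \<longlonglongrightarrow> ennreal (g x)"
      using lim by eventually_elim (rule tendsto_ennrealI)
  qed (auto simp: G1)
  have g_sq: "(\<integral>\<^sup>+x. ennreal ((g x)\<^sup>2) \<partial>lborel) \<le> ennreal a0"
  proof (rule nn_integral_AE_limit_le[where H="\<lambda>j x. ennreal ((G j x)\<^sup>2)" and k=0])
    show "AE x in lborel. (\<lambda>j. ennreal ((G j x)\<^sup>2)) \<longlonglongrightarrow> ennreal ((g x)\<^sup>2)"
      using lim by eventually_elim (intro tendsto_ennrealI tendsto_intros)
    show "(\<integral>\<^sup>+x. ennreal ((G j x)\<^sup>2) \<partial>lborel) \<le> ennreal a0" for j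
      using GG[of j j] a_le[OF \<tau>(1), of j] by (simp add: power2_eq_square ennreal_leI)
  qed auto
  have g_diff: "(\<integral>\<^sup>+x. ennreal ((g x - G k x)\<^sup>2) \<partial>lborel) \<le> ennreal (2 * (1/4) ^ k)" for k
  proof (rule nn_integral_AE_limit_le[where H="\<lambda>j x. ennreal ((G j x - G k x)\<^sup>2)" and k=k])
    show "AE x in lborel. (\<lambda>j. ennreal ((G j x - G k x)\<^sup>2)) \<longlonglongrightarrow> ennreal ((g x - G k x)\<^sup>2)"
      using lim by eventually_elim (intro tendsto_ennrealI tendsto_intros)
  qed (auto intro: diff)
  have le_bounded: "emeasure \<mu> U \<le> (\<integral>\<^sup>+x. indicator U x * ennreal (g x) \<partial>lborel)" if U: "open U" "bounded U" for U
  proof -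
    have [measurable]: "U \<in> sets borel" using U by auto
    have Ufin: "emeasure lborel U < \<infinity>" using U(2) by (rule emeasure_bounded_finite)
    let ?I = "\<integral>\<^sup>+x. indicator U x * ennreal (g x) \<partial>lborel"
    have "emeasure \<mu> U \<le> ?I + ennreal \<delta> * emeasure lborel U" if \<delta>: "\<delta> > 0" for \<delta>
    proof -
      have step: "(\<integral>\<^sup>+x. indicator U x * ennreal (G k x) \<partial>lborel) \<le> ?I + ennreal \<delta> * emeasure lborel U + ennreal (2 / \<delta> * (1/4) ^ k)" for k
      proof -
        \<comment> \<open>An integrable substitute for the Cauchy--Schwarz inequality on the set \<open>U\<close> of finite measure.\<close>
        have pt: "G k x \<le> g x + \<delta> + (g x - G k x)\<^sup>2 / \<delta>" for x
        proof (cases "G k x - g x \<le> \<delta>")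
          case True
          thus ?thesis using \<delta> by (simp add: add_increasing2)
        next
          case False
          hence "(G k x - g x) * \<delta> \<le> (G k x - g x) * (G k x - g x)" using \<delta> by (intro mult_left_mono) auto
          also have "\<dots> = (g x - G k x)\<^sup>2" by (simp add: power2_eq_square algebra_simps)
          finally have "G k x - g x \<le> (g x - G k x)\<^sup>2 / \<delta>" using \<delta> by (simp add: pos_le_divide_eq)
          thus ?thesis using \<delta> by simp
        qed
        have "(\<integral>\<^sup>+x. indicator U x * ennreal (G k x) \<partial>lborel)
           \<le> (\<integral>\<^sup>+x. indicator U x * ennreal (g x) + ennreal \<delta> * indicator U x + ennreal (1 / \<delta>) * ennreal ((g x - G k x)\<^sup>2) \<partial>lborel)"
        proof (rule nn_integral_mono)
          fix x
          show "indicator U x * ennreal (G k x) \<le> indicator U x * ennreal (g x) + ennreal \<delta> * indicator U x + ennreal (1 / \<delta>) * ennreal ((g x - G k x)\<^sup>2)"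
          proof (cases "x \<in> U")
            case True
            have "ennreal (G k x) \<le> ennreal (g x + \<delta> + (1 / \<delta>) * (g x - G k x)\<^sup>2)"
              using pt[of x] by (intro ennreal_leI) simp
            also have "\<dots> = ennreal (g x) + ennreal \<delta> + ennreal (1 / \<delta>) * ennreal ((g x - G k x)\<^sup>2)"
              using \<delta> g0[of x] by (simp only: ennreal_plus ennreal_mult add_nonneg_nonneg less_imp_le zero_le_power2 mult_nonneg_nonneg zero_le_divide_1_iff)
            finally show ?thesis using True by simp
          qed simp
        qed
        also have "\<dots> = ?I + ennreal \<delta> * emeasure lborel U + ennreal (1 / \<delta>) * (\<integral>\<^sup>+x. ennreal ((g x - G k x)\<^sup>2) \<partial>lborel)"
          by (simp add: nn_integral_add nn_integral_cmult)
        also have "\<dots> \<le> ?I + ennreal \<delta> * emeasure lborel U + ennreal (1 / \<delta>) * ennreal (2 * (1/4) ^ k)"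
          by (intro add_left_mono mult_left_mono g_diff) auto
        also have "ennreal (1 / \<delta>) * ennreal (2 * (1/4) ^ k) = ennreal (2 / \<delta> * (1/4) ^ k)"
          using \<delta> by (simp add: ennreal_mult[symmetric])
        finally show ?thesis .
      qed
      have "emeasure \<mu> U \<le> liminf (\<lambda>k. \<integral>\<^sup>+x. indicator U x * ennreal (G k x) \<partial>lborel)"
        unfolding G_def by (rule emeasure_open_le_liminf_mollified[OF \<epsilon>(1) \<epsilon>_lim U(1)])
      also have "\<dots> \<le> liminf (\<lambda>k. ?I + ennreal \<delta> * emeasure lborel U + ennreal (2 / \<delta> * (1/4) ^ k))"
        by (intro Liminf_mono always_eventually allI step)
      also have "\<dots> = ?I + ennreal \<delta> * emeasure lborel U + ennreal (2 / \<delta> * 0)"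
      proof (rule lim_imp_Liminf)
        have "(\<lambda>k. 2 / \<delta> * (1/4) ^ k) \<longlonglongrightarrow> 2 / \<delta> * 0"
          by (intro tendsto_intros LIMSEQ_power_zero) simp
        thus "(\<lambda>k. ?I + ennreal \<delta> * emeasure lborel U + ennreal (2 / \<delta> * (1/4) ^ k)) \<longlonglongrightarrow> ?I + ennreal \<delta> * emeasure lborel U + ennreal (2 / \<delta> * 0)"
          by (intro tendsto_add tendsto_const tendsto_ennrealI)
      qed simp
      finally show ?thesis by simp
    qed
    hence *: "emeasure \<mu> U \<le> ?I + ennreal (1 / real (Suc n)) * emeasure lborel U" for n by simp
    have "(\<lambda>n. ?I + ennreal (1 / real (Suc n)) * emeasure lborel U) \<longlonglongrightarrow> ?I + ennreal 0 * emeasure lborel U"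
    proof (intro tendsto_add tendsto_const)
      have "(\<lambda>n. emeasure lborel U * ennreal (1 / real (Suc n))) \<longlonglongrightarrow> emeasure lborel U * ennreal 0"
        using Ufin by (intro ennreal_tendsto_cmult tendsto_ennrealI inv_lim) auto
      thus "(\<lambda>n. ennreal (1 / real (Suc n)) * emeasure lborel U) \<longlonglongrightarrow> ennreal 0 * emeasure lborel U"
        by (simp only: mult.commute)
    qed
    from LIMSEQ_le_const[OF this] * show ?thesis by auto
  qed
  define N where "N = density lborel (\<lambda>x. ennreal (g x))"
  have N_em: "emeasure N A = (\<integral>\<^sup>+x. indicator A x * ennreal (g x) \<partial>lborel)" if "A \<in> sets borel" for A
    unfolding N_def using that by (subst emeasure_density) (auto simp: mult.commute)
  have le: "emeasure \<mu> U \<le> emeasure N U" if U: "open U" for U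
  proof -
    have "emeasure \<mu> (\<Union>n. U \<inter> ball 0 (real n)) = (SUP n. emeasure \<mu> (U \<inter> ball 0 (real n)))"
      using U by (intro SUP_emeasure_incseq[symmetric]) (auto simp: sets_\<mu> incseq_def)
    also have "(\<Union>n. U \<inter> ball 0 (real n)) = U" by (auto intro: reals_Archimedean2)
    also have "(SUP n. emeasure \<mu> (U \<inter> ball 0 (real n))) \<le> emeasure N U"
    proof (rule SUP_least)
      fix n
      have "emeasure \<mu> (U \<inter> ball 0 (real n)) \<le> emeasure N (U \<inter> ball 0 (real n))"
        using U by (subst N_em) (auto intro!: le_bounded)
      also have "\<dots> \<le> emeasure N U" using U by (intro emeasure_mono) (auto simp: N_def)
      finally show "emeasure \<mu> (U \<inter> ball 0 (real n)) \<le> emeasure N U" .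
    qed
    finally show ?thesis .
  qed
  have "space \<mu> = UNIV" using sets_eq_imp_space_eq[OF sets_\<mu>] by simp
  hence "1 \<le> emeasure N UNIV" using le[of UNIV] emeasure_space_1 by simp
  moreover have "emeasure N UNIV \<le> 1" using g_int by (subst N_em) auto
  ultimately have "prob_space N" by (intro prob_spaceI) (simp add: N_def)
  hence "\<mu> = N" using prob by (intro prob_measure_eqI_open le sets_\<mu>) (auto simp: N_def)
  moreover have "integrable lborel (\<lambda>x. (g x)\<^sup>2)"
  proof (rule integrableI_bounded)
    show "(\<integral>\<^sup>+x. ennreal (norm ((g x)\<^sup>2)) \<partial>lborel) < \<infinity>"
      using le_less_trans[OF g_sq ennreal_less_top] by simp
  qed simp
  ultimately show ?thesis using g0 g_meas by (intro exI[of _ g]) (auto simp: N_def)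
qed

end

section \<open>Self-similar measures of contracting similarities\<close>

lemma emeasure_distr_nn_integral:
  assumes [measurable]: "g \<in> measurable M borel" "A \<in> sets borel"
  shows "emeasure (distr M borel g) A = (\<integral>\<^sup>+x. indicator A (g x) \<partial>M)"
proof -
  have "emeasure (distr M borel g) A = (\<integral>\<^sup>+y. indicator A y \<partial>distr M borel g)" by simp
  also have "\<dots> = (\<integral>\<^sup>+x. indicator A (g x) \<partial>M)" by (rule nn_integral_distr) measurable
  finally show ?thesis .
qed

text \<open>The compact set \<open>B\<close>, which all maps send into itself, carries the self-similar measure. It may be
larger than the attractor; in the application it is a ball.\<close>

locale similarity_ifs =
  fixes J :: "nat set" and f :: "nat \<Rightarrow> 'a::euclidean_space \<Rightarrow> 'a" and r :: real and B :: "'a set"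
  assumes finite_J: "finite J" and J_nonempty: "J \<noteq> {}"
    and r_pos: "0 < r" and r_less_1: "r < 1"
    and dist_f: "\<And>j x y. j \<in> J \<Longrightarrow> dist (f j x) (f j y) = r * dist x y"
    and compact_B: "compact B" and B_nonempty: "B \<noteq> {}"
    and f_B: "\<And>j x. j \<in> J \<Longrightarrow> x \<in> B \<Longrightarrow> f j x \<in> B"
begin

definition N :: nat where "N = card J"

lemma N_pos: "N > 0" using finite_J J_nonempty by (simp add: N_def card_gt_0_iff)

abbreviation "U \<equiv> uniform_count_measure J"
abbreviation "S \<equiv> stream_space U"

sublocale U: prob_space U
  by (rule prob_space_uniform_count_measure[OF finite_J J_nonempty])

sublocale S: prob_space S by (rule U.prob_space_stream_space)

lemma space_U: "space U = J" by (simp add: space_uniform_count_measure)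

lemma nn_integral_U: "(\<integral>\<^sup>+j. h j \<partial>U) = (\<Sum>j\<in>J. h j) / of_nat N"
proof -
  have "(\<integral>\<^sup>+j. h j \<partial>U) = (\<Sum>j\<in>J. ennreal (1 / real (card J)) * h j)"
    unfolding uniform_count_measure_def using finite_J by (simp add: nn_integral_point_measure_finite)
  also have "\<dots> = (\<Sum>j\<in>J. h j) * ennreal (1 / real (card J))"
    by (simp add: sum_distrib_right mult.commute)
  also have "\<dots> = (\<Sum>j\<in>J. h j) / of_nat N"
    using N_pos by (simp add: N_def divide_ennreal_def ennreal_of_nat_eq_real_of_nat inverse_ennreal inverse_eq_divide)
  finally show ?thesis .
qed

lemma f_continuous: "j \<in> J \<Longrightarrow> continuous_on UNIV (f j)"
  using r_pos by (intro lipschitz_on_continuous_on[where L=r] lipschitz_onI) (simp_all add: dist_f)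

lemma f_measurable: "j \<in> J \<Longrightarrow> f j \<in> borel_measurable borel"
  by (intro borel_measurable_continuous_onI f_continuous)

lemma f_select_measurable:
  assumes g: "g \<in> measurable M U" and h: "h \<in> borel_measurable M"
  shows "(\<lambda>x. f (g x) (h x)) \<in> borel_measurable M"
proof (rule measurable_compose_countable'[where I=J])
  show "(\<lambda>x. f j (h x)) \<in> borel_measurable M" if "j \<in> J" for j
    using measurable_compose[OF h f_measurable[OF that]] .
  have "sets U = sets (count_space J)" by (simp add: sets_uniform_count_measure)
  thus "g \<in> measurable M (count_space J)" using g measurable_cong_sets[OF refl] by metis
qed (use finite_J in \<open>simp add: countable_finite\<close>)

text \<open>The composition of the maps selected by the first \<open>n\<close> entries of a stream, the head being outermost.\<close>

primrec app :: "nat \<Rightarrow> nat stream \<Rightarrow> 'a \<Rightarrow> 'a" where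
  "app 0 s x = x"
| "app (Suc n) s x = f (shd s) (app n (stl s) x)"

lemma app_measurable:
  assumes "g \<in> measurable M S" and h: "h \<in> borel_measurable M"
  shows "(\<lambda>z. app n (g z) (h z)) \<in> borel_measurable M"
  using assms(1)
proof (induction n arbitrary: g)
  case (Suc n)
  note [measurable] = Suc.prems
  have "(\<lambda>z. shd (g z)) \<in> measurable M U" "(\<lambda>z. stl (g z)) \<in> measurable M S" by measurable
  thus ?case by (auto intro!: f_select_measurable Suc.IH)
qed (simp add: h)

lemma dist_app: "s \<in> streams J \<Longrightarrow> dist (app n s x) (app n s y) = r ^ n * dist x y"
proof (induction n arbitrary: s)
  case (Suc n)
  thus ?case by (cases s) (auto simp: dist_f streams_Stream)
qed simp

lemma app_B: "s \<in> streams J \<Longrightarrow> x \<in> B \<Longrightarrow> app n s x \<in> B"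
proof (induction n arbitrary: s)
  case (Suc n)
  thus ?case by (cases s) (auto simp: f_B streams_Stream)
qed simp

lemma app_add: "app (n + m) s x = app n s (app m (sdrop n s) x)"
  by (induction n arbitrary: s) auto

definition b0 :: 'a where "b0 = (SOME b. b \<in> B)"

lemma b0: "b0 \<in> B" unfolding b0_def using B_nonempty by (simp add: some_in_eq)

text \<open>The self-similar measure is realized as the law of the limit point of a stream of independent
uniformly chosen maps.\<close>

definition code :: "nat stream \<Rightarrow> 'a" where "code s = lim (\<lambda>n. app n s b0)"

lemma streams_sdrop: "s \<in> streams J \<Longrightarrow> sdrop n s \<in> streams J"
proof (induction n arbitrary: s)
  case (Suc n)
  thus ?case by (cases s) (auto simp: streams_Stream)
qed simp

lemma r_power_lim: "(\<lambda>n. r ^ n * c) \<longlonglongrightarrow> 0"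
proof -
  have "(\<lambda>n. r ^ n * c) \<longlonglongrightarrow> 0 * c"
    using r_pos r_less_1 by (intro tendsto_intros LIMSEQ_power_zero) auto
  thus ?thesis by simp
qed

lemma app_tendsto_code:
  assumes s: "s \<in> streams J"
  shows "(\<lambda>n. app n s x) \<longlonglongrightarrow> code s"
proof -
  have bd: "dist (app n s b0) (app (n + m) s b0) \<le> r ^ n * diameter B" for n m
  proof -
    have "dist (app n s b0) (app (n + m) s b0) = r ^ n * dist b0 (app m (sdrop n s) b0)"
      unfolding app_add by (rule dist_app[OF s])
    also have "\<dots> \<le> r ^ n * diameter B"
      using r_pos by (intro mult_left_mono diameter_bounded_bound compact_imp_bounded[OF compact_B] b0 app_B streams_sdrop s) auto
    finally show ?thesis .
  qed
  have "Cauchy (\<lambda>n. app n s b0)"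
  proof (rule metric_CauchyI)
    fix e :: real assume "e > 0"
    then obtain M where M: "\<And>n. n \<ge> M \<Longrightarrow> norm (r ^ n * diameter B - 0) < e / 2"
      using LIMSEQ_D[OF r_power_lim, of "e / 2" "diameter B"] by auto
    show "\<exists>M. \<forall>m\<ge>M. \<forall>n\<ge>M. dist (app m s b0) (app n s b0) < e"
    proof (intro exI allI impI)
      fix m n assume "M \<le> m" "M \<le> n"
      have *: "dist (app M s b0) (app k s b0) < e / 2" if "M \<le> k" for k
        using bd[of M "k - M"] M[of M] that by simp
      show "dist (app m s b0) (app n s b0) < e"
        using dist_triangle_half_r[OF *[OF \<open>M \<le> m\<close>] *[OF \<open>M \<le> n\<close>]] .
    qed
  qed
  hence lim: "(\<lambda>n. app n s b0) \<longlonglongrightarrow> code s"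
    unfolding code_def by (simp add: Cauchy_convergent_iff convergent_LIMSEQ_iff)
  have "(\<lambda>n. dist (app n s x) (app n s b0)) \<longlonglongrightarrow> 0"
    unfolding dist_app[OF s] by (rule r_power_lim)
  hence "(\<lambda>n. app n s x - app n s b0) \<longlonglongrightarrow> 0" by (simp add: dist_norm tendsto_norm_zero_iff)
  from tendsto_add[OF this lim] show ?thesis by simp
qed

lemma code_B: "s \<in> streams J \<Longrightarrow> code s \<in> B"
  by (rule closed_sequentially[OF compact_imp_closed[OF compact_B] _ app_tendsto_code[of s b0]])
     (auto intro: app_B b0)

lemma code_Stream:
  assumes "j \<in> J" "s \<in> streams J"
  shows "code (j ## s) = f j (code s)"
proof (rule LIMSEQ_unique)
  have "(\<lambda>n. app (Suc n) (j ## s) b0) \<longlonglongrightarrow> code (j ## s)"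
    using assms by (intro LIMSEQ_Suc app_tendsto_code) (simp add: streams_Stream)
  thus "(\<lambda>n. f j (app n s b0)) \<longlonglongrightarrow> code (j ## s)" by simp
  show "(\<lambda>n. f j (app n s b0)) \<longlonglongrightarrow> f j (code s)"
    using f_continuous[OF assms(1)]
    by (intro isCont_tendsto_compose[OF _ app_tendsto_code[OF assms(2)]]) (simp add: continuous_on_eq_continuous_at)
qed

lemma code_measurable [measurable]: "code \<in> borel_measurable S"
  unfolding code_def
  by (intro borel_measurable_lim_metric app_measurable measurable_ident_sets refl measurable_const) auto

definition nu :: "'a measure" where "nu = distr S borel code"

lemma sets_nu [simp, measurable_cong]: "sets nu = sets borel" by (simp add: nu_def)
lemma space_nu [simp]: "space nu = UNIV" by (simp add: nu_def)

sublocale nu: prob_space nu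
  unfolding nu_def by (rule S.prob_space_distr) measurable

lemma nu_self_similar: "is_uniform_self_similar J f nu"
  unfolding is_uniform_self_similar_def
proof (intro conjI ballI)
  fix A :: "'a set" assume A [measurable]: "A \<in> sets borel"
  have "emeasure nu A = (\<integral>\<^sup>+s. indicator A (code s) \<partial>S)"
    unfolding nu_def by (rule emeasure_distr_nn_integral) measurable
  also have "\<dots> = (\<integral>\<^sup>+j. \<integral>\<^sup>+s. indicator A (code (j ## s)) \<partial>S \<partial>U)"
    by (rule U.nn_integral_stream_space) measurable
  also have "\<dots> = (\<Sum>j\<in>J. \<integral>\<^sup>+s. indicator A (code (j ## s)) \<partial>S) / of_nat N"
    by (rule nn_integral_U)
  also have "(\<Sum>j\<in>J. \<integral>\<^sup>+s. indicator A (code (j ## s)) \<partial>S) = (\<Sum>j\<in>J. emeasure (distr nu borel (f j)) A)"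
  proof (rule sum.cong)
    fix j assume j: "j \<in> J"
    note [measurable] = f_measurable[OF j]
    have "(\<integral>\<^sup>+s. indicator A (code (j ## s)) \<partial>S) = (\<integral>\<^sup>+s. indicator A (f j (code s)) \<partial>S)"
      using j by (intro nn_integral_cong) (simp add: code_Stream space_stream_space space_U)
    also have "\<dots> = (\<integral>\<^sup>+x. indicator A (f j x) \<partial>nu)"
      unfolding nu_def by (subst nn_integral_distr) auto
    also have "\<dots> = (\<integral>\<^sup>+x. indicator A x \<partial>distr nu borel (f j))"
      by (subst nn_integral_distr) auto
    also have "\<dots> = emeasure (distr nu borel (f j)) A" by simp
    finally show "(\<integral>\<^sup>+s. indicator A (code (j ## s)) \<partial>S) = emeasure (distr nu borel (f j)) A" .
  qed simp
  finally show "emeasure nu A = (\<Sum>j\<in>J. emeasure (distr nu borel (f j)) A) / of_nat (card J)"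
    by (simp add: N_def)
qed (auto intro: nu.prob_space_axioms)

text \<open>Self-similarity says that applying a random map to an independent point of law \<open>\<mu>\<close> gives law \<open>\<mu>\<close>
again; in this form it passes from sets to integrals.\<close>

lemma self_similar_eq_distr:
  assumes "is_uniform_self_similar J f \<mu>"
  shows "\<mu> = distr (U \<Otimes>\<^sub>M \<mu>) borel (\<lambda>(j, x). f j x)" and "(\<lambda>z. f (fst z) (snd z)) \<in> borel_measurable (U \<Otimes>\<^sub>M \<mu>)"
proof -
  interpret \<mu>: prob_space \<mu> using assms by (simp add: is_uniform_self_similar_def)
  have s [measurable_cong]: "sets \<mu> = sets borel" using assms by (simp add: is_uniform_self_similar_def)
  show m: "(\<lambda>z. f (fst z) (snd z)) \<in> borel_measurable (U \<Otimes>\<^sub>M \<mu>)"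
    by (rule f_select_measurable) measurable
  show "\<mu> = distr (U \<Otimes>\<^sub>M \<mu>) borel (\<lambda>(j, x). f j x)"
  proof (rule measure_eqI)
    fix A assume "A \<in> sets \<mu>"
    hence A [measurable]: "A \<in> sets borel" using s by simp
    note [measurable] = m
    have "emeasure (distr (U \<Otimes>\<^sub>M \<mu>) borel (\<lambda>(j, x). f j x)) A = (\<integral>\<^sup>+z. indicator A (f (fst z) (snd z)) \<partial>(U \<Otimes>\<^sub>M \<mu>))"
      unfolding case_prod_beta' by (rule emeasure_distr_nn_integral) measurable
    also have "\<dots> = (\<integral>\<^sup>+j. \<integral>\<^sup>+x. indicator A (f j x) \<partial>\<mu> \<partial>U)"
      by (subst \<mu>.nn_integral_fst[symmetric]) auto
    also have "\<dots> = (\<Sum>j\<in>J. \<integral>\<^sup>+x. indicator A (f j x) \<partial>\<mu>) / of_nat N" by (rule nn_integral_U)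
    also have "(\<Sum>j\<in>J. \<integral>\<^sup>+x. indicator A (f j x) \<partial>\<mu>) = (\<Sum>j\<in>J. emeasure (distr \<mu> borel (f j)) A)"
    proof (rule sum.cong)
      fix j assume j: "j \<in> J"
      note [measurable] = f_measurable[OF j]
      have "(\<integral>\<^sup>+x. indicator A (f j x) \<partial>\<mu>) = (\<integral>\<^sup>+x. indicator A x \<partial>distr \<mu> borel (f j))"
        by (subst nn_integral_distr) auto
      thus "(\<integral>\<^sup>+x. indicator A (f j x) \<partial>\<mu>) = emeasure (distr \<mu> borel (f j)) A" by simp
    qed simp
    finally show "emeasure \<mu> A = emeasure (distr (U \<Otimes>\<^sub>M \<mu>) borel (\<lambda>(j, x). f j x)) A"
      using assms by (simp add: is_uniform_self_similar_def N_def)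
  qed (simp add: s)
qed

lemma nn_integral_self_similar:
  assumes "is_uniform_self_similar J f \<mu>" and h [measurable]: "h \<in> borel_measurable borel"
  shows "(\<integral>\<^sup>+x. h x \<partial>\<mu>) = (\<integral>\<^sup>+j. \<integral>\<^sup>+x. h (f j x) \<partial>\<mu> \<partial>U)"
proof -
  interpret \<mu>: prob_space \<mu> using assms by (simp add: is_uniform_self_similar_def)
  note [measurable] = self_similar_eq_distr(2)[OF assms(1)]
  have "(\<integral>\<^sup>+x. h x \<partial>\<mu>) = (\<integral>\<^sup>+x. h x \<partial>distr (U \<Otimes>\<^sub>M \<mu>) borel (\<lambda>(j, x). f j x))"
    using self_similar_eq_distr(1)[OF assms(1)] by simp
  also have "\<dots> = (\<integral>\<^sup>+z. h (f (fst z) (snd z)) \<partial>(U \<Otimes>\<^sub>M \<mu>))"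
    by (subst nn_integral_distr) (auto simp: case_prod_beta')
  also have "\<dots> = (\<integral>\<^sup>+j. \<integral>\<^sup>+x. h (f j x) \<partial>\<mu> \<partial>U)"
    by (subst \<mu>.nn_integral_fst[symmetric]) auto
  finally show ?thesis .
qed

lemma nn_integral_iterate:
  assumes ss: "is_uniform_self_similar J f \<mu>" and h: "h \<in> borel_measurable borel"
  shows "(\<integral>\<^sup>+x. h x \<partial>\<mu>) = (\<integral>\<^sup>+s. \<integral>\<^sup>+x. h (app n s x) \<partial>\<mu> \<partial>S)"
  using h
proof (induction n arbitrary: h)
  case 0
  thus ?case by (simp add: S.emeasure_space_1)
next
  case (Suc n)
  interpret \<mu>: prob_space \<mu> using ss by (simp add: is_uniform_self_similar_def)
  have [measurable_cong]: "sets \<mu> = sets borel" using ss by (simp add: is_uniform_self_similar_def)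
  note [measurable] = Suc.prems
  have meas: "(\<lambda>s. \<integral>\<^sup>+x. h (app (Suc n) s x) \<partial>\<mu>) \<in> borel_measurable S"
  proof (rule \<mu>.borel_measurable_nn_integral)
    have "(\<lambda>z. app (Suc n) (fst z) (snd z)) \<in> borel_measurable (S \<Otimes>\<^sub>M \<mu>)"
      by (rule app_measurable) measurable
    from measurable_compose[OF this Suc.prems]
    show "(\<lambda>(s, x). h (app (Suc n) s x)) \<in> borel_measurable (S \<Otimes>\<^sub>M \<mu>)" by (simp add: case_prod_beta')
  qed
  have "(\<integral>\<^sup>+x. h x \<partial>\<mu>) = (\<integral>\<^sup>+j. \<integral>\<^sup>+x. h (f j x) \<partial>\<mu> \<partial>U)"
    by (rule nn_integral_self_similar[OF ss Suc.prems])
  also have "\<dots> = (\<integral>\<^sup>+j. \<integral>\<^sup>+s. \<integral>\<^sup>+x. h (f j (app n s x)) \<partial>\<mu> \<partial>S \<partial>U)"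
  proof (rule nn_integral_cong)
    fix j assume "j \<in> space U"
    hence [measurable]: "f j \<in> borel_measurable borel" by (simp add: space_U f_measurable)
    show "(\<integral>\<^sup>+x. h (f j x) \<partial>\<mu>) = (\<integral>\<^sup>+s. \<integral>\<^sup>+x. h (f j (app n s x)) \<partial>\<mu> \<partial>S)"
      by (rule Suc.IH[of "\<lambda>x. h (f j x)"]) measurable
  qed
  also have "\<dots> = (\<integral>\<^sup>+j. \<integral>\<^sup>+s. \<integral>\<^sup>+x. h (app (Suc n) (j ## s) x) \<partial>\<mu> \<partial>S \<partial>U)" by simp
  also have "\<dots> = (\<integral>\<^sup>+s. \<integral>\<^sup>+x. h (app (Suc n) s x) \<partial>\<mu> \<partial>S)"
    by (rule U.nn_integral_stream_space[OF meas, symmetric])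
  finally show ?case .
qed

text \<open>Applying \<open>n\<close> random maps to a point of law \<open>\<mu>\<close> reproduces \<open>\<mu>\<close>, while the images converge to the limit
point of the stream, whatever the starting point. For open sets Fatou's lemma gives one inequality,
and that is enough.\<close>

lemma self_similar_unique:
  assumes ss: "is_uniform_self_similar J f \<mu>"
  shows "nu = \<mu>"
proof (rule prob_measure_eqI_open)
  show "prob_space nu" "sets nu = sets borel" by (auto intro: nu.prob_space_axioms)
  interpret \<mu>: prob_space \<mu> using ss by (simp add: is_uniform_self_similar_def)
  show "prob_space \<mu>" by (rule \<mu>.prob_space_axioms)
  show s [measurable_cong]: "sets \<mu> = sets borel" using ss by (simp add: is_uniform_self_similar_def)
  fix V :: "'a set" assume V: "open V"
  hence [measurable]: "V \<in> sets borel" by auto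
  have am: "(\<lambda>z. app n (fst z) (snd z)) \<in> borel_measurable (S \<Otimes>\<^sub>M \<mu>)" for n
    by (rule app_measurable) measurable
  have am': "(\<lambda>z. indicator V (app n (fst z) (snd z)) :: ennreal) \<in> borel_measurable (S \<Otimes>\<^sub>M \<mu>)" for n
    using measurable_compose[OF am, of "indicator V" borel n] by auto
  have am1: "(\<lambda>x. indicator V (app n s x) :: ennreal) \<in> borel_measurable \<mu>" if "s \<in> space S" for s n
  proof -
    have "(\<lambda>x. app n s x) \<in> borel_measurable \<mu>" using that by (intro app_measurable) measurable
    from measurable_compose[OF this, of "indicator V" borel] show ?thesis by auto
  qed
  have "emeasure nu V = (\<integral>\<^sup>+s. indicator V (code s) \<partial>S)"
    unfolding nu_def by (rule emeasure_distr_nn_integral) measurable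
  also have "\<dots> = (\<integral>\<^sup>+s. \<integral>\<^sup>+x. indicator V (code s) \<partial>\<mu> \<partial>S)" by (simp add: \<mu>.emeasure_space_1)
  also have "\<dots> \<le> (\<integral>\<^sup>+s. \<integral>\<^sup>+x. liminf (\<lambda>n. indicator V (app n s x)) \<partial>\<mu> \<partial>S)"
  proof (intro nn_integral_mono)
    fix s x assume "s \<in> space S"
    hence s: "s \<in> streams J" by (simp add: space_stream_space space_U)
    show "indicator V (code s) \<le> (liminf (\<lambda>n. indicator V (app n s x)) :: ennreal)"
    proof (cases "code s \<in> V")
      case True
      have "eventually (\<lambda>n. app n s x \<in> V) sequentially"
        by (rule topological_tendstoD[OF app_tendsto_code[OF s] V True])
      hence "eventually (\<lambda>n. indicator V (code s) \<le> (indicator V (app n s x) :: ennreal)) sequentially"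
        by eventually_elim (simp add: True)
      thus ?thesis by (rule Liminf_bounded)
    qed simp
  qed
  also have "\<dots> \<le> (\<integral>\<^sup>+s. liminf (\<lambda>n. \<integral>\<^sup>+x. indicator V (app n s x) \<partial>\<mu>) \<partial>S)"
    by (intro nn_integral_mono nn_integral_liminf am1)
  also have "\<dots> \<le> liminf (\<lambda>n. \<integral>\<^sup>+s. \<integral>\<^sup>+x. indicator V (app n s x) \<partial>\<mu> \<partial>S)"
    by (intro nn_integral_liminf \<mu>.borel_measurable_nn_integral) (use am' in \<open>simp add: case_prod_beta'\<close>)
  also have "\<dots> = liminf (\<lambda>n. emeasure \<mu> V)"
    using nn_integral_iterate[OF ss, of "indicator V"] by simp
  also have "\<dots> = emeasure \<mu> V" by (simp add: Liminf_const)
  finally show "emeasure nu V \<le> emeasure \<mu> V" .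
qed

lemma uniform_self_similar_measure_eq: "uniform_self_similar_measure J f = nu"
  unfolding uniform_self_similar_measure_def
  by (rule the_equality) (auto simp: nu_self_similar intro: self_similar_unique[symmetric])

lemma AE_nu_B: "AE x in nu. x \<in> B"
proof -
  have [measurable]: "B \<in> sets borel" using compact_B by (simp add: compact_imp_closed)
  show ?thesis unfolding nu_def
    by (subst AE_distr_iff) (auto intro!: AE_I2 code_B simp: space_stream_space space_U)
qed

lemma emeasure_nu:
  assumes [measurable]: "A \<in> sets borel"
  shows "emeasure nu A = (\<Sum>j\<in>J. emeasure nu (f j -` A)) / of_nat N"
proof -
  have "emeasure (distr nu borel (f j)) A = emeasure nu (f j -` A)" if "j \<in> J" for j
    using f_measurable[OF that] by (subst emeasure_distr) auto
  thus ?thesis using nu_self_similar assms by (simp add: is_uniform_self_similar_def N_def)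
qed

lemma nn_integral_nu:
  assumes "h \<in> borel_measurable borel"
  shows "(\<integral>\<^sup>+x. h x \<partial>nu) = (\<Sum>j\<in>J. \<integral>\<^sup>+x. h (f j x) \<partial>nu) / of_nat N"
  using nn_integral_self_similar[OF nu_self_similar assms] nn_integral_U by simp

lemma integral_nu:
  fixes h :: "'a \<Rightarrow> complex"
  assumes [measurable]: "h \<in> borel_measurable borel" and bd: "\<And>x. norm (h x) \<le> K"
  shows "(\<integral>x. h x \<partial>nu) = (\<Sum>j\<in>J. \<integral>x. h (f j x) \<partial>nu) / of_nat N"
proof -
  interpret P: pair_sigma_finite U nu ..
  interpret PP: prob_space "U \<Otimes>\<^sub>M nu" by (rule prob_space_pair) unfold_locales
  note [measurable] = self_similar_eq_distr(2)[OF nu_self_similar]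
  have "(\<integral>x. h x \<partial>nu) = (\<integral>x. h x \<partial>distr (U \<Otimes>\<^sub>M nu) borel (\<lambda>(j, x). f j x))"
    using self_similar_eq_distr(1)[OF nu_self_similar] by simp
  also have "\<dots> = (\<integral>z. h (f (fst z) (snd z)) \<partial>(U \<Otimes>\<^sub>M nu))"
    by (subst integral_distr) (auto simp: case_prod_beta')
  also have "\<dots> = (\<integral>j. \<integral>x. h (f (fst (j, x)) (snd (j, x))) \<partial>nu \<partial>U)"
    by (rule P.integral_fst'[symmetric]) (auto intro!: PP.integrable_const_bound[where B=K] bd)
  also have "\<dots> = (\<Sum>j\<in>J. \<integral>x. h (f j x) \<partial>nu) / of_nat N"
    unfolding uniform_count_measure_def using finite_J
    by (subst lebesgue_integral_point_measure_finite) (auto simp: N_def sum_divide_distrib scaleR_conv_of_real)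
  finally show ?thesis .
qed

end

section \<open>Dimensions of separated self-similar measures\<close>

lemma geometric_scale_exists:
  fixes c r z :: real
  assumes "0 < r" "r < 1" "0 < z" "z < c"
  shows "\<exists>n. c * r ^ Suc n \<le> z \<and> z < c * r ^ n"
proof -
  have "(\<lambda>n. c * r ^ n) \<longlonglongrightarrow> c * 0" using assms by (intro tendsto_intros LIMSEQ_power_zero) auto
  hence "eventually (\<lambda>n. c * r ^ n < z) sequentially" using assms by (intro order_tendstoD(2)) auto
  then obtain m where "c * r ^ m < z" using eventually_happens'[OF sequentially_bot] by blast
  hence ex: "\<exists>m. c * r ^ m \<le> z" by (auto intro: less_imp_le)
  define m where "m = (LEAST m. c * r ^ m \<le> z)"
  have m: "c * r ^ m \<le> z" unfolding m_def using ex by (rule LeastI_ex)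
  hence "m \<noteq> 0" using assms by (intro notI) simp
  then obtain n where n: "m = Suc n" by (cases m) auto
  hence "\<not> c * r ^ n \<le> z" using not_less_Least[of n "\<lambda>m. c * r ^ m \<le> z"] by (simp add: m_def)
  thus ?thesis using m n by (intro exI[of _ n]) auto
qed

text \<open>The condition \<open>dimension\<close> says that \<open>D\<close> is the similarity dimension.\<close>

locale separated_ifs = similarity_ifs +
  fixes \<kappa> D :: real
  assumes kappa_pos: "0 < \<kappa>" and D_pos: "0 < D"
    and separated: "\<And>i j x y. i \<in> J \<Longrightarrow> j \<in> J \<Longrightarrow> i \<noteq> j \<Longrightarrow> x \<in> B \<Longrightarrow> y \<in> B \<Longrightarrow> \<kappa> \<le> dist (f i x) (f j y)"
    and dimension: "real N * r powr D = 1"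
begin

lemma N_eq: "1 / real N = r powr D"
  using dimension N_pos by (simp add: field_simps)

lemma inv_N_power: "(1 / real N) ^ n = (r ^ n) powr D"
  unfolding N_eq using r_pos by (simp add: powr_power powr_realpow[symmetric] powr_powr mult.commute)

lemma N_gt_1: "1 / real N < 1" "real N > 1"
proof -
  have "r powr D < 1 powr D" using r_pos r_less_1 D_pos by (intro powr_less_mono2) auto
  thus "1 / real N < 1" unfolding N_eq by simp
  thus "real N > 1" using N_pos by (simp add: field_simps)
qed

text \<open>A set of diameter below \<open>\<kappa>\<close> meets the image of \<open>B\<close> under at most one map, so only one term of the
self-similarity relation survives. Pulling back by that map enlarges the set by the factor \<open>1 / r\<close> and
loses a factor \<open>1 / N\<close> of mass, which can be repeated as long as the set stays small.\<close>

lemma small_set_measure: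
  assumes "A \<in> sets borel" "n > 0 \<longrightarrow> (\<forall>x\<in>A. \<forall>y\<in>A. dist x y < \<kappa> * r ^ (n - 1))"
  shows "emeasure nu A \<le> ennreal ((1 / real N) ^ n)"
  using assms
proof (induction n arbitrary: A)
  case 0
  show ?case using nu.measure_le_1[of A] by (simp add: nu.emeasure_eq_measure)
next
  case (Suc n)
  note A [measurable] = Suc.prems(1)
  have near: "dist x y < \<kappa> * r ^ n" if "x \<in> A" "y \<in> A" for x y using Suc.prems(2) that by auto
  have [measurable]: "B \<in> sets borel" using compact_B by (simp add: compact_imp_closed)
  have fA [measurable]: "f j -` A \<in> sets borel" if "j \<in> J" for j
    using measurable_sets[OF f_measurable[OF that] A] by simp
  have null: "emeasure nu (f j -` A) = 0" if "j \<in> J" "f j -` A \<inter> B = {}" for j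
  proof -
    have "AE x in nu. x \<notin> f j -` A" using AE_nu_B by eventually_elim (use that in auto)
    thus ?thesis using AE_iff_measurable[of "f j -` A" nu "\<lambda>x. x \<notin> f j -` A"] fA[OF that(1)] by auto
  qed
  have bd: "emeasure nu (f i -` A) \<le> ennreal ((1 / real N) ^ n)" if i: "i \<in> J" for i
  proof (rule Suc.IH[OF fA[OF i]], intro impI ballI)
    fix x y assume n: "0 < n" and "x \<in> f i -` A" "y \<in> f i -` A"
    hence "r * dist x y < \<kappa> * r ^ n" using near[of "f i x" "f i y"] i by (simp add: dist_f)
    also have "\<dots> = r * (\<kappa> * r ^ (n - 1))" using n by (cases n) auto
    finally show "dist x y < \<kappa> * r ^ (n - 1)" using r_pos by simp
  qed
  have "(\<Sum>j\<in>J. emeasure nu (f j -` A)) \<le> ennreal ((1 / real N) ^ n)"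
  proof (cases "\<exists>i\<in>J. f i -` A \<inter> B \<noteq> {}")
    case True
    then obtain i x where i: "i \<in> J" "f i x \<in> A" "x \<in> B" by auto
    have "emeasure nu (f j -` A) = 0" if j: "j \<in> J" "j \<noteq> i" for j
    proof (rule null[OF j(1)], rule ccontr)
      assume "f j -` A \<inter> B \<noteq> {}"
      then obtain y where y: "f j y \<in> A" "y \<in> B" by auto
      have "\<kappa> \<le> dist (f j y) (f i x)" using i y j by (intro separated) auto
      also have "\<dots> < \<kappa> * r ^ n" using i y by (intro near)
      also have "\<dots> \<le> \<kappa> * 1" using kappa_pos r_pos r_less_1 by (intro mult_left_mono power_le_one) auto
      finally show False by simp
    qed
    hence "(\<Sum>j\<in>J. emeasure nu (f j -` A)) = emeasure nu (f i -` A)"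
      using finite_J i by (subst sum.remove[of _ i]) auto
    thus ?thesis using bd[OF i(1)] by simp
  next
    case False
    hence "(\<Sum>j\<in>J. emeasure nu (f j -` A)) = 0" using null by (intro sum.neutral) auto
    thus ?thesis by simp
  qed
  hence "emeasure nu A \<le> ennreal ((1 / real N) ^ n) / of_nat N"
    unfolding emeasure_nu[OF A] by (rule divide_right_mono_ennreal)
  also have "\<dots> = ennreal ((1 / real N) ^ Suc n)"
    using N_pos by (simp add: ennreal_of_nat_eq_real_of_nat divide_ennreal)
  finally show ?case .
qed

lemma frostman:
  assumes A: "A \<in> sets borel" and d: "\<And>x y. x \<in> A \<Longrightarrow> y \<in> A \<Longrightarrow> dist x y \<le> d" and d0: "0 \<le> d"
  shows "emeasure nu A \<le> ennreal ((d / \<kappa>) powr D)"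
proof -
  consider "d = 0" | "0 < d" "d < \<kappa>" | "\<kappa> \<le> d" using d0 by linarith
  thus ?thesis
  proof cases
    case 1
    have "emeasure nu A \<le> ennreal ((1 / real N) ^ n)" for n
    proof (rule small_set_measure[OF A], intro impI ballI)
      fix x y assume "x \<in> A" "y \<in> A"
      hence "dist x y \<le> 0" using d 1 by simp
      also have "0 < \<kappa> * r ^ (n - 1)" using kappa_pos r_pos by simp
      finally show "dist x y < \<kappa> * r ^ (n - 1)" .
    qed
    moreover have "(\<lambda>n. ennreal ((1 / real N) ^ n)) \<longlonglongrightarrow> ennreal 0"
      using N_gt_1 by (intro tendsto_ennrealI LIMSEQ_power_zero) auto
    ultimately have "emeasure nu A \<le> ennreal 0" by (intro LIMSEQ_le_const) auto
    thus ?thesis by simp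
  next
    case 2
    then obtain n where n: "\<kappa> * r ^ Suc n \<le> d" "d < \<kappa> * r ^ n"
      using geometric_scale_exists[OF r_pos r_less_1, of d \<kappa>] by auto
    have "emeasure nu A \<le> ennreal ((1 / real N) ^ Suc n)"
      by (rule small_set_measure[OF A]) (use d n in \<open>auto intro: le_less_trans\<close>)
    also have "(1 / real N) ^ Suc n \<le> (d / \<kappa>) powr D"
      unfolding inv_N_power using n(1) r_pos D_pos kappa_pos
      by (intro powr_mono2) (auto simp: pos_le_divide_eq mult.commute)
    finally show ?thesis by (simp add: ennreal_leI)
  next
    case 3
    have "emeasure nu A \<le> ennreal 1" using nu.measure_le_1[of A] by (simp add: nu.emeasure_eq_measure)
    also have "1 \<le> (d / \<kappa>) powr D"
      using 3 kappa_pos D_pos by (intro ge_one_powr_ge_zero) auto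
    finally show ?thesis by (simp add: ennreal_leI)
  qed
qed

text \<open>Points have measure zero, so the diagonal does not matter, and the kernel is dominated by a sum over
geometric scales. The ball of scale \<open>n\<close> has measure at most \<open>(r ^ n) powr D\<close> up to a constant, which
makes the sum a geometric series of ratio \<open>r powr (D - \<alpha>)\<close>.\<close>

lemma nn_integral_riesz_le:
  assumes \<alpha>: "0 < \<alpha>" "\<alpha> < D"
  shows "\<exists>C\<ge>0. \<forall>x. (\<integral>\<^sup>+y. riesz_kernel \<alpha> x y \<partial>nu) \<le> ennreal C"
proof -
  define c where "c = \<kappa> / 2"
  have c: "c > 0" using kappa_pos by (simp add: c_def)
  define q where "q = r powr (D - \<alpha>)"
  have q: "0 < q" "q < 1"
  proof -
    have "r powr (D - \<alpha>) < 1 powr (D - \<alpha>)" using r_pos r_less_1 \<alpha> by (intro powr_less_mono2) auto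
    thus "q < 1" by (simp add: q_def)
  qed (use r_pos in \<open>simp add: q_def\<close>)
  define C where "C = c powr (- \<alpha>) + (\<Sum>n. c powr (- \<alpha>) * q ^ Suc n)"
  have sm: "summable (\<lambda>n. c powr (- \<alpha>) * q ^ Suc n)"
    using q by (simp only: power_Suc mult.assoc[symmetric]) (intro summable_mult summable_geometric, simp)
  have "(\<integral>\<^sup>+y. riesz_kernel \<alpha> x y \<partial>nu) \<le> ennreal C" for x
  proof -
    let ?w = "\<lambda>n. (c * r ^ Suc n) powr (- \<alpha>)"
    have ball: "emeasure nu (ball x (c * r ^ n)) \<le> ennreal ((1 / real N) ^ Suc n)" for n
    proof (rule small_set_measure)
      show "0 < Suc n \<longrightarrow> (\<forall>y\<in>ball x (c * r ^ n). \<forall>z\<in>ball x (c * r ^ n). dist y z < \<kappa> * r ^ (Suc n - 1))"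
      proof (intro impI ballI)
        fix y z assume "y \<in> ball x (c * r ^ n)" "z \<in> ball x (c * r ^ n)"
        hence "dist y z < 2 * (c * r ^ n)" using dist_triangle3[of y z x] by simp
        thus "dist y z < \<kappa> * r ^ (Suc n - 1)" by (simp add: c_def)
      qed
    qed simp
    have "AE y in nu. y \<noteq> x"
    proof -
      have "emeasure nu {x} \<le> ennreal ((0 / \<kappa>) powr D)" by (rule frostman) auto
      hence "emeasure nu {x} = 0" by simp
      thus ?thesis by (intro AE_I[of _ _ "{x}"]) auto
    qed
    hence "(\<integral>\<^sup>+y. riesz_kernel \<alpha> x y \<partial>nu) \<le> (\<integral>\<^sup>+y. ennreal (c powr (- \<alpha>)) + (\<Sum>n. ennreal (?w n) * indicator (ball x (c * r ^ n)) y) \<partial>nu)"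
    proof (intro nn_integral_mono_AE, eventually_elim)
      case (elim y)
      show ?case
      proof (cases "c \<le> dist x y")
        case True
        hence "dist x y powr (- \<alpha>) \<le> c powr (- \<alpha>)" using c \<alpha> by (intro powr_mono2') auto
        hence "riesz_kernel \<alpha> x y \<le> ennreal (c powr (- \<alpha>))" using elim by (auto simp: riesz_kernel_def intro: ennreal_leI)
        thus ?thesis by (rule add_increasing2[rotated]) simp
      next
        case False
        then obtain n where n: "c * r ^ Suc n \<le> dist x y" "dist x y < c * r ^ n"
          using geometric_scale_exists[OF r_pos r_less_1, of "dist x y" c] elim by auto
        have "dist x y powr (- \<alpha>) \<le> ?w n" using n c r_pos \<alpha> by (intro powr_mono2') auto
        hence "riesz_kernel \<alpha> x y \<le> ennreal (?w n) * indicator (ball x (c * r ^ n)) y"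
          using elim n by (auto simp: riesz_kernel_def intro: ennreal_leI)
        also have "\<dots> = (\<Sum>i\<in>{n}. ennreal (?w i) * indicator (ball x (c * r ^ i)) y)"
          by (simp only: sum.insert finite.emptyI empty_iff not_False_eq_True sum.empty add_0_right)
        also have "\<dots> \<le> (\<Sum>n. ennreal (?w n) * indicator (ball x (c * r ^ n)) y)"
          by (rule sum_le_suminf) auto
        finally show ?thesis by (rule add_increasing[rotated]) simp
      qed
    qed
    also have "\<dots> = ennreal (c powr (- \<alpha>)) + (\<Sum>n. ennreal (?w n) * emeasure nu (ball x (c * r ^ n)))"
    proof -
      have [measurable]: "ball x t \<in> sets borel" for t by simp
      have "(\<integral>\<^sup>+y. (\<Sum>n. ennreal (?w n) * indicator (ball x (c * r ^ n)) y) \<partial>nu) = (\<Sum>n. ennreal (?w n) * emeasure nu (ball x (c * r ^ n)))"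
        by (subst nn_integral_suminf) (auto simp: nn_integral_cmult_indicator)
      thus ?thesis by (subst nn_integral_add) (auto simp: nu.emeasure_space_1[simplified])
    qed
    also have "\<dots> \<le> ennreal (c powr (- \<alpha>)) + (\<Sum>n. ennreal (c powr (- \<alpha>) * q ^ Suc n))"
    proof (intro add_left_mono suminf_le summableI)
      fix n
      have "?w n * (1 / real N) ^ Suc n = c powr (- \<alpha>) * q ^ Suc n"
      proof -
        have "?w n * (1 / real N) ^ Suc n = c powr (- \<alpha>) * ((r ^ Suc n) powr (- \<alpha>) * (r ^ Suc n) powr D)"
          unfolding inv_N_power using c r_pos by (subst powr_mult) auto
        also have "(r ^ Suc n) powr (- \<alpha>) * (r ^ Suc n) powr D = (r ^ Suc n) powr (D - \<alpha>)"
          by (simp add: powr_add[symmetric])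
        also have "\<dots> = q ^ Suc n"
          unfolding q_def using r_pos by (simp only: powr_realpow[symmetric] powr_powr powr_gt_zero mult.commute)
        finally show ?thesis .
      qed
      moreover have "ennreal (?w n) * emeasure nu (ball x (c * r ^ n)) \<le> ennreal (?w n) * ennreal ((1 / real N) ^ Suc n)"
        by (intro mult_left_mono ball) auto
      ultimately show "ennreal (?w n) * emeasure nu (ball x (c * r ^ n)) \<le> ennreal (c powr (- \<alpha>) * q ^ Suc n)"
        by (simp add: ennreal_mult[symmetric])
    qed
    also have "(\<Sum>n. ennreal (c powr (- \<alpha>) * q ^ Suc n)) = ennreal (\<Sum>n. c powr (- \<alpha>) * q ^ Suc n)"
      using q by (intro suminf_ennreal2 sm) auto
    also have "ennreal (c powr (- \<alpha>)) + \<dots> = ennreal C"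
      unfolding C_def using q by (intro ennreal_plus[symmetric] suminf_nonneg sm) auto
    finally show ?thesis .
  qed
  moreover have "C \<ge> 0" unfolding C_def using q by (intro add_nonneg_nonneg suminf_nonneg sm) auto
  ultimately show ?thesis by blast
qed

lemma riesz_energy_finite:
  assumes "0 < \<alpha>" "\<alpha> < D"
  shows "(\<integral>\<^sup>+x. \<integral>\<^sup>+y. riesz_kernel \<alpha> x y \<partial>nu \<partial>nu) < \<infinity>"
proof -
  obtain C where C: "\<And>x. (\<integral>\<^sup>+y. riesz_kernel \<alpha> x y \<partial>nu) \<le> ennreal C"
    using nn_integral_riesz_le[OF assms] by blast
  have "(\<integral>\<^sup>+x. \<integral>\<^sup>+y. riesz_kernel \<alpha> x y \<partial>nu \<partial>nu) \<le> (\<integral>\<^sup>+x. ennreal C \<partial>nu)"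
    by (intro nn_integral_mono C)
  also have "\<dots> = ennreal C" using nu.emeasure_space_1 by simp
  also have "\<dots> < \<infinity>" by simp
  finally show ?thesis .
qed

text \<open>If the two points are chosen in the same first-level piece, which has probability \<open>1 / N\<close>, the energy
is scaled by \<open>r powr (- \<alpha>)\<close>. So the energy \<open>I\<close> satisfies \<open>c * I \<le> I\<close> with \<open>c > 1\<close>, and being positive it
is infinite.\<close>

lemma riesz_energy_infinite:
  assumes \<alpha>: "D < \<alpha>"
  shows "(\<integral>\<^sup>+x. \<integral>\<^sup>+y. riesz_kernel \<alpha> x y \<partial>nu \<partial>nu) = \<infinity>"
proof (rule ccontr)
  let ?R = "riesz_kernel \<alpha> :: 'a \<Rightarrow> 'a \<Rightarrow> ennreal"
  define I where "I = (\<integral>\<^sup>+x. \<integral>\<^sup>+y. ?R x y \<partial>nu \<partial>nu)"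
  assume "(\<integral>\<^sup>+x. \<integral>\<^sup>+y. ?R x y \<partial>nu \<partial>nu) \<noteq> \<infinity>"
  hence fin: "I < \<infinity>" by (simp add: I_def less_top)
  have scale: "?R (f j x) (f j y) = ennreal (r powr (- \<alpha>)) * ?R x y" if j: "j \<in> J" for j x y
  proof (cases "x = y")
    case True
    thus ?thesis using \<alpha> D_pos r_pos by (simp add: riesz_kernel_def ennreal_mult_top)
  next
    case False
    hence "f j x \<noteq> f j y" using dist_f[OF j, of x y] r_pos by auto
    thus ?thesis using False r_pos by (simp add: riesz_kernel_def dist_f[OF j] powr_mult ennreal_mult)
  qed
  have "I = (\<Sum>i\<in>J. \<integral>\<^sup>+x. \<integral>\<^sup>+y. ?R (f i x) y \<partial>nu \<partial>nu) / of_nat N"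
    unfolding I_def by (rule nn_integral_nu) measurable
  also have "\<dots> \<ge> (\<Sum>i\<in>J. ennreal (r powr (- \<alpha>)) * I / of_nat N) / of_nat N"
  proof (intro divide_right_mono_ennreal sum_mono)
    fix i assume i: "i \<in> J"
    have "ennreal (r powr (- \<alpha>)) * I = (\<integral>\<^sup>+x. \<integral>\<^sup>+y. ?R (f i x) (f i y) \<partial>nu \<partial>nu)"
    proof -
      have "(\<integral>\<^sup>+y. ennreal (r powr (- \<alpha>)) * ?R x y \<partial>nu) = ennreal (r powr (- \<alpha>)) * (\<integral>\<^sup>+y. ?R x y \<partial>nu)" for x
        by (rule nn_integral_cmult) measurable
      thus ?thesis unfolding I_def scale[OF i] by (simp add: nn_integral_cmult)
    qed
    also have "\<dots> / of_nat N = (\<integral>\<^sup>+x. (\<integral>\<^sup>+y. ?R (f i x) (f i y) \<partial>nu) / of_nat N \<partial>nu)"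
    proof (rule nn_integral_divide[symmetric])
      note [measurable] = f_measurable[OF i]
      show "(\<lambda>x. \<integral>\<^sup>+y. ?R (f i x) (f i y) \<partial>nu) \<in> borel_measurable nu" by measurable
    qed
    also have "\<dots> \<le> (\<integral>\<^sup>+x. \<integral>\<^sup>+y. ?R (f i x) y \<partial>nu \<partial>nu)"
    proof (rule nn_integral_mono)
      fix x
      have "(\<integral>\<^sup>+y. ?R (f i x) y \<partial>nu) = (\<Sum>j\<in>J. \<integral>\<^sup>+y. ?R (f i x) (f j y) \<partial>nu) / of_nat N"
        by (rule nn_integral_nu) measurable
      also have "\<dots> \<ge> (\<integral>\<^sup>+y. ?R (f i x) (f i y) \<partial>nu) / of_nat N"
        using finite_J i by (intro divide_right_mono_ennreal member_le_sum) auto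
      finally show "(\<integral>\<^sup>+y. ?R (f i x) (f i y) \<partial>nu) / of_nat N \<le> (\<integral>\<^sup>+y. ?R (f i x) y \<partial>nu)" .
    qed
    finally show "ennreal (r powr (- \<alpha>)) * I / of_nat N \<le> (\<integral>\<^sup>+x. \<integral>\<^sup>+y. ?R (f i x) y \<partial>nu \<partial>nu)" .
  qed
  finally have le: "(\<Sum>i\<in>J. ennreal (r powr (- \<alpha>)) * I / of_nat N) / of_nat N \<le> I" .
  define t where "t = enn2real I"
  have t: "I = ennreal t" "0 \<le> t" using fin by (simp_all add: t_def)
  have "(\<Sum>i\<in>J. ennreal (r powr (- \<alpha>)) * I / of_nat N) / of_nat N = ennreal (r powr (- \<alpha>) * t / real N)"
    using N_pos t by (simp add: N_def[symmetric] ennreal_of_nat_eq_real_of_nat divide_ennreal ennreal_mult[symmetric])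
  hence "r powr (- \<alpha>) * t / real N \<le> t" using le t by simp
  moreover have "1 < r powr (- \<alpha>) / real N"
  proof -
    have "r powr (- \<alpha>) / real N = r powr (- \<alpha>) * r powr D" unfolding N_eq[symmetric] by simp
    also have "\<dots> = (1 / r) powr (\<alpha> - D)" using r_pos by (simp add: powr_add[symmetric] powr_divide powr_minus_divide[symmetric])
    also have "\<dots> > 1 powr (\<alpha> - D)" using r_pos r_less_1 \<alpha> by (intro powr_less_mono2) auto
    finally show ?thesis by simp
  qed
  ultimately have "t = 0" using t(2) mult_less_cancel_right1[of t "r powr (- \<alpha>) / real N"] by (simp add: mult.commute)
  hence "I = 0" using t by simp
  hence "AE x in nu. (\<integral>\<^sup>+y. ?R x y \<partial>nu) = 0" unfolding I_def by (subst (asm) nn_integral_0_iff_AE) auto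
  hence "AE x in nu. False"
  proof eventually_elim
    case (elim x)
    hence "AE y in nu. ?R x y = 0" by (subst (asm) nn_integral_0_iff_AE) auto
    hence "AE y in nu. False"
      by eventually_elim (use \<alpha> D_pos in \<open>auto simp: riesz_kernel_def split: if_splits\<close>)
    thus False using nu.AE_False by simp
  qed
  thus False using nu.AE_False by simp
qed

lemma correlation_dim_nu: "correlation_dim nu = ereal D"
  unfolding correlation_dim_def
proof (rule antisym)
  show "(SUP \<alpha> \<in> {\<alpha>. (\<integral>\<^sup>+x. \<integral>\<^sup>+y. riesz_kernel \<alpha> x y \<partial>nu \<partial>nu) < \<infinity>}. ereal \<alpha>) \<le> ereal D"
  proof (rule SUP_least)
    fix \<alpha> assume "\<alpha> \<in> {\<alpha>. (\<integral>\<^sup>+x. \<integral>\<^sup>+y. riesz_kernel \<alpha> x y \<partial>nu \<partial>nu) < \<infinity>}"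
    hence "\<not> D < \<alpha>" using riesz_energy_infinite[of \<alpha>] by (metis mem_Collect_eq less_irrefl)
    thus "ereal \<alpha> \<le> ereal D" by simp
  qed
  show "ereal D \<le> (SUP \<alpha> \<in> {\<alpha>. (\<integral>\<^sup>+x. \<integral>\<^sup>+y. riesz_kernel \<alpha> x y \<partial>nu \<partial>nu) < \<infinity>}. ereal \<alpha>)"
  proof (subst le_SUP_iff, intro allI impI)
    fix y assume "y < ereal D"
    then obtain z where z: "y < ereal z" "ereal z < ereal D" by (rule ereal_dense2[THEN exE]) auto
    have "0 < max z (D / 2)" "max z (D / 2) < D" using z D_pos by auto
    from riesz_energy_finite[OF this] show "\<exists>\<alpha>\<in>{\<alpha>. (\<integral>\<^sup>+x. \<integral>\<^sup>+y. riesz_kernel \<alpha> x y \<partial>nu \<partial>nu) < \<infinity>}. y < ereal \<alpha>"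
      using z by (intro bexI[of _ "max z (D / 2)"]) (auto intro: less_le_trans)
  qed
qed

text \<open>The mass distribution principle. Covering sets may fail to be measurable, but their closures have the
same diameter.\<close>

lemma hausdorff_dim_ge:
  assumes A: "A \<in> sets borel" "emeasure nu A > 0"
  shows "ereal D \<le> hausdorff_dim A"
  unfolding hausdorff_dim_def
proof (rule INF_greatest)
  fix s assume "s \<in> {s. 0 \<le> s \<and> hausdorff_measure s A = 0}"
  hence s: "0 \<le> s" "hausdorff_measure s A = 0" by auto
  have "D \<le> s"
  proof (rule ccontr)
    assume "\<not> D \<le> s"
    hence sD: "s < D" by simp
    define C where "C = \<kappa> powr (- D)"
    have C: "0 < C" using kappa_pos by (simp add: C_def)
    have set: "emeasure nu (closure V) \<le> ennreal C * diam_powr V s" if V: "bounded V" "diameter V \<le> 1" for V :: "'a set"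
    proof (cases "V = {}")
      case False
      let ?d = "diameter V"
      have d0: "0 \<le> ?d" by (rule diameter_ge_0[OF V(1)])
      have "emeasure nu (closure V) \<le> ennreal ((?d / \<kappa>) powr D)"
      proof (rule frostman)
        fix x y assume "x \<in> closure V" "y \<in> closure V"
        thus "dist x y \<le> ?d"
          using diameter_bounded_bound[of "closure V" x y] V(1) by (simp add: diameter_closure bounded_closure)
      qed (use d0 in auto)
      also have "(?d / \<kappa>) powr D = C * ?d powr D"
        using d0 kappa_pos by (simp add: C_def powr_divide powr_minus_divide)
      also have "ennreal (C * ?d powr D) \<le> ennreal C * diam_powr V s"
      proof -
        have "?d powr D \<le> (if s = 0 then 1 else ?d powr s)"
        proof (cases "s = 0")
          case True
          thus ?thesis using d0 V(2) D_pos by (simp add: powr_le1)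
        next
          case False
          thus ?thesis using d0 V(2) sD by (cases "?d = 0") (auto intro!: powr_mono')
        qed
        hence "ennreal (C * ?d powr D) \<le> ennreal C * ennreal (if s = 0 then 1 else ?d powr s)"
          using C by (subst ennreal_mult[symmetric]) (auto intro!: ennreal_leI)
        thus ?thesis using False by (cases "s = 0") (simp_all add: diam_powr_def)
      qed
      finally show ?thesis .
    qed simp
    have "hausdorff_premeasure s 1 A \<le> hausdorff_measure s A"
      unfolding hausdorff_measure_def by (rule SUP_upper) simp
    hence pre: "hausdorff_premeasure s 1 A = 0" using s(2) by simp
    have "ennreal (1 / C) * emeasure nu A \<le> hausdorff_premeasure s 1 A"
      unfolding hausdorff_premeasure_def
    proof (rule INF_greatest)
      fix V :: "nat \<Rightarrow> 'a set"
      assume "V \<in> {U. A \<subseteq> (\<Union>i. U i) \<and> (\<forall>i. bounded (U i) \<and> diameter (U i) \<le> 1)}"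
      hence V: "A \<subseteq> (\<Union>i. V i)" "\<And>i. bounded (V i)" "\<And>i. diameter (V i) \<le> 1" by auto
      have "emeasure nu A \<le> emeasure nu (\<Union>i. closure (V i))"
      proof (rule emeasure_mono)
        have "(\<Union>i. V i) \<subseteq> (\<Union>i. closure (V i))" by (intro UN_mono closure_subset subset_refl)
        thus "A \<subseteq> (\<Union>i. closure (V i))" using V(1) by (rule subset_trans[rotated])
      qed simp
      also have "\<dots> \<le> (\<Sum>i. emeasure nu (closure (V i)))"
        by (rule emeasure_subadditive_countably) auto
      also have "\<dots> \<le> (\<Sum>i. ennreal C * diam_powr (V i) s)"
        by (intro suminf_le summableI set V)
      also have "\<dots> = ennreal C * (\<Sum>i. diam_powr (V i) s)" by simp
      finally have "ennreal (1 / C) * emeasure nu A \<le> ennreal (1 / C) * (ennreal C * (\<Sum>i. diam_powr (V i) s))"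
        by (rule mult_left_mono) simp
      also have "\<dots> = (\<Sum>i. diam_powr (V i) s)"
        using C by (simp add: mult.assoc[symmetric] ennreal_mult[symmetric])
      finally show "ennreal (1 / C) * emeasure nu A \<le> (\<Sum>i. diam_powr (V i) s)" .
    qed
    hence "ennreal (1 / C) * emeasure nu A = 0" unfolding pre by simp
    thus False using A(2) C by (simp add: mult_eq_0_iff)
  qed
  thus "ereal D \<le> ereal s" by simp
qed

text \<open>The approximations from outside to the attractor.\<close>

primrec level :: "nat \<Rightarrow> 'a set" where
  "level 0 = B"
| "level (Suc n) = (\<Union>j\<in>J. f j ` level n)"

lemma compact_level: "compact (level n)"
proof (induction n)
  case (Suc n)
  thus ?case using finite_J f_continuous
    by (auto intro!: compact_UN compact_continuous_image intro: continuous_on_subset)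
qed (simp add: compact_B)

definition attractor :: "'a set" where "attractor = (\<Inter>n. level n)"

lemma level_borel [measurable]: "level n \<in> sets borel"
  using compact_level by (simp add: compact_imp_closed)

lemma attractor_borel [measurable]: "attractor \<in> sets borel"
  unfolding attractor_def by measurable

lemma code_level: "s \<in> streams J \<Longrightarrow> code s \<in> level n"
proof (induction n arbitrary: s)
  case (Suc n)
  then obtain j t where s: "s = j ## t" "j \<in> J" "t \<in> streams J" by (cases s) (auto simp: streams_Stream)
  thus ?case using Suc.IH[of t] by (auto simp: code_Stream)
qed (simp add: code_B)

lemma emeasure_nu_attractor: "emeasure nu attractor = 1"
proof -
  have "AE x in nu. x \<in> attractor"
    unfolding nu_def
    by (subst AE_distr_iff) (auto intro!: AE_I2 simp: attractor_def code_level space_stream_space space_U)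
  thus ?thesis by (subst nu.emeasure_eq_1_AE) auto
qed

lemma level_cover:
  "\<exists>\<C>. finite \<C> \<and> card \<C> \<le> N ^ n \<and> level n \<subseteq> \<Union>\<C> \<and> (\<forall>V\<in>\<C>. \<forall>x\<in>V. \<forall>y\<in>V. dist x y \<le> r ^ n * diameter B)"
proof (induction n)
  case 0
  show ?case
  proof (intro exI[of _ "{B}"] conjI ballI)
    fix V x y assume "V \<in> {B}" "x \<in> V" "y \<in> V"
    thus "dist x y \<le> r ^ 0 * diameter B"
      using diameter_bounded_bound[OF compact_imp_bounded[OF compact_B], of x y] by simp
  qed simp_all
next
  case (Suc n)
  then obtain \<C> where C: "finite \<C>" "card \<C> \<le> N ^ n" "level n \<subseteq> \<Union>\<C>" "\<forall>V\<in>\<C>. \<forall>x\<in>V. \<forall>y\<in>V. dist x y \<le> r ^ n * diameter B"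
    by (elim exE conjE)
  let ?C = "(\<lambda>(j, V). f j ` V) ` (J \<times> \<C>)"
  have "card ?C \<le> card (J \<times> \<C>)" using finite_J C(1) by (intro card_image_le) auto
  also have "\<dots> \<le> N ^ Suc n" using C(2) by (simp add: card_cartesian_product N_def)
  finally have "card ?C \<le> N ^ Suc n" .
  moreover have "level (Suc n) \<subseteq> \<Union>?C"
  proof
    fix x assume "x \<in> level (Suc n)"
    then obtain j y where jy: "j \<in> J" "y \<in> level n" "x = f j y" by auto
    then obtain V where V: "V \<in> \<C>" "y \<in> V" using C(3) by blast
    have "f j ` V \<in> ?C" using jy(1) V(1) by (intro image_eqI[where x="(j, V)"]) auto
    thus "x \<in> \<Union>?C" using jy(3) V(2) by blast
  qed
  moreover have "dist x y \<le> r ^ Suc n * diameter B" if V: "V \<in> ?C" and x: "x \<in> V" and y: "y \<in> V" for V x y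
  proof -
    obtain j W where W: "j \<in> J" "W \<in> \<C>" "V = f j ` W" using V by (elim imageE SigmaE) simp
    obtain a where a: "a \<in> W" "x = f j a" using x unfolding W(3) by (elim imageE) simp
    obtain b where b: "b \<in> W" "y = f j b" using y unfolding W(3) by (elim imageE) simp
    note ab = a(1) b(1) a(2) b(2)
    have "dist x y = r * dist a b" using W ab by (simp add: dist_f)
    also have "\<dots> \<le> r * (r ^ n * diameter B)" using r_pos W ab C(4) by (intro mult_left_mono) auto
    finally show ?thesis by (simp add: mult.assoc)
  qed
  moreover have "finite ?C" using finite_J C(1) by simp
  ultimately show ?case by (intro exI[of _ ?C] conjI ballI)
qed

lemma N_power_r_powr: "real N ^ n * (r ^ n) powr s = (r powr (s - D)) ^ n"
proof -
  have "r powr D * r powr (- D) = 1" using r_pos by (simp add: powr_add[symmetric])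
  hence "real N = (real N * r powr D) * r powr (- D)" by (simp only: mult.assoc mult_1_right)
  hence "real N = r powr (- D)" by (simp only: dimension mult_1)
  moreover have "(r ^ n) powr s = (r powr s) ^ n"
    using r_pos by (simp only: powr_realpow[symmetric] powr_powr powr_gt_zero mult.commute)
  ultimately have "real N ^ n * (r ^ n) powr s = (r powr (- D)) ^ n * (r powr s) ^ n" by simp
  also have "\<dots> = (r powr (s - D)) ^ n" unfolding power_mult_distrib[symmetric] powr_add[symmetric] by (simp add: add.commute)
  finally show ?thesis .
qed

lemma hausdorff_dim_attractor_le: "hausdorff_dim attractor \<le> ereal D"
proof (rule dense_ge_bounded[of _ "\<infinity>"])
  fix z :: ereal assume z: "ereal D < z" "z < \<infinity>"
  then obtain s where s: "z = ereal s" "D < s" by (cases z) auto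
  define b where "b = diameter B"
  have b: "0 \<le> b" unfolding b_def by (rule diameter_ge_0[OF compact_imp_bounded[OF compact_B]])
  define q where "q = r powr (s - D)"
  have q: "0 \<le> q" "q < 1"
  proof -
    have "r powr (s - D) < 1 powr (s - D)" using r_pos r_less_1 s by (intro powr_less_mono2) auto
    thus "q < 1" by (simp add: q_def)
  qed (simp add: q_def)
  have "hausdorff_premeasure s \<delta> attractor = 0" if \<delta>: "\<delta> > 0" for \<delta>
  proof -
    have bound: "hausdorff_premeasure s \<delta> attractor \<le> ennreal (q ^ n * b powr s)" if n: "r ^ n * b \<le> \<delta>" for n
    proof -
      obtain \<C> where C: "finite \<C>" "card \<C> \<le> N ^ n" "level n \<subseteq> \<Union>\<C>" "\<forall>V\<in>\<C>. \<forall>x\<in>V. \<forall>y\<in>V. dist x y \<le> r ^ n * b"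
        using level_cover[of n, folded b_def] by (elim exE conjE)
      obtain h where h: "bij_betw h {0..<card \<C>} \<C>" using ex_bij_betw_nat_finite[OF C(1)] by blast
      define V where "V i = (if i < card \<C> then h i else {})" for i
      have VC: "V i \<in> \<C>" if "i < card \<C>" for i using h that by (auto simp: V_def bij_betw_def)
      have rb: "0 \<le> r ^ n * b" using r_pos b by simp
      have Vd: "dist x y \<le> r ^ n * b" if "x \<in> V i" "y \<in> V i" for x y i
      proof (cases "i < card \<C>")
        case True
        thus ?thesis using C(4) VC[OF True] that by blast
      qed (use that in \<open>simp add: V_def\<close>)
      have diam: "diameter (V i) \<le> r ^ n * b" for i
        using rb by (intro diameter_le) (auto simp: dist_norm[symmetric] intro: Vd)
      have bdd: "bounded (V i)" for i
      proof (cases "V i = {}")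
        case False
        then obtain x where "x \<in> V i" by auto
        show ?thesis unfolding bounded_def
          using Vd[OF \<open>x \<in> V i\<close>] by (intro exI[of _ x] exI[of _ "r ^ n * b"] ballI)
      qed simp
      have "attractor \<subseteq> level n" by (auto simp: attractor_def)
      also have "\<dots> \<subseteq> \<Union>\<C>" by (rule C(3))
      also have "\<dots> \<subseteq> (\<Union>i. V i)"
      proof
        fix x assume "x \<in> \<Union>\<C>"
        then obtain W where W: "W \<in> \<C>" "x \<in> W" by auto
        have "W \<in> h ` {0..<card \<C>}" using W(1) h by (simp add: bij_betw_def)
        then obtain i where "i < card \<C>" "h i = W" by (elim imageE) simp
        thus "x \<in> (\<Union>i. V i)" using W by (auto simp: V_def)
      qed
      finally have "hausdorff_premeasure s \<delta> attractor \<le> (\<Sum>i. diam_powr (V i) s)"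
        unfolding hausdorff_premeasure_def using bdd order_trans[OF diam n]
        by (intro INF_lower) simp
      also have "\<dots> = (\<Sum>i\<in>{..<card \<C>}. diam_powr (V i) s)"
        by (rule suminf_finite) (auto simp: V_def diam_powr_def)
      also have "\<dots> \<le> (\<Sum>i\<in>{..<card \<C>}. ennreal ((r ^ n * b) powr s))"
      proof (rule sum_mono)
        fix i
        show "diam_powr (V i) s \<le> ennreal ((r ^ n * b) powr s)"
          using s D_pos diam[of i] diameter_ge_0[OF bdd, of i]
          by (auto simp: diam_powr_def intro!: ennreal_leI powr_mono2)
      qed
      also have "\<dots> = ennreal (real (card \<C>) * (r ^ n * b) powr s)"
        unfolding sum_constant card_lessThan ennreal_of_nat_eq_real_of_nat
        by (rule ennreal_mult[symmetric]) simp_all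
      also have "\<dots> \<le> ennreal (real N ^ n * (r ^ n * b) powr s)"
      proof -
        have "real (card \<C>) \<le> real N ^ n" using C(2) by (metis of_nat_power of_nat_le_iff)
        thus ?thesis by (intro ennreal_leI mult_right_mono powr_ge_zero)
      qed
      also have "real N ^ n * (r ^ n * b) powr s = q ^ n * b powr s"
        unfolding q_def N_power_r_powr[symmetric] using r_pos b by (simp add: powr_mult)
      finally show ?thesis .
    qed
    have "eventually (\<lambda>n. r ^ n * b < \<delta>) sequentially" by (rule order_tendstoD(2)[OF r_power_lim \<delta>])
    hence "eventually (\<lambda>n. hausdorff_premeasure s \<delta> attractor \<le> ennreal (q ^ n * b powr s)) sequentially"
      by eventually_elim (auto intro: bound)
    moreover have "(\<lambda>n. ennreal (q ^ n * b powr s)) \<longlonglongrightarrow> ennreal (0 * b powr s)"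
      using q by (intro tendsto_ennrealI tendsto_mult_right LIMSEQ_power_zero) auto
    ultimately have "hausdorff_premeasure s \<delta> attractor \<le> ennreal (0 * b powr s)"
      by (intro tendsto_lowerbound[where F=sequentially]) auto
    thus ?thesis by simp
  qed
  hence "hausdorff_measure s attractor = 0" by (simp add: hausdorff_measure_def)
  thus "hausdorff_dim attractor \<le> z" unfolding hausdorff_dim_def s(1) using s D_pos by (intro INF_lower) auto
qed (use D_pos in auto)

lemma hausdorff_dim_measure_nu: "hausdorff_dim_measure nu = ereal D"
  unfolding hausdorff_dim_measure_def
proof (rule antisym)
  show "(INF A \<in> {A \<in> sets nu. emeasure nu A > 0}. hausdorff_dim A) \<le> ereal D"
    using emeasure_nu_attractor hausdorff_dim_attractor_le by (intro INF_lower2[of attractor]) auto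
  show "ereal D \<le> (INF A \<in> {A \<in> sets nu. emeasure nu A > 0}. hausdorff_dim A)"
    by (intro INF_greatest hausdorff_dim_ge) auto
qed

lemma mutually_singular_nu:
  assumes D: "D < real DIM('a)"
  shows "mutually_singular nu lborel"
proof -
  define b where "b = diameter B"
  have b: "0 \<le> b" unfolding b_def by (rule diameter_ge_0[OF compact_imp_bounded[OF compact_B]])
  define q where "q = r powr (real DIM('a) - D)"
  have q: "0 \<le> q" "q < 1"
  proof -
    have "r powr (real DIM('a) - D) < 1 powr (real DIM('a) - D)" using r_pos r_less_1 D by (intro powr_less_mono2) auto
    thus "q < 1" by (simp add: q_def)
  qed (simp add: q_def)
  let ?v = "unit_ball_vol (real DIM('a)) * b ^ DIM('a)"
  have "emeasure lborel attractor \<le> ennreal (q ^ n * ?v)" for n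
  proof -
    obtain \<C> where C: "finite \<C>" "card \<C> \<le> N ^ n" "level n \<subseteq> \<Union>\<C>" "\<forall>V\<in>\<C>. \<forall>x\<in>V. \<forall>y\<in>V. dist x y \<le> r ^ n * b"
      using level_cover[of n, folded b_def] by (elim exE conjE)
    have rb: "0 \<le> r ^ n * b" using r_pos b by simp
    have v0: "0 \<le> unit_ball_vol (real DIM('a)) * (r ^ n * b) ^ DIM('a)"
      by (intro mult_nonneg_nonneg unit_ball_vol_nonneg zero_le_power rb of_nat_0_le_iff)
    have card_le: "real (card \<C>) \<le> real N ^ n"
      using C(2) by (metis of_nat_power of_nat_le_iff)
    define c where "c V = (SOME x. x \<in> V)" for V :: "'a set"
    have sub: "V \<subseteq> cball (c V) (r ^ n * b)" if "V \<in> \<C>" for V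
    proof
      fix x assume x: "x \<in> V"
      hence "c V \<in> V" unfolding c_def by (rule someI)
      thus "x \<in> cball (c V) (r ^ n * b)" using C(4) that x by simp
    qed
    have "attractor \<subseteq> level n" by (auto simp: attractor_def)
    also have "\<dots> \<subseteq> \<Union>\<C>" by (rule C(3))
    also have "\<dots> \<subseteq> (\<Union>V\<in>\<C>. cball (c V) (r ^ n * b))" using sub by blast
    finally have "emeasure lborel attractor \<le> emeasure lborel (\<Union>V\<in>\<C>. cball (c V) (r ^ n * b))"
      using C(1) by (intro emeasure_mono) (auto intro!: sets.finite_UN)
    also have "\<dots> \<le> (\<Sum>V\<in>\<C>. emeasure lborel (cball (c V) (r ^ n * b)))"
      using C(1) by (intro emeasure_subadditive_finite) auto
    also have "\<dots> = ennreal (real (card \<C>) * (unit_ball_vol (real DIM('a)) * (r ^ n * b) ^ DIM('a)))"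
    proof -
      have "(\<Sum>V\<in>\<C>. emeasure lborel (cball (c V) (r ^ n * b))) = (\<Sum>V\<in>\<C>. ennreal (unit_ball_vol (real DIM('a)) * (r ^ n * b) ^ DIM('a)))"
        by (intro sum.cong refl emeasure_cball rb)
      also have "\<dots> = of_nat (card \<C>) * ennreal (unit_ball_vol (real DIM('a)) * (r ^ n * b) ^ DIM('a))"
        by (rule sum_constant)
      also have "\<dots> = ennreal (real (card \<C>) * (unit_ball_vol (real DIM('a)) * (r ^ n * b) ^ DIM('a)))"
        unfolding ennreal_of_nat_eq_real_of_nat by (rule ennreal_mult[symmetric]) (simp_all only: v0 of_nat_0_le_iff)
      finally show ?thesis .
    qed
    also have "\<dots> \<le> ennreal (real N ^ n * (unit_ball_vol (real DIM('a)) * (r ^ n * b) ^ DIM('a)))"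
      by (intro ennreal_leI mult_right_mono card_le v0)
    also have "real N ^ n * (unit_ball_vol (real DIM('a)) * (r ^ n * b) ^ DIM('a)) = (real N ^ n * (r ^ n) powr (real DIM('a))) * ?v"
      using r_pos by (simp add: powr_realpow power_mult_distrib mult_ac)
    also have "real N ^ n * (r ^ n) powr (real DIM('a)) = q ^ n" unfolding q_def by (rule N_power_r_powr)
    finally show ?thesis .
  qed
  moreover have "(\<lambda>n. ennreal (q ^ n * ?v)) \<longlonglongrightarrow> ennreal (0 * ?v)"
    using q by (intro tendsto_ennrealI tendsto_mult_right LIMSEQ_power_zero) auto
  ultimately have "emeasure lborel attractor \<le> ennreal (0 * ?v)" by (intro LIMSEQ_le_const) auto
  hence null: "emeasure lborel attractor = 0" by simp
  have "emeasure nu (UNIV - attractor) = 0"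
    using emeasure_nu_attractor emeasure_compl[of attractor nu] nu.emeasure_space_1 by simp
  thus ?thesis unfolding mutually_singular_def
    using null by (intro exI[of _ "UNIV - attractor"]) (auto simp: Diff_Diff_Int)
qed

end

section \<open>Integer quaternions and factorizations into generators\<close>

datatype quat = Quat (qre: int) (qi: int) (qj: int) (qk: int)

instantiation quat :: ring_1
begin

definition "0 = Quat 0 0 0 0"
definition "1 = Quat 1 0 0 0"
definition "x + y = Quat (qre x + qre y) (qi x + qi y) (qj x + qj y) (qk x + qk y)"
definition "- x = Quat (- qre x) (- qi x) (- qj x) (- qk x)"
definition "x - y = Quat (qre x - qre y) (qi x - qi y) (qj x - qj y) (qk x - qk y)"
definition "x * y = Quat
  (qre x * qre y - qi x * qi y - qj x * qj y - qk x * qk y)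
  (qre x * qi y + qi x * qre y + qj x * qk y - qk x * qj y)
  (qre x * qj y - qi x * qk y + qj x * qre y + qk x * qi y)
  (qre x * qk y + qi x * qj y - qj x * qi y + qk x * qre y)"

instance
  by standard (auto simp: zero_quat_def one_quat_def plus_quat_def uminus_quat_def minus_quat_def times_quat_def algebra_simps)

end

definition qcnj :: "quat \<Rightarrow> quat" where
  "qcnj x = Quat (qre x) (- qi x) (- qj x) (- qk x)"

definition qnorm :: "quat \<Rightarrow> int" where
  "qnorm x = (qre x)\<^sup>2 + (qi x)\<^sup>2 + (qj x)\<^sup>2 + (qk x)\<^sup>2"

definition smul :: "int \<Rightarrow> quat \<Rightarrow> quat" where
  "smul n x = Quat (n * qre x) (n * qi x) (n * qj x) (n * qk x)"

definition qdvd :: "int \<Rightarrow> quat \<Rightarrow> bool" where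
  "qdvd n x \<longleftrightarrow> (\<exists>y. x = smul n y)"

lemma qnorm_mult: "qnorm (x * y) = qnorm x * qnorm y"
  by (simp add: qnorm_def times_quat_def power2_eq_square algebra_simps)

lemma qnorm_smul: "qnorm (smul n x) = n\<^sup>2 * qnorm x"
  by (simp add: qnorm_def smul_def power2_eq_square algebra_simps)

lemma qnorm_cnj [simp]: "qnorm (qcnj x) = qnorm x"
  by (simp add: qnorm_def qcnj_def)

lemma qnorm_nonneg: "0 \<le> qnorm x"
  by (simp add: qnorm_def)

lemma qnorm_one [simp]: "qnorm 1 = 1"
  by (simp add: qnorm_def one_quat_def)

lemma qcnj_mult: "qcnj (x * y) = qcnj y * qcnj x"
  by (simp add: qcnj_def times_quat_def algebra_simps)

lemma qcnj_one [simp]: "qcnj 1 = 1"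
  by (simp add: qcnj_def one_quat_def)

lemma qcnj_diff: "qcnj (x - y) = qcnj x - qcnj y"
  by (simp add: qcnj_def minus_quat_def)

lemma qcnj_mult_self: "qcnj x * (x * y) = smul (qnorm x) y" "x * (qcnj x * y) = smul (qnorm x) y"
  by (simp_all add: qcnj_def smul_def times_quat_def qnorm_def power2_eq_square algebra_simps)

lemma smul_mult: "smul n x * y = smul n (x * y)" "x * smul n y = smul n (x * y)"
  by (simp_all add: smul_def times_quat_def algebra_simps)

lemma smul_add: "smul n (x + y) = smul n x + smul n y" "smul n (x - y) = smul n x - smul n y"
  by (simp_all add: smul_def plus_quat_def minus_quat_def algebra_simps)

lemma smul_cancel: "n \<noteq> 0 \<Longrightarrow> smul n x = smul n y \<longleftrightarrow> x = y"
  by (cases x; cases y) (simp add: smul_def)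

lemma qdvd_iff: "qdvd n x \<longleftrightarrow> n dvd qre x \<and> n dvd qi x \<and> n dvd qj x \<and> n dvd qk x"
proof
  assume "n dvd qre x \<and> n dvd qi x \<and> n dvd qj x \<and> n dvd qk x"
  then obtain a b c d where "qre x = n * a" "qi x = n * b" "qj x = n * c" "qk x = n * d"
    by (elim conjE dvdE)
  hence "x = smul n (Quat a b c d)" by (cases x) (simp add: smul_def)
  thus "qdvd n x" unfolding qdvd_def by blast
next
  assume "qdvd n x"
  then obtain y where "x = smul n y" unfolding qdvd_def by blast
  thus "n dvd qre x \<and> n dvd qi x \<and> n dvd qj x \<and> n dvd qk x" by (simp add: smul_def)
qed

lemma qdvd_mult_right: "qdvd n x \<Longrightarrow> qdvd n (y * x)"
  unfolding qdvd_def using smul_mult(2) by metis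

lemma qdvd_smul_cancel: "m \<noteq> 0 \<Longrightarrow> qdvd (m * n) (smul m x) \<longleftrightarrow> qdvd n x"
  by (simp add: qdvd_iff smul_def)

text \<open>Left division by \<open>\<alpha>\<close> is multiplication by the conjugate followed by division by \<open>p\<close>; in this way
statements about left factors become statements about divisibility by the integer \<open>p\<close>.\<close>

lemma left_factor_cnj:
  assumes "qnorm \<alpha> = p" "p \<noteq> 0"
  shows "\<alpha> * w = x \<longleftrightarrow> qcnj \<alpha> * x = smul p w"
proof
  assume "qcnj \<alpha> * x = smul p w"
  hence "\<alpha> * (qcnj \<alpha> * x) = \<alpha> * smul p w" by simp
  hence "smul p x = smul p (\<alpha> * w)" using assms by (simp add: qcnj_mult_self smul_mult)
  thus "\<alpha> * w = x" using assms by (simp add: smul_cancel)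
qed (use assms in \<open>auto simp: qcnj_mult_self\<close>)

text \<open>The integer quaternions of norm \<open>p\<close> whose normalizations form \<open>Omega p\<close>. They are congruent to 1
modulo 2 and have positive real part, so no two of them differ by a unit factor.\<close>

definition generators :: "nat \<Rightarrow> quat set" where
  "generators p = {x. qnorm x = int p \<and> qre x > 0 \<and> odd (qre x) \<and> even (qi x) \<and> even (qj x) \<and> even (qk x)}"

text \<open>From the quadratic equation of \<open>x * q\<close>. Modulo a divisor of the norm of \<open>x\<close> the last term vanishes: this
is the identity \<open>x q x = tr (x q) x\<close> for matrices of rank one.\<close>

lemma rank_one_identity:
  "x * q * x = smul (2 * qre (x * q)) x - smul (qnorm x) (qcnj q)"
  by (simp add: smul_def times_quat_def minus_quat_def qcnj_def qnorm_def power2_eq_square algebra_simps)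

text \<open>Modulo \<open>p\<close> the integer quaternions are the two by two matrices. A nonzero \<open>y\<close> divisible on the left by
\<open>\<alpha>\<close> and by \<open>\<beta>\<close> has rank one and the same image as \<open>\<alpha>\<close> and as \<open>\<beta>\<close>; hence \<open>qcnj \<alpha> * \<beta>\<close> vanishes modulo \<open>p\<close>,
that is, \<open>\<beta>\<close> is \<open>\<alpha>\<close> times a unit. The normalization of the generators makes this unit 1.\<close>

lemma left_divisor_unique:
  assumes p: "prime p" "odd p" and a: "\<alpha> \<in> generators p" and b: "\<beta> \<in> generators p"
    and y: "\<not> qdvd (int p) y" and ay: "qdvd (int p) (qcnj \<alpha> * y)" and by': "qdvd (int p) (qcnj \<beta> * y)"
  shows "\<alpha> = \<beta>"
proof -
  have pi: "prime (int p)" and p0: "int p \<noteq> 0" using p by auto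
  have na: "qnorm \<alpha> = int p" and nb: "qnorm \<beta> = int p" using a b by (auto simp: generators_def)
  obtain a' where a': "qcnj \<alpha> * y = smul (int p) a'" using ay unfolding qdvd_def by blast
  obtain b' where b': "qcnj \<beta> * y = smul (int p) b'" using by' unfolding qdvd_def by blast
  have yb: "\<beta> * b' = y" using left_factor_cnj[OF nb p0] b' by blast
  have odd2: "\<not> int p dvd 2"
  proof
    assume "int p dvd 2"
    hence "p \<le> 2" using zdvd_imp_le by fastforce
    moreover have "2 \<le> p" using p by (simp add: prime_ge_2_nat)
    ultimately have "p = 2" by simp
    thus False using p by simp
  qed
  have *: "\<not> int p dvd 2 * z" if "\<not> int p dvd z" for z
    using pi odd2 that prime_dvd_mult_iff by blast
  \<comment> \<open>Up to sign the real parts of \<open>y * q\<close> for \<open>q\<close> among \<open>1, i, j, k\<close> are the coordinates of \<open>y\<close>.\<close>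
  obtain q where q: "\<not> int p dvd 2 * qre (y * q)"
  proof -
    consider "\<not> int p dvd qre y" | "\<not> int p dvd qi y" | "\<not> int p dvd qj y" | "\<not> int p dvd qk y"
      using y by (auto simp: qdvd_iff)
    thus ?thesis
    proof cases
      case 1 show ?thesis by (rule that[of 1], rule *) (use 1 in \<open>simp add: times_quat_def one_quat_def\<close>)
    next
      case 2 show ?thesis by (rule that[of "Quat 0 1 0 0"], rule *) (use 2 in \<open>simp add: times_quat_def\<close>)
    next
      case 3 show ?thesis by (rule that[of "Quat 0 0 1 0"], rule *) (use 3 in \<open>simp add: times_quat_def\<close>)
    next
      case 4 show ?thesis by (rule that[of "Quat 0 0 0 1"], rule *) (use 4 in \<open>simp add: times_quat_def\<close>)
    qed
  qed
  let ?t = "2 * qre (y * q)"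
  have id: "y * q * \<beta> = smul ?t \<beta> - smul (int p) (qcnj (b' * q))"
    using rank_one_identity[of \<beta> "b' * q"] yb nb by (simp add: mult.assoc[symmetric])
  have "smul ?t (qcnj \<alpha> * \<beta>) = qcnj \<alpha> * (y * q * \<beta>) + smul (int p) (qcnj \<alpha> * qcnj (b' * q))"
    unfolding id by (simp add: right_diff_distrib smul_mult)
  also have "qcnj \<alpha> * (y * q * \<beta>) = smul (int p) (a' * q * \<beta>)"
    using a' by (simp add: mult.assoc[symmetric] smul_mult)
  finally have "qdvd (int p) (smul ?t (qcnj \<alpha> * \<beta>))"
    unfolding qdvd_def smul_add(1)[symmetric] by blast
  hence "qdvd (int p) (qcnj \<alpha> * \<beta>)"
    using q pi by (auto simp: qdvd_iff smul_def prime_dvd_mult_iff)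
  then obtain u where u: "qcnj \<alpha> * \<beta> = smul (int p) u" unfolding qdvd_def by blast
  hence au: "\<alpha> * u = \<beta>" using left_factor_cnj[OF na p0] by blast
  hence "int p * qnorm u = int p * 1" using na nb qnorm_mult[of \<alpha> u] by simp
  hence nu: "qnorm u = 1" using p0 by simp
  have "odd (qre \<beta>)" using b by (simp add: generators_def)
  hence "odd (qre u)" using au a by (auto simp: generators_def times_quat_def)
  hence u0: "qre u \<noteq> 0" by auto
  hence "1 \<le> (qre u)\<^sup>2" by (simp add: int_one_le_iff_zero_less)
  hence "(qi u)\<^sup>2 + (qj u)\<^sup>2 + (qk u)\<^sup>2 \<le> 0" "(qre u)\<^sup>2 + ((qi u)\<^sup>2 + (qj u)\<^sup>2 + (qk u)\<^sup>2) = 1" using nu by (auto simp: qnorm_def)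
  moreover have "0 \<le> (qi u)\<^sup>2" "0 \<le> (qj u)\<^sup>2" "0 \<le> (qk u)\<^sup>2" by simp_all
  ultimately have z: "(qi u)\<^sup>2 = 0" "(qj u)\<^sup>2 = 0" "(qk u)\<^sup>2 = 0" "(qre u)\<^sup>2 = 1" by linarith+
  hence u': "qi u = 0" "qj u = 0" "qk u = 0" "qre u = 1 \<or> qre u = - 1" by (auto simp: power2_eq_1_iff)
  have "qre \<beta> = qre \<alpha> * qre u" using au u' by (auto simp: times_quat_def)
  hence "qre u = 1" using a b u'(4) by (auto simp: generators_def)
  hence "u = 1" using u' by (cases u) (simp add: one_quat_def)
  thus ?thesis using au by simp
qed

definition words :: "nat \<Rightarrow> nat \<Rightarrow> quat list set" where
  "words p n = {ws. set ws \<subseteq> generators p \<and> length ws = n}"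

definition word_count :: "nat \<Rightarrow> nat \<Rightarrow> quat \<Rightarrow> nat" where
  "word_count p n x = card {ws \<in> words p n. prod_list ws = x}"

lemma words_Suc: "words p (Suc n) = (\<lambda>(a, ws). a # ws) ` (generators p \<times> words p n)"
  by (auto simp: words_def length_Suc_conv image_iff)

context
  fixes p :: nat
  assumes p: "prime p" "odd p" and card_S: "card (generators p) = p + 1"
begin

lemma finite_generators: "finite (generators p)"
  using card_S card.infinite by fastforce

lemma finite_words: "finite (words p n)"
  unfolding words_def using finite_lists_length_eq[OF finite_generators] by simp

lemma word_count_Suc:
  "word_count p (Suc n) x = (\<Sum>\<alpha>\<in>generators p. card {ws \<in> words p n. \<alpha> * prod_list ws = x})"
proof -
  have "{ws \<in> words p (Suc n). prod_list ws = x} = (\<Union>\<alpha>\<in>generators p. (#) \<alpha> ` {ws \<in> words p n. \<alpha> * prod_list ws = x})"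
    unfolding words_Suc by auto
  hence "word_count p (Suc n) x = card (\<Union>\<alpha>\<in>generators p. (#) \<alpha> ` {ws \<in> words p n. \<alpha> * prod_list ws = x})"
    by (simp add: word_count_def)
  also have "\<dots> = (\<Sum>\<alpha>\<in>generators p. card ((#) \<alpha> ` {ws \<in> words p n. \<alpha> * prod_list ws = x}))"
    by (rule card_UN_disjoint) (auto simp: finite_generators finite_words)
  also have "\<dots> = (\<Sum>\<alpha>\<in>generators p. card {ws \<in> words p n. \<alpha> * prod_list ws = x})"
    by (intro sum.cong refl card_image) auto
  finally show ?thesis .
qed

lemma prefix_count:
  assumes a: "\<alpha> \<in> generators p"
  shows "qcnj \<alpha> * x = smul (int p) y \<Longrightarrow> card {ws \<in> words p n. \<alpha> * prod_list ws = x} = word_count p n y"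
    and "\<not> qdvd (int p) (qcnj \<alpha> * x) \<Longrightarrow> card {ws \<in> words p n. \<alpha> * prod_list ws = x} = 0"
proof -
  have n: "qnorm \<alpha> = int p" "int p \<noteq> 0" using a p by (auto simp: generators_def)
  show "card {ws \<in> words p n. \<alpha> * prod_list ws = x} = word_count p n y" if "qcnj \<alpha> * x = smul (int p) y"
    unfolding left_factor_cnj[OF n] that word_count_def by (simp only: smul_cancel[OF n(2)] eq_commute[of y])
  show "card {ws \<in> words p n. \<alpha> * prod_list ws = x} = 0" if "\<not> qdvd (int p) (qcnj \<alpha> * x)"
    unfolding left_factor_cnj[OF n] using that by (auto simp: qdvd_def)
qed

text \<open>Induction on the length of the word, splitting off the first generator. If \<open>p\<close> does not divide \<open>x\<close>, the
first generator is determined. If \<open>x\<close> is \<open>p\<close> times \<open>x'\<close>, each of the \<open>p + 1\<close> generators \<open>\<alpha>\<close> is possible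
and leaves the cofactor \<open>qcnj \<alpha> * x'\<close>; the power of \<open>p\<close> in the cofactor is smaller by one than that in
\<open>x\<close> for all \<open>\<alpha>\<close> except at most one, again by the uniqueness of left divisors.\<close>

theorem word_count_le:
  "\<not> qdvd (int p ^ Suc k) x \<Longrightarrow> word_count p n x \<le> 2 ^ n * p ^ k"
proof (induction n arbitrary: k x)
  case 0
  have "words p 0 = {[]}" by (auto simp: words_def)
  hence "word_count p 0 x \<le> card {[] :: quat list}" unfolding word_count_def by (intro card_mono) auto
  also have "\<dots> \<le> 2 ^ 0 * p ^ k" using p by (simp add: prime_gt_0_nat Suc_leI)
  finally show ?case .
next
  case (Suc n)
  have p0: "int p \<noteq> 0" and ppos: "0 < p" using p by (auto simp: prime_gt_0_nat)
  show ?case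
  proof (cases "qdvd (int p) x")
    case False
    let ?c = "\<lambda>\<alpha>. card {ws \<in> words p n. \<alpha> * prod_list ws = x}"
    let ?T = "{\<alpha> \<in> generators p. qdvd (int p) (qcnj \<alpha> * x)}"
    have "card ?T \<le> 1"
      using left_divisor_unique[OF p _ _ False] finite_generators by (auto simp: card_le_Suc0_iff_eq)
    have bd: "?c \<alpha> \<le> 2 ^ n * p ^ k" if a: "\<alpha> \<in> ?T" for \<alpha>
    proof -
      obtain y where y: "qcnj \<alpha> * x = smul (int p) y" using a by (auto simp: qdvd_def)
      have "\<alpha> * y = x" using left_factor_cnj[of \<alpha> "int p"] a y p0 by (auto simp: generators_def)
      hence "\<not> qdvd (int p ^ Suc k) y" using qdvd_mult_right Suc.prems by metis
      thus ?thesis using prefix_count(1)[of \<alpha> x y n] a y Suc.IH[of k y] by auto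
    qed
    have "word_count p (Suc n) x = (\<Sum>\<alpha>\<in>?T. ?c \<alpha>)"
      unfolding word_count_Suc by (rule sum.mono_neutral_right) (auto simp: finite_generators prefix_count(2))
    also have "\<dots> \<le> of_nat (card ?T) * (2 ^ n * p ^ k)"
      by (rule sum_bounded_above) (rule bd)
    also have "\<dots> \<le> 1 * (2 ^ n * p ^ k)" using \<open>card ?T \<le> 1\<close> by (intro mult_right_mono) auto
    also have "\<dots> \<le> 2 ^ Suc n * p ^ k" by simp
    finally show ?thesis .
  next
    case True
    then obtain x' where x': "x = smul (int p) x'" by (auto simp: qdvd_def)
    have "k \<noteq> 0" using True Suc.prems by (intro notI) simp
    then obtain l where l: "k = Suc l" by (cases k) auto
    have nx': "\<not> qdvd (int p ^ Suc l) x'"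
      using Suc.prems qdvd_smul_cancel[OF p0, of "int p ^ Suc l" x'] by (simp add: x' l)
    have lift: "qdvd (m) (smul (int p) x')" if "\<alpha> \<in> generators p" "qdvd m (qcnj \<alpha> * x')" for m \<alpha>
      using qdvd_mult_right[OF that(2), of \<alpha>] that(1) by (simp add: qcnj_mult_self generators_def)
    let ?w = "\<lambda>\<alpha>. word_count p n (qcnj \<alpha> * x')"
    let ?T = "{\<alpha> \<in> generators p. qdvd (int p ^ Suc l) (qcnj \<alpha> * x')}"
    have total: "word_count p (Suc n) x = (\<Sum>\<alpha>\<in>generators p. ?w \<alpha>)"
      unfolding word_count_Suc by (rule sum.cong[OF refl], rule prefix_count(1)) (simp_all add: x' smul_mult)
    have big: "?w \<alpha> \<le> 2 ^ n * p ^ Suc l" if a: "\<alpha> \<in> generators p" for \<alpha>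
    proof (rule Suc.IH, rule notI)
      assume "qdvd (int p ^ Suc (Suc l)) (qcnj \<alpha> * x')"
      from lift[OF a this] have "qdvd (int p * int p ^ Suc l) (smul (int p) x')" by simp
      thus False using nx' qdvd_smul_cancel[OF p0] by blast
    qed
    have small: "?w \<alpha> \<le> 2 ^ n * p ^ l" if "\<alpha> \<in> generators p - ?T" for \<alpha>
      using that by (intro Suc.IH) auto
    \<comment> \<open>The exceptional generators: those whose conjugate does not lower the power of \<open>p\<close>.\<close>
    have T1: "card ?T \<le> 1"
    proof -
      have "\<alpha> = \<beta>" if a: "\<alpha> \<in> ?T" and b: "\<beta> \<in> ?T" for \<alpha> \<beta>
      proof -
        have "qdvd (int p * int p ^ l) (smul (int p) x')" using lift[of \<alpha> "int p ^ Suc l"] a by simp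
        hence "qdvd (int p ^ l) x'" using qdvd_smul_cancel[OF p0] by blast
        then obtain z where z: "x' = smul (int p ^ l) z" by (auto simp: qdvd_def)
        have pl: "int p ^ l \<noteq> 0" using p0 by simp
        have nz: "\<not> qdvd (int p) z"
          using nx' qdvd_smul_cancel[OF pl, of "int p" z] by (simp add: z mult.commute)
        have "qdvd (int p) (qcnj \<gamma> * z)" if "\<gamma> \<in> ?T" for \<gamma>
          using that qdvd_smul_cancel[OF pl, of "int p" "qcnj \<gamma> * z"] by (simp add: z smul_mult mult.commute)
        thus ?thesis using left_divisor_unique[OF p _ _ nz] a b by auto
      qed
      thus ?thesis using finite_generators by (auto simp: card_le_Suc0_iff_eq)
    qed
    have "(\<Sum>\<alpha>\<in>generators p. ?w \<alpha>) = (\<Sum>\<alpha>\<in>generators p - ?T. ?w \<alpha>) + (\<Sum>\<alpha>\<in>?T. ?w \<alpha>)"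
      by (rule sum.subset_diff) (auto simp: finite_generators)
    also have "\<dots> \<le> of_nat (card (generators p - ?T)) * (2 ^ n * p ^ l) + of_nat (card ?T) * (2 ^ n * p ^ Suc l)"
      by (intro add_mono sum_bounded_above small big) auto
    also have "\<dots> \<le> 2 ^ Suc n * p ^ k"
    proof -
      have "card (generators p - ?T) = p + 1 - card ?T"
        using card_S finite_generators by (subst card_Diff_subset) auto
      moreover have "card ?T = 0 \<or> card ?T = 1" using T1 by linarith
      moreover have "(p + 1) * (2 ^ n * p ^ l) \<le> (2 * p) * (2 ^ n * p ^ l)" using ppos by (intro mult_right_mono) auto
      ultimately show ?thesis by (auto simp: l algebra_simps)
    qed
    finally show ?thesis unfolding total .
  qed
qed

lemma qnorm_word: "ws \<in> words p n \<Longrightarrow> qnorm (prod_list ws) = int p ^ n"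
proof (induction n arbitrary: ws)
  case (Suc n)
  thus ?case by (auto simp: words_Suc qnorm_mult generators_def)
qed (simp add: words_def)

corollary word_count_le_sqrt:
  assumes "qnorm x = int p ^ n"
  shows "word_count p n x \<le> 2 ^ n * p ^ (n div 2)"
proof (rule word_count_le, rule notI)
  assume "qdvd (int p ^ Suc (n div 2)) x"
  then obtain y where "x = smul (int p ^ Suc (n div 2)) y" by (auto simp: qdvd_def)
  hence "int p ^ n = (int p ^ Suc (n div 2))\<^sup>2 * qnorm y" using assms qnorm_smul by metis
  also have "(int p ^ Suc (n div 2))\<^sup>2 = int p ^ (2 * Suc (n div 2))"
    by (simp only: power_mult[symmetric] mult.commute)
  finally have "int p ^ n = int p ^ (2 * Suc (n div 2)) * qnorm y" .
  hence "int p ^ (2 * Suc (n div 2)) dvd int p ^ n" by (rule dvdI)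
  hence "p ^ (2 * Suc (n div 2)) dvd p ^ n" by (simp only: of_nat_power[symmetric] int_dvd_int_iff)
  moreover have "1 < p" using p prime_gt_1_nat by auto
  ultimately have "2 * Suc (n div 2) \<le> n" by (rule power_dvd_imp_le)
  thus False by presburger
qed

end

section \<open>Quaternions acting on four-dimensional space\<close>

lemma vector_4 [simp]:
  "(vector [x, y, z, w] :: 'a::zero ^ 4) $ 1 = x"
  "(vector [x, y, z, w] :: 'a::zero ^ 4) $ 2 = y"
  "(vector [x, y, z, w] :: 'a::zero ^ 4) $ 3 = z"
  "(vector [x, y, z, w] :: 'a::zero ^ 4) $ 4 = w"
  unfolding vector_def by simp_all

lemma left_mult_apply:
  "(left_mult w *v v) $ 1 = w $ 1 * v $ 1 - w $ 2 * v $ 2 - w $ 3 * v $ 3 - w $ 4 * v $ 4"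
  "(left_mult w *v v) $ 2 = w $ 2 * v $ 1 + w $ 1 * v $ 2 - w $ 4 * v $ 3 + w $ 3 * v $ 4"
  "(left_mult w *v v) $ 3 = w $ 3 * v $ 1 + w $ 4 * v $ 2 + w $ 1 * v $ 3 - w $ 2 * v $ 4"
  "(left_mult w *v v) $ 4 = w $ 4 * v $ 1 - w $ 3 * v $ 2 + w $ 2 * v $ 3 + w $ 1 * v $ 4"
  by (simp_all add: matrix_vector_mult_def left_mult_def sum_4)

lemma left_mult_scaleR: "left_mult (c *\<^sub>R w) *v v = c *\<^sub>R (left_mult w *v v)"
  by (simp add: vec_eq_iff forall_4 left_mult_apply algebra_simps)

lemma norm_sq_4: "(norm (x :: real ^ 4))\<^sup>2 = (x $ 1)\<^sup>2 + (x $ 2)\<^sup>2 + (x $ 3)\<^sup>2 + (x $ 4)\<^sup>2"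
  unfolding power2_norm_eq_inner by (simp add: inner_vec_def sum_4 power2_eq_square)

lemma norm_left_mult: "norm (left_mult w *v v) = norm w * norm v"
proof -
  have "(norm (left_mult w *v v))\<^sup>2 = (norm w * norm v)\<^sup>2"
    unfolding power_mult_distrib norm_sq_4 left_mult_apply by (simp add: power2_eq_square algebra_simps)
  thus ?thesis by (simp add: power2_eq_iff_nonneg)
qed

definition qvec :: "quat \<Rightarrow> real ^ 4" where
  "qvec x = vector [of_int (qre x), of_int (qi x), of_int (qj x), of_int (qk x)]"

definition qact :: "quat \<Rightarrow> real ^ 4 \<Rightarrow> real ^ 4" where
  "qact x v = left_mult (qvec x) *v v"

lemma qact_apply:
  "(qact x v) $ 1 = qre x * v $ 1 - qi x * v $ 2 - qj x * v $ 3 - qk x * v $ 4"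
  "(qact x v) $ 2 = qi x * v $ 1 + qre x * v $ 2 - qk x * v $ 3 + qj x * v $ 4"
  "(qact x v) $ 3 = qj x * v $ 1 + qk x * v $ 2 + qre x * v $ 3 - qi x * v $ 4"
  "(qact x v) $ 4 = qk x * v $ 1 - qj x * v $ 2 + qi x * v $ 3 + qre x * v $ 4"
  by (simp_all add: qact_def left_mult_apply qvec_def)

lemma qact_mult: "qact (x * y) v = qact x (qact y v)"
  by (simp add: vec_eq_iff forall_4 qact_apply times_quat_def algebra_simps)

lemma qact_one [simp]: "qact 1 v = v"
  by (simp add: vec_eq_iff forall_4 qact_apply one_quat_def)

lemma qact_diff: "qact (x - y) v = qact x v - qact y v"
  by (simp add: vec_eq_iff forall_4 qact_apply minus_quat_def algebra_simps)

lemma qact_scaleR: "qact x (c *\<^sub>R v) = c *\<^sub>R qact x v"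
  by (simp add: vec_eq_iff forall_4 qact_apply algebra_simps)

lemma norm_qvec: "norm (qvec x) = sqrt (real_of_int (qnorm x))"
proof -
  have "(norm (qvec x))\<^sup>2 = real_of_int (qnorm x)" by (simp add: norm_sq_4 qvec_def qnorm_def)
  thus ?thesis by (metis norm_ge_zero real_sqrt_abs abs_of_nonneg)
qed

lemma norm_qact: "norm (qact x v) = sqrt (real_of_int (qnorm x)) * norm v"
  by (simp add: qact_def norm_left_mult norm_qvec)

lemma inner_qact: "v \<bullet> qact x w = qact (qcnj x) v \<bullet> w"
  by (simp add: inner_vec_def sum_4 qact_apply qcnj_def algebra_simps)

lemma qnorm_ge_1: "x \<noteq> 0 \<Longrightarrow> 1 \<le> qnorm x"
proof -
  assume "x \<noteq> 0"
  hence "\<not> (qre x = 0 \<and> qi x = 0 \<and> qj x = 0 \<and> qk x = 0)" by (cases x) (auto simp: zero_quat_def)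
  hence "qnorm x \<noteq> 0" by (auto simp: qnorm_def add_nonneg_eq_0_iff)
  thus "1 \<le> qnorm x" using qnorm_nonneg[of x] by linarith
qed

lemma Omega_eq: "Omega p = (\<lambda>x. (1 / sqrt (real p)) *\<^sub>R qvec x) ` generators p"
proof (intro equalityI subsetI)
  fix w assume "w \<in> Omega p"
  then obtain a b c d :: int where *: "w = (1 / sqrt (real p)) *\<^sub>R vector [of_int a, of_int b, of_int c, of_int d]"
    "a\<^sup>2 + b\<^sup>2 + c\<^sup>2 + d\<^sup>2 = int p" "a > 0" "odd a" "even b" "even c" "even d" unfolding Omega_def by blast
  thus "w \<in> (\<lambda>x. (1 / sqrt (real p)) *\<^sub>R qvec x) ` generators p"
    by (intro image_eqI[where x="Quat a b c d"]) (simp_all add: qvec_def generators_def qnorm_def)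
next
  fix w assume "w \<in> (\<lambda>x. (1 / sqrt (real p)) *\<^sub>R qvec x) ` generators p"
  then obtain x where x: "x \<in> generators p" "w = (1 / sqrt (real p)) *\<^sub>R qvec x" by blast
  thus "w \<in> Omega p" unfolding Omega_def mem_Collect_eq
    by (intro exI[of _ "qre x"] exI[of _ "qi x"] exI[of _ "qj x"] exI[of _ "qk x"])
       (simp add: generators_def qnorm_def qvec_def)
qed

lemma inj_qvec: "inj qvec"
proof (rule injI)
  fix x y assume "qvec x = qvec y"
  hence "\<And>i. qvec x $ i = qvec y $ i" by simp
  from this[of 1] this[of 2] this[of 3] this[of 4] show "x = y"
    by (cases x; cases y) (simp add: qvec_def)
qed

text \<open>The conjugate reverses products, so the first generator of a word acts first, as the recursion for \<open>F\<close>
requires.\<close>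

lemma iterate_word_average:
  fixes F :: "real ^ 4 \<Rightarrow> real"
  assumes "c0 \<ge> 0" and step: "\<And>\<xi>. F \<xi> \<le> c0 * (\<Sum>\<alpha>\<in>generators p. F (c *\<^sub>R qact (qcnj \<alpha>) \<xi>))"
  shows "F \<xi> \<le> c0 ^ n * (\<Sum>ws\<in>words p n. F (c ^ n *\<^sub>R qact (qcnj (prod_list ws)) \<xi>))"
proof (induction n arbitrary: \<xi>)
  case 0
  have "words p 0 = {[]}" by (auto simp: words_def)
  thus ?case by simp
next
  case (Suc n)
  have "F \<xi> \<le> c0 * (\<Sum>\<alpha>\<in>generators p. F (c *\<^sub>R qact (qcnj \<alpha>) \<xi>))" by (rule step)
  also have "\<dots> \<le> c0 * (\<Sum>\<alpha>\<in>generators p. c0 ^ n * (\<Sum>ws\<in>words p n. F (c ^ n *\<^sub>R qact (qcnj (prod_list ws)) (c *\<^sub>R qact (qcnj \<alpha>) \<xi>))))"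
    by (intro mult_left_mono sum_mono Suc.IH assms)
  also have "\<dots> = c0 ^ Suc n * (\<Sum>\<alpha>\<in>generators p. \<Sum>ws\<in>words p n. F (c ^ n *\<^sub>R qact (qcnj (prod_list ws)) (c *\<^sub>R qact (qcnj \<alpha>) \<xi>)))"
    by (simp add: sum_distrib_left mult.assoc)
  also have "(\<Sum>\<alpha>\<in>generators p. \<Sum>ws\<in>words p n. F (c ^ n *\<^sub>R qact (qcnj (prod_list ws)) (c *\<^sub>R qact (qcnj \<alpha>) \<xi>)))
     = (\<Sum>(\<alpha>, ws)\<in>generators p \<times> words p n. F (c ^ Suc n *\<^sub>R qact (qcnj (prod_list (\<alpha> # ws))) \<xi>))"
    unfolding sum.cartesian_product by (simp add: qact_scaleR qcnj_mult qact_mult mult.commute)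
  also have "\<dots> = (\<Sum>ws\<in>words p (Suc n). F (c ^ Suc n *\<^sub>R qact (qcnj (prod_list ws)) \<xi>))"
    unfolding words_Suc by (subst sum.reindex) (auto simp: inj_on_def case_prod_beta' intro!: sum.cong)
  finally show ?case .
qed

definition directions :: "nat \<Rightarrow> nat \<Rightarrow> real ^ 4 \<Rightarrow> (real ^ 4) set" where
  "directions p n u = (\<lambda>x. (1 / sqrt (real p) ^ n) *\<^sub>R qact (qcnj x) u) ` prod_list ` words p n"

context
  fixes p :: nat
  assumes p: "prime p" "odd p" and card_S: "card (generators p) = p + 1"
begin

lemma qnorm_product: "x \<in> prod_list ` words p n \<Longrightarrow> real_of_int (qnorm x) = real p ^ n"
  using qnorm_word[OF p card_S] by auto

lemma sqrt_power: "sqrt (real p ^ n) = sqrt (real p) ^ n"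
  by (rule real_sqrt_power)

lemma p_pos: "0 < real p" using p prime_gt_0_nat by simp

lemma sqrt_p_pos: "0 < sqrt (real p) ^ n" using p_pos by simp

lemma directions_finite: "finite (directions p n u)"
  unfolding directions_def using finite_words[OF p card_S] by simp

lemma directions_norm:
  assumes "norm u = 1" "v \<in> directions p n u"
  shows "norm v = 1"
proof -
  obtain x where x: "x \<in> prod_list ` words p n" "v = (1 / sqrt (real p) ^ n) *\<^sub>R qact (qcnj x) u"
    using assms(2) by (auto simp: directions_def)
  show ?thesis unfolding x(2) using assms(1) p_pos
    by (simp add: norm_qact qnorm_product[OF x(1)] sqrt_power)
qed

lemma directions_dist:
  assumes "norm u = 1" "x \<noteq> y"
  shows "1 / sqrt (real p) ^ n \<le> dist ((1 / sqrt (real p) ^ n) *\<^sub>R qact (qcnj x) u) ((1 / sqrt (real p) ^ n) *\<^sub>R qact (qcnj y) u)"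
proof -
  have "dist ((1 / sqrt (real p) ^ n) *\<^sub>R qact (qcnj x) u) ((1 / sqrt (real p) ^ n) *\<^sub>R qact (qcnj y) u)
      = (1 / sqrt (real p) ^ n) * norm (qact (qcnj x - qcnj y) u)"
    unfolding dist_norm scaleR_diff_right[symmetric] qact_diff[symmetric] using sqrt_p_pos[of n] by simp
  also have "norm (qact (qcnj x - qcnj y) u) = sqrt (real_of_int (qnorm (x - y)))"
    using assms(1) by (simp add: norm_qact qcnj_diff[symmetric])
  also have "(1 / sqrt (real p) ^ n) * \<dots> \<ge> (1 / sqrt (real p) ^ n) * 1"
    using qnorm_ge_1[of "x - y"] assms(2) sqrt_p_pos[of n] by (intro mult_left_mono) auto
  finally show ?thesis by simp
qed

lemma directions_inj:
  assumes "norm u = 1"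
  shows "inj_on (\<lambda>x. (1 / sqrt (real p) ^ n) *\<^sub>R qact (qcnj x) u) X"
proof (rule inj_onI, rule ccontr)
  fix x y assume "(1 / sqrt (real p) ^ n) *\<^sub>R qact (qcnj x) u = (1 / sqrt (real p) ^ n) *\<^sub>R qact (qcnj y) u" "x \<noteq> y"
  with directions_dist[OF assms, of x y n] show False using sqrt_p_pos[of n] by simp
qed

lemma directions_separated:
  assumes "norm u = 1" "v \<in> directions p n u" "w \<in> directions p n u" "v \<noteq> w"
  shows "1 / sqrt (real p) ^ n \<le> dist v w"
  using assms by (auto simp: directions_def intro!: directions_dist)

text \<open>Words with the same product are collected, at the cost of the bound on the number of factorizations.
The normalization \<open>sqrt p ^ n\<close> of the products is moved from the scalar to the directions.\<close>

lemma word_average_le_directions: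
  fixes F :: "real ^ 4 \<Rightarrow> real"
  assumes F: "\<And>\<xi>. 0 \<le> F \<xi>" and u: "norm u = 1" and c: "c = r / sqrt (real p)"
  shows "(\<Sum>ws\<in>words p n. F (c ^ n *\<^sub>R qact (qcnj (prod_list ws)) (t *\<^sub>R u)))
     \<le> 2 ^ n * sqrt (real p) ^ n * (\<Sum>v\<in>directions p n u. F ((r ^ n * t) *\<^sub>R v))"
proof -
  let ?g = "\<lambda>x. F (c ^ n *\<^sub>R qact (qcnj x) (t *\<^sub>R u))"
  let ?X = "prod_list ` words p n"
  have "(\<Sum>ws\<in>words p n. ?g (prod_list ws)) = (\<Sum>x\<in>?X. \<Sum>ws\<in>{ws \<in> words p n. prod_list ws = x}. ?g (prod_list ws))"
    by (rule sum.image_gen) (rule finite_words[OF p card_S])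
  also have "\<dots> = (\<Sum>x\<in>?X. real (word_count p n x) * ?g x)"
    by (intro sum.cong refl) (simp add: word_count_def)
  also have "\<dots> \<le> (\<Sum>x\<in>?X. (2 ^ n * sqrt (real p) ^ n) * ?g x)"
  proof (intro sum_mono mult_right_mono F)
    fix x assume x: "x \<in> ?X"
    hence "qnorm x = int p ^ n" using qnorm_word[OF p card_S] by auto
    hence "word_count p n x \<le> 2 ^ n * p ^ (n div 2)" by (rule word_count_le_sqrt[OF p card_S])
    hence "real (word_count p n x) \<le> real (2 ^ n * p ^ (n div 2))" by (simp only: of_nat_le_iff)
    also have "\<dots> = 2 ^ n * sqrt (real p) ^ (2 * (n div 2))" by (simp add: power_mult)
    also have "\<dots> \<le> 2 ^ n * sqrt (real p) ^ n"
      using p prime_ge_1_nat[OF p(1)] by (intro mult_left_mono power_increasing) auto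
    finally show "real (word_count p n x) \<le> 2 ^ n * sqrt (real p) ^ n" .
  qed
  also have "\<dots> = 2 ^ n * sqrt (real p) ^ n * (\<Sum>x\<in>?X. ?g x)" by (rule sum_distrib_left[symmetric])
  also have "(\<Sum>x\<in>?X. ?g x) = (\<Sum>x\<in>?X. F ((r ^ n * t) *\<^sub>R ((1 / sqrt (real p) ^ n) *\<^sub>R qact (qcnj x) u)))"
    by (simp add: c qact_scaleR power_divide)
  also have "\<dots> = (\<Sum>v\<in>directions p n u. F ((r ^ n * t) *\<^sub>R v))"
    unfolding directions_def by (subst sum.reindex[OF directions_inj[OF u]]) (simp add: o_def)
  finally show ?thesis .
qed

end

section \<open>Decay of the Fourier transform along lines\<close>

lemma nn_integral_rescale_interval:
  fixes h :: "real \<Rightarrow> ennreal"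
  assumes [measurable]: "h \<in> borel_measurable borel" and q: "q > 0"
  shows "(\<integral>\<^sup>+t\<in>{a / q..b / q}. h (q * t) \<partial>lborel) = ennreal (1 / q) * (\<integral>\<^sup>+s\<in>{a..b}. h s \<partial>lborel)"
proof -
  have "(\<integral>\<^sup>+t\<in>{a / q..b / q}. h (q * t) \<partial>lborel)
     = ennreal \<bar>1 / q\<bar> * (\<integral>\<^sup>+s. h (q * (0 + 1 / q * s)) * indicator {a / q..b / q} (0 + 1 / q * s) \<partial>lborel)"
    using q by (intro nn_integral_real_affine) auto
  also have "(\<integral>\<^sup>+s. h (q * (0 + 1 / q * s)) * indicator {a / q..b / q} (0 + 1 / q * s) \<partial>lborel) = (\<integral>\<^sup>+s\<in>{a..b}. h s \<partial>lborel)"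
    using q by (intro nn_integral_cong) (auto simp: indicator_def divide_le_cancel)
  finally show ?thesis using q by simp
qed

lemma nn_integral_half_line_le:
  fixes h :: "real \<Rightarrow> ennreal"
  assumes [measurable]: "h \<in> borel_measurable borel" and h1: "\<And>t. h t \<le> 1" and b: "1 < b"
    and \<theta>: "0 \<le> \<theta>" "\<theta> < 1" and A: "A < \<infinity>"
    and le: "\<And>n. (\<integral>\<^sup>+t\<in>{b ^ n..b ^ Suc n}. h t \<partial>lborel) \<le> A * ennreal (\<theta> ^ n)"
  shows "(\<integral>\<^sup>+t\<in>{0..}. h t \<partial>lborel) < \<infinity>"
proof -
  have "(\<integral>\<^sup>+t\<in>{0..}. h t \<partial>lborel) \<le> (\<integral>\<^sup>+t. indicator {0..1} t + (\<Sum>n. h t * indicator {b ^ n..b ^ Suc n} t) \<partial>lborel)"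
  proof (rule nn_integral_mono)
    fix t :: real
    consider "t < 0" | "0 \<le> t" "t \<le> 1" | "1 < t" by linarith
    thus "h t * indicator {0..} t \<le> indicator {0..1} t + (\<Sum>n. h t * indicator {b ^ n..b ^ Suc n} t)"
    proof cases
      case 2
      thus ?thesis using h1[of t] by (simp add: add_increasing2)
    next
      case 3
      then obtain n where n: "1 * (1 / b) ^ Suc n \<le> 1 / t" "1 / t < 1 * (1 / b) ^ n"
        using geometric_scale_exists[of "1 / b" "1 / t" 1] b by auto
      have "b ^ n \<le> t" "t \<le> b ^ Suc n" using n b 3 by (auto simp: power_divide field_simps)
      hence "h t * indicator {0..} t = (\<Sum>i\<in>{n}. h t * indicator {b ^ i..b ^ Suc i} t)" using 3 by simp
      also have "\<dots> \<le> (\<Sum>n. h t * indicator {b ^ n..b ^ Suc n} t)" by (rule sum_le_suminf) auto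
      finally show ?thesis by (rule add_increasing[rotated]) simp
    qed simp
  qed
  also have "\<dots> = (\<integral>\<^sup>+t. indicator {0..1::real} t \<partial>lborel) + (\<integral>\<^sup>+t. (\<Sum>n. h t * indicator {b ^ n..b ^ Suc n} t) \<partial>lborel)"
    by (rule nn_integral_add) measurable
  also have "(\<integral>\<^sup>+t. (\<Sum>n. h t * indicator {b ^ n..b ^ Suc n} t) \<partial>lborel) = (\<Sum>n. \<integral>\<^sup>+t\<in>{b ^ n..b ^ Suc n}. h t \<partial>lborel)"
    by (rule nn_integral_suminf) measurable
  also have "\<dots> \<le> (\<Sum>n. A * ennreal (\<theta> ^ n))" by (intro suminf_le summableI le)
  also have "\<dots> = A * (\<Sum>n. ennreal (\<theta> ^ n))" by simp
  also have "(\<Sum>n. ennreal (\<theta> ^ n)) = ennreal (\<Sum>n. \<theta> ^ n)"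
    using \<theta> by (intro suminf_ennreal2 summable_geometric) auto
  finally have "(\<integral>\<^sup>+t\<in>{0..}. h t \<partial>lborel) \<le> (\<integral>\<^sup>+t. indicator {0..1::real} t \<partial>lborel) + A * ennreal (\<Sum>n. \<theta> ^ n)"
    by (simp add: add_left_mono)
  also have "\<dots> < \<infinity>" using A by (simp add: ennreal_mult_less_top)
  finally show ?thesis .
qed

lemma ft_uminus: "ft M (- \<xi>) = cnj (ft M \<xi>)"
proof -
  have "cnj (ft M \<xi>) = (\<integral>x. cnj (cis (\<xi> \<bullet> x)) \<partial>M)" unfolding ft_def by simp
  thus ?thesis by (simp add: ft_def cis_cnj)
qed

text \<open>On \<open>[K ^ n, K ^ (n + 1)]\<close> the recursion \<open>step\<close> is applied \<open>n\<close> times. With \<open>K = sqrt p / r\<close> this brings the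
frequencies down to the range from \<open>\<rho> = sqrt p ^ n\<close> to \<open>K * \<rho>\<close>, the scale at which the directions
are \<open>1 / \<rho>\<close>-separated and \<open>sphere_sieve\<close> applies. The contributions of the intervals decay geometrically
with ratio \<open>\<theta>\<close>.\<close>

theorem ft_line_square_integrable:
  fixes \<nu> :: "(real ^ 4) measure" and p :: nat
  assumes \<nu>: "prob_space \<nu>" "sets \<nu> = sets borel" and L: "AE x in \<nu>. norm x \<le> L"
    and p: "prime p" "odd p" and card_S: "card (generators p) = p + 1"
    and r: "0 < r" "r < 1" and u: "norm u = 1"
    and step: "\<And>\<xi>. (norm (ft \<nu> \<xi>))\<^sup>2 \<le> (1 / (real p + 1)) * (\<Sum>\<alpha>\<in>generators p. (norm (ft \<nu> ((r / sqrt (real p)) *\<^sub>R qact (qcnj \<alpha>) \<xi>)))\<^sup>2)"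
    and \<alpha>: "0 < \<alpha>" "\<alpha> \<le> 4" and energy: "(\<integral>\<^sup>+x. \<integral>\<^sup>+y. riesz_kernel \<alpha> x y \<partial>\<nu> \<partial>\<nu>) < \<infinity>"
    and \<theta>: "2 * sqrt (real p) * sqrt (real p) powr (4 - \<alpha>) / (r * (real p + 1)) < 1"
  shows "(\<integral>\<^sup>+t. ennreal ((norm (ft \<nu> (t *\<^sub>R u)))\<^sup>2) \<partial>lborel) < \<infinity>"
proof -
  interpret prob_space \<nu> by fact
  let ?F = "\<lambda>\<xi>. (norm (ft \<nu> \<xi>))\<^sup>2"
  have fm: "finite_measure \<nu>" by unfold_locales
  have [measurable]: "ft \<nu> \<in> borel_measurable borel"
    by (rule borel_measurable_ft) (auto simp: \<nu> sigma_finite_measure_axioms)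
  define s where "s = sqrt (real p)"
  have s: "1 < s" using p prime_gt_1_nat by (simp add: s_def)
  define K where "K = s / r"
  have K: "1 < K" using s r by (simp add: K_def field_simps)
  define \<theta>' where "\<theta>' = 2 * s * s powr (4 - \<alpha>) / (r * (real p + 1))"
  define I where "I = (\<integral>\<^sup>+x. \<integral>\<^sup>+y. riesz_kernel \<alpha> x y \<partial>\<nu> \<partial>\<nu>)"
  obtain C where C: "C \<ge> 0" "\<And>\<rho> (V::(real^4) set). 1 \<le> \<rho> \<Longrightarrow> finite V \<Longrightarrow> (\<forall>v\<in>V. norm v = 1) \<Longrightarrow>
      (\<forall>v\<in>V. \<forall>w\<in>V. v \<noteq> w \<longrightarrow> 1 / \<rho> \<le> dist v w) \<Longrightarrow>
      (\<integral>\<^sup>+s\<in>{\<rho>..K * \<rho>}. (\<Sum>v\<in>V. ennreal (?F (s *\<^sub>R v))) \<partial>lborel) \<le> ennreal (C * \<rho> powr (4 - \<alpha>)) * I"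
    using sphere_sieve[OF fm \<nu>(2) L _ \<alpha>, of K] K unfolding I_def by auto
  have F1: "ennreal (?F \<xi>) \<le> 1" for \<xi>
  proof -
    have "norm (ft \<nu> \<xi>) \<le> 1"
      unfolding ft_def using integral_norm_bound[of \<nu> "\<lambda>x. cis (\<xi> \<bullet> x)"] by (simp add: prob_space)
    hence "?F \<xi> \<le> 1" by (simp add: power_le_one)
    thus ?thesis by simp
  qed
  have half: "(\<integral>\<^sup>+t\<in>{0..}. ennreal (?F (t *\<^sub>R u)) \<partial>lborel) < \<infinity>"
  proof (rule nn_integral_half_line_le[OF _ F1 K])
    show "0 \<le> \<theta>'" "\<theta>' < 1" using \<theta> r s by (auto simp: \<theta>'_def s_def)
    show "ennreal C * I < \<infinity>" using energy by (simp add: I_def ennreal_mult_less_top)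
    fix n
    let ?V = "directions p n u"
    let ?\<rho> = "s ^ n"
    have pt: "?F (t *\<^sub>R u) \<le> (2 * s / (real p + 1)) ^ n * (\<Sum>v\<in>?V. ?F ((r ^ n * t) *\<^sub>R v))" for t
    proof -
      have "?F (t *\<^sub>R u) \<le> (1 / (real p + 1)) ^ n * (\<Sum>ws\<in>words p n. ?F ((r / sqrt (real p)) ^ n *\<^sub>R qact (qcnj (prod_list ws)) (t *\<^sub>R u)))"
        by (rule iterate_word_average[OF _ step]) simp
      also have "\<dots> \<le> (1 / (real p + 1)) ^ n * (2 ^ n * s ^ n * (\<Sum>v\<in>?V. ?F ((r ^ n * t) *\<^sub>R v)))"
        unfolding s_def by (intro mult_left_mono word_average_le_directions[OF p card_S _ u refl]) auto
      also have "\<dots> = (2 * s / (real p + 1)) ^ n * (\<Sum>v\<in>?V. ?F ((r ^ n * t) *\<^sub>R v))"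
        by (simp add: power_mult_distrib power_divide)
      finally show ?thesis .
    qed
    let ?h = "\<lambda>t. \<Sum>v\<in>?V. ennreal (?F (t *\<^sub>R v))"
    let ?c = "(2 * s / (real p + 1)) ^ n"
    have c0: "0 \<le> ?c" using s by simp
    have "(\<integral>\<^sup>+t\<in>{K ^ n..K ^ Suc n}. ennreal (?F (t *\<^sub>R u)) \<partial>lborel)
       \<le> (\<integral>\<^sup>+t. ennreal ?c * (?h (r ^ n * t) * indicator {?\<rho> / r ^ n..K * ?\<rho> / r ^ n} t) \<partial>lborel)"
    proof (rule nn_integral_mono)
      fix t
      have iv: "{K ^ n..K ^ Suc n} = {?\<rho> / r ^ n..K * ?\<rho> / r ^ n}" by (simp add: K_def power_divide)
      have "ennreal (?F (t *\<^sub>R u)) \<le> ennreal (?c * (\<Sum>v\<in>?V. ?F ((r ^ n * t) *\<^sub>R v)))"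
        by (rule ennreal_leI[OF pt])
      also have "\<dots> = ennreal ?c * ?h (r ^ n * t)"
        using c0 by (simp add: ennreal_mult sum_nonneg sum_ennreal)
      finally show "ennreal (?F (t *\<^sub>R u)) * indicator {K ^ n..K ^ Suc n} t
          \<le> ennreal ?c * (?h (r ^ n * t) * indicator {?\<rho> / r ^ n..K * ?\<rho> / r ^ n} t)"
        unfolding iv mult.assoc[symmetric] by (rule mult_right_mono) simp
    qed
    also have "\<dots> = ennreal ?c * (\<integral>\<^sup>+t\<in>{?\<rho> / r ^ n..K * ?\<rho> / r ^ n}. ?h (r ^ n * t) \<partial>lborel)"
      by (rule nn_integral_cmult) measurable
    also have "(\<integral>\<^sup>+t\<in>{?\<rho> / r ^ n..K * ?\<rho> / r ^ n}. ?h (r ^ n * t) \<partial>lborel) = ennreal (1 / r ^ n) * (\<integral>\<^sup>+t\<in>{?\<rho>..K * ?\<rho>}. ?h t \<partial>lborel)"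
      by (rule nn_integral_rescale_interval) (measurable, use r in simp)
    also have "(\<integral>\<^sup>+t\<in>{?\<rho>..K * ?\<rho>}. ?h t \<partial>lborel) \<le> ennreal (C * ?\<rho> powr (4 - \<alpha>)) * I"
    proof (rule C(2))
      show "1 \<le> ?\<rho>" using s by simp
      show "finite ?V" by (rule directions_finite[OF p card_S])
      show "\<forall>v\<in>?V. norm v = 1" using directions_norm[OF p card_S u] by blast
      show "\<forall>v\<in>?V. \<forall>w\<in>?V. v \<noteq> w \<longrightarrow> 1 / ?\<rho> \<le> dist v w"
        unfolding s_def using directions_separated[OF p card_S u] by blast
    qed
    finally have "(\<integral>\<^sup>+t\<in>{K ^ n..K ^ Suc n}. ennreal (?F (t *\<^sub>R u)) \<partial>lborel)
      \<le> ennreal ?c * (ennreal (1 / r ^ n) * (ennreal (C * ?\<rho> powr (4 - \<alpha>)) * I))"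
      by (simp add: mult_left_mono)
    also have "\<dots> = ennreal (?c * (1 / r ^ n) * (C * ?\<rho> powr (4 - \<alpha>))) * I"
      using c0 r C(1) by (simp add: ennreal_mult[symmetric] mult.assoc[symmetric])
    also have "?c * (1 / r ^ n) * (C * ?\<rho> powr (4 - \<alpha>)) = C * \<theta>' ^ n"
    proof -
      have "?\<rho> powr (4 - \<alpha>) = (s powr (4 - \<alpha>)) ^ n"
        using s by (simp only: powr_realpow[symmetric] powr_powr powr_gt_zero mult.commute less_trans[OF zero_less_one])
      thus ?thesis by (simp add: \<theta>'_def power_divide power_mult_distrib mult_ac)
    qed
    also have "ennreal (C * \<theta>' ^ n) * I = ennreal C * I * ennreal (\<theta>' ^ n)"
      using C(1) \<open>0 \<le> \<theta>'\<close> by (simp add: ennreal_mult mult_ac)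
    finally show "(\<integral>\<^sup>+t\<in>{K ^ n..K ^ Suc n}. ennreal (?F (t *\<^sub>R u)) \<partial>lborel) \<le> ennreal C * I * ennreal (\<theta>' ^ n)" .
  qed measurable
  have "(\<integral>\<^sup>+t. ennreal (?F (t *\<^sub>R u)) \<partial>lborel)
     \<le> (\<integral>\<^sup>+t. ennreal (?F (t *\<^sub>R u)) * indicator {0..} t + ennreal (?F ((0 - t) *\<^sub>R u)) * indicator {0..} (0 - t) \<partial>lborel)"
    by (intro nn_integral_mono) (auto simp: indicator_def ft_uminus)
  also have "\<dots> = (\<integral>\<^sup>+t\<in>{0..}. ennreal (?F (t *\<^sub>R u)) \<partial>lborel) + (\<integral>\<^sup>+t. ennreal (?F ((0 - t) *\<^sub>R u)) * indicator {0..} (0 - t) \<partial>lborel)"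
    by (rule nn_integral_add) measurable
  also have "(\<integral>\<^sup>+t. ennreal (?F ((0 - t) *\<^sub>R u)) * indicator {0..} (0 - t) \<partial>lborel) = (\<integral>\<^sup>+t\<in>{0..}. ennreal (?F (t *\<^sub>R u)) \<partial>lborel)"
    by (rule nn_integral_lborel_reflect[of "\<lambda>t. ennreal (?F (t *\<^sub>R u)) * indicator {0..} t"]) measurable
  also have "(\<integral>\<^sup>+t\<in>{0..}. ennreal (?F (t *\<^sub>R u)) \<partial>lborel) + (\<integral>\<^sup>+t\<in>{0..}. ennreal (?F (t *\<^sub>R u)) \<partial>lborel) < \<infinity>"
    using half by simp
  finally show ?thesis .
qed

section \<open>Projections to lines\<close>

lemma unit_vector_of_line:
  assumes V: "V \<in> grassmannian 1"
  defines "u \<equiv> SOME u. u \<in> V \<and> norm u = 1"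
  shows "u \<in> V" "norm u = 1" "V = range (\<lambda>t. t *\<^sub>R u)"
proof -
  have sV: "subspace V" and dV: "dim V = 1" using V by (auto simp: grassmannian_def)
  have "\<exists>x\<in>V. x \<noteq> 0"
  proof (rule ccontr)
    assume "\<not> ?thesis"
    hence "dim V = 0" by (subst dim_eq_0) auto
    thus False using dV by simp
  qed
  then obtain x where x: "x \<in> V" "x \<noteq> 0" by blast
  have "(1 / norm x) *\<^sub>R x \<in> V \<and> norm ((1 / norm x) *\<^sub>R x) = 1"
    using x sV by (auto intro: subspace_scale)
  hence u: "u \<in> V \<and> norm u = 1" unfolding u_def by (rule someI)
  thus "u \<in> V" "norm u = 1" by auto
  have "independent {u}" using u by (intro independent_insertI) (auto simp: independent_empty)
  hence "V \<subseteq> span {u}" using u dV by (intro card_ge_dim_independent) auto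
  moreover have "span {u} \<subseteq> V" using u sV by (intro span_minimal) auto
  ultimately show "V = range (\<lambda>t. t *\<^sub>R u)" by (auto simp: span_singleton)
qed

text \<open>The Fourier transform of the law of \<open>u \<bullet> x\<close> is the restriction of the transform of \<open>\<nu>\<close> to the line
through \<open>u\<close>. What remains is to transport the density from the real line to \<open>V\<close>.\<close>

lemma projection_has_L2_density:
  fixes \<nu> :: "'a::euclidean_space measure"
  assumes \<nu>: "prob_space \<nu>" "sets \<nu> = sets borel" and V: "V \<in> grassmannian 1"
    and fin: "\<And>u. norm u = 1 \<Longrightarrow> (\<integral>\<^sup>+t. ennreal ((norm (ft \<nu> (t *\<^sub>R u)))\<^sup>2) \<partial>lborel) < \<infinity>"
  shows "absolutely_continuous (line_lebesgue V) (proj_measure V \<nu>) \<and> has_L2_density (line_lebesgue V) (proj_measure V \<nu>)"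
proof -
  interpret prob_space \<nu> by fact
  note [measurable_cong] = \<nu>(2)
  define u where "u = (SOME u. u \<in> V \<and> norm u = 1)"
  note u = unit_vector_of_line[OF V, folded u_def]
  have uu: "u \<bullet> u = 1" using u(2) by (simp add: norm_eq_1)
  let ?N = "restrict_space borel V"
  have h [measurable]: "(\<lambda>t. t *\<^sub>R u) \<in> measurable borel ?N"
    using u(3) by (intro measurable_restrict_space2) auto
  have proj: "orth_proj V x = (u \<bullet> x) *\<^sub>R u" for x
    unfolding orth_proj_def
  proof (rule the_equality)
    show "(u \<bullet> x) *\<^sub>R u \<in> V \<and> (\<forall>v\<in>V. orthogonal (x - (u \<bullet> x) *\<^sub>R u) v)"
      unfolding u(3) using uu by (auto simp: orthogonal_def inner_diff_left inner_commute[of x u])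
    fix y assume y: "y \<in> V \<and> (\<forall>v\<in>V. orthogonal (x - y) v)"
    then obtain t where t: "y = t *\<^sub>R u" using u(3) by auto
    have "(x - y) \<bullet> u = 0" using y u(1) by (auto simp: orthogonal_def)
    hence "t = u \<bullet> x" using uu by (simp add: t inner_diff_left inner_commute[of x u])
    thus "y = (u \<bullet> x) *\<^sub>R u" using t by simp
  qed
  define \<mu> where "\<mu> = distr \<nu> borel (\<lambda>x. u \<bullet> x)"
  have \<mu>: "prob_space \<mu>" "sets \<mu> = sets borel"
    unfolding \<mu>_def by (auto intro!: prob_space_distr)
  have ft\<mu>: "ft \<mu> t = ft \<nu> (t *\<^sub>R u)" for t
  proof -
    have "ft \<mu> t = (\<integral>x. cis (t \<bullet> (u \<bullet> x)) \<partial>\<nu>)"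
      unfolding ft_def \<mu>_def by (rule integral_distr) (simp_all add: cis_conv_exp)
    thus ?thesis by (simp add: ft_def)
  qed
  obtain g :: "real \<Rightarrow> real" where g [measurable]: "g \<in> borel_measurable borel" and g0: "\<And>x. 0 \<le> g x"
    and gi: "integrable lborel (\<lambda>x. (g x)\<^sup>2)" and \<mu>g: "\<mu> = density lborel (\<lambda>x. ennreal (g x))"
    using L2_ft_imp_L2_density[OF \<mu>] fin[OF u(2)] unfolding ft\<mu> by blast
  define G where "G y = g (u \<bullet> y)" for y :: 'a
  have [measurable]: "G \<in> borel_measurable ?N"
    unfolding G_def by (rule measurable_restrict_space1) measurable
  have Gh: "G (t *\<^sub>R u) = g t" for t by (simp add: G_def uu)
  have line: "line_lebesgue V = distr lborel ?N (\<lambda>t. t *\<^sub>R u)"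
    by (simp add: line_lebesgue_def u_def)
  have "proj_measure V \<nu> = distr \<nu> ?N (\<lambda>x. (u \<bullet> x) *\<^sub>R u)"
    by (simp add: proj_measure_def proj[abs_def])
  also have "\<dots> = distr \<mu> ?N (\<lambda>t. t *\<^sub>R u)"
    unfolding \<mu>_def by (subst distr_distr) (auto simp: o_def)
  also have "\<dots> = distr (density lborel (\<lambda>t. ennreal (G (t *\<^sub>R u)))) ?N (\<lambda>t. t *\<^sub>R u)"
    unfolding \<mu>g Gh ..
  also have "\<dots> = density (line_lebesgue V) (\<lambda>y. ennreal (G y))"
    unfolding line by (rule density_distr[symmetric]) measurable
  finally have eq: "proj_measure V \<nu> = density (line_lebesgue V) (\<lambda>y. ennreal (G y))" .
  have meas: "G \<in> borel_measurable (line_lebesgue V)" unfolding line by simp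
  have "integrable (line_lebesgue V) (\<lambda>y. (G y)\<^sup>2)"
    unfolding line by (subst integrable_distr_eq) (simp_all add: Gh gi)
  hence "has_L2_density (line_lebesgue V) (proj_measure V \<nu>)"
    unfolding has_L2_density_def using meas eq g0 by (intro exI[of _ G]) (auto simp: G_def)
  moreover have "absolutely_continuous (line_lebesgue V) (proj_measure V \<nu>)"
    unfolding eq using meas by (intro absolutely_continuousI_density) simp
  ultimately show ?thesis by blast
qed

section \<open>The quaternionic iterated function system\<close>

lemma base_M_bound: "real (base_M p) - 1 < real (p + 1) powr (1 / 4)"
proof -
  have "0 \<le> real (p + 1) powr (1 / 4)" by simp
  hence "real (base_M p) = of_int \<lceil>real (p + 1) powr (1 / 4)\<rceil>" unfolding base_M_def by (simp add: ceiling_mono)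
  thus ?thesis by linarith
qed

lemma norm_transl_le: "norm (transl p j) \<le> 2 * (real (base_M p) - 1)"
proof -
  have c: "(real (digit p i j))\<^sup>2 \<le> (real (base_M p) - 1)\<^sup>2" for i
    using digit_less[of p i j] by (intro power_mono) auto
  have "(norm (transl p j))\<^sup>2 \<le> 4 * (real (base_M p) - 1)\<^sup>2"
    unfolding norm_sq_4 using c[of 1] c[of 2] c[of 3] c[of 4] by (simp add: transl_def)
  also have "\<dots> = (2 * (real (base_M p) - 1))\<^sup>2" by (simp only: power_mult_distrib) simp
  finally show ?thesis
    by (rule power2_le_imp_le) (use digit_less[of p 1 j] in simp)
qed

text \<open>The digits determine \<open>j\<close>, so two different translations differ in an integer coordinate.\<close>

lemma dist_transl_ge:
  assumes "i \<in> {1..p + 1}" "j \<in> {1..p + 1}" "i \<noteq> j"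
  shows "1 \<le> dist (transl p i) (transl p j)"
proof -
  have comp: "1 \<le> dist (transl p i) (transl p j)"
    if "transl p i $ k = real a" "transl p j $ k = real b" "a \<noteq> b" for k a b
  proof -
    have "1 \<le> \<bar>real a - real b\<bar>" using that(3) by linarith
    also have "\<dots> = \<bar>(transl p i - transl p j) $ k\<bar>" using that by simp
    also have "\<dots> \<le> norm (transl p i - transl p j)" by (rule component_le_norm_cart)
    finally show ?thesis by (simp add: dist_norm)
  qed
  have "\<not> (digit p 1 i = digit p 1 j \<and> digit p 2 i = digit p 2 j \<and> digit p 3 i = digit p 3 j \<and> digit p 4 i = digit p 4 j)"
  proof
    assume "digit p 1 i = digit p 1 j \<and> digit p 2 i = digit p 2 j \<and> digit p 3 i = digit p 3 j \<and> digit p 4 i = digit p 4 j"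
    hence "i - 1 = j - 1" unfolding digit_expansion[OF assms(1)] digit_expansion[OF assms(2)] by simp
    thus False using assms by auto
  qed
  thus ?thesis
    using comp[of 1 "digit p 1 i" "digit p 1 j"] comp[of 2 "digit p 2 i" "digit p 2 j"]
      comp[of 3 "digit p 3 i" "digit p 3 j"] comp[of 4 "digit p 4 i" "digit p 4 j"]
    by (auto simp: transl_def)
qed

theorem corollary1p4:
  fixes D :: real and p :: nat and \<omega> :: "nat \<Rightarrow> real ^ 4"
  assumes "(3 + sqrt 21) / 2 < D" and "D < 4"
    and "prime p" and "[p = 1] (mod 4)"
    and "real p > max (5 powr (4 * D / (4 - D))) (2 powr (4 * D * (D - 1) / (D\<^sup>2 - 3 * D - 3)))"
    and "bij_betw \<omega> {1..p + 1} (Omega p)"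
  defines "\<nu> \<equiv> uniform_self_similar_measure {1..p + 1} (Phi p D \<omega>)"
  shows "(hausdorff_dim_measure \<nu> = ereal D \<and> correlation_dim \<nu> = ereal D \<and> D < 4 \<and>
          mutually_singular \<nu> lborel) \<and>
         (\<forall>V \<in> grassmannian 1.
            absolutely_continuous (line_lebesgue V) (proj_measure V \<nu>) \<and>
            has_L2_density (line_lebesgue V) (proj_measure V \<nu>))"
proof -
  have "sqrt 21 < 2 * D - 3" using assms(1) by simp
  hence "(sqrt 21)\<^sup>2 < (2 * D - 3)\<^sup>2" by (intro power_strict_mono) auto
  hence Dsq: "3 < D\<^sup>2 - 3 * D" by (simp add: power2_eq_square algebra_simps)
  have "sqrt (4\<^sup>2) \<le> sqrt 21" by (intro real_sqrt_le_mono) simp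
  hence D3: "7 / 2 < D" using assms(1) by simp
  define y where "y = real (p + 1)"
  have p1: "5 powr (4 * D / (4 - D)) < real p" using assms(5) by simp
  have "5 powr 12 \<le> (5::real) powr (4 * D / (4 - D))"
    using D3 \<open>D < 4\<close> by (intro powr_mono) (auto simp: pos_le_divide_eq)
  hence "(5::real) ^ 12 < real p" using p1 by simp
  hence y256: "2 ^ 8 < y" by (simp add: y_def)
  have y0: "0 < y" and y1: "1 < y" using y256 by auto
  define r where "r = y powr (- 1 / D)"
  have r0: "0 < r" using y0 by (simp add: r_def)
  have r_quarter: "r * y powr (1 / 4) < 1 / 5"
  proof -
    define e where "e = 4 * D / (4 - D)"
    have e: "0 < e" "1 / e = 1 / D - 1 / 4" using D3 \<open>D < 4\<close> by (auto simp: e_def field_simps)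
    have "5 powr e < y" using p1 by (simp add: e_def y_def)
    hence "(5 powr e) powr (1 / e) < y powr (1 / e)" using e(1) by (intro powr_less_mono2) auto
    moreover have "(5 powr e) powr (1 / e) = 5" using e(1) by (simp add: powr_powr)
    ultimately have T: "5 < y powr (1 / D - 1 / 4)" unfolding e(2) by simp
    moreover have "r * y powr (1 / 4) * y powr (1 / D - 1 / 4) = 1"
      using y0 by (simp add: r_def powr_add[symmetric])
    moreover have "r * y powr (1 / 4) * 5 < r * y powr (1 / 4) * y powr (1 / D - 1 / 4)"
      using T r0 y0 by (intro mult_strict_left_mono) auto
    ultimately show ?thesis by simp
  qed
  have "1 \<le> y powr (1 / 4)" using y1 by (intro ge_one_powr_ge_zero) auto
  hence "r * 1 \<le> r * y powr (1 / 4)" using r0 by (intro mult_left_mono) auto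
  hence r_fifth: "r \<le> r * y powr (1 / 4)" by simp
  hence r1: "r < 1" using r_quarter by simp
  define m where "m = real (base_M p) - 1"
  have m0: "0 \<le> m" using digit_less[of p 1 1] by (simp add: m_def)
  have "r * m \<le> r * y powr (1 / 4)"
    using base_M_bound[of p] r0 by (intro mult_left_mono) (auto simp: m_def y_def)
  hence rm: "4 * (r * m) + r < 1" using r_quarter r_fifth by linarith
  \<comment> \<open>The radius of a ball that all maps send into itself, as all translations have norm at most \<open>2 * m\<close>.\<close>
  define L where "L = 2 * m / (1 - r)"
  have L0: "0 \<le> L" and LL: "r * L + 2 * m = L" using m0 r1 by (auto simp: L_def field_simps)
  have rL: "2 * (r * L) < 1" using rm r1 by (simp add: L_def pos_divide_less_eq mult_ac)
  \<comment> \<open>Distinct translations are at distance at least 1, and the linear parts map the ball of radius \<open>L\<close> into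
    the ball of radius \<open>r * L\<close>.\<close>
  define \<kappa> where "\<kappa> = 1 - 2 * (r * L)"
  have odd_p: "odd p" using assms(4) unfolding cong_def by presburger
  have sqrt_p: "0 < sqrt (real p)" using le_less_trans[OF powr_ge_zero p1] by simp
  have inj: "inj_on (\<lambda>x. (1 / sqrt (real p)) *\<^sub>R qvec x) (generators p)"
    using sqrt_p inj_qvec by (auto simp: inj_on_def)
  have card_S: "card (generators p) = p + 1"
    using bij_betw_same_card[OF assms(6)] card_image[OF inj] by (simp add: Omega_eq)
  define J where "J = {1..p + 1}"
  note bij = assms(6)[folded J_def]
  have card_J: "real (card J) = real p + 1" by (simp add: J_def)
  let ?f = "Phi p D \<omega>"
  have f: "?f j x = r *\<^sub>R (left_mult (\<omega> j) *v x) + transl p j" for j x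
    by (simp add: Phi_def r_def y_def)
  have norm_\<omega>: "norm (\<omega> j) = 1" if "j \<in> J" for j
  proof -
    have "\<omega> j \<in> Omega p" using bij that by (auto simp: bij_betw_def)
    then obtain x where "x \<in> generators p" "\<omega> j = (1 / sqrt (real p)) *\<^sub>R qvec x" unfolding Omega_eq by blast
    thus ?thesis using sqrt_p by (simp add: norm_qvec generators_def)
  qed
  have norm_f: "norm (r *\<^sub>R (left_mult (\<omega> j) *v x)) = r * norm x" if "j \<in> J" for j x
    using r0 norm_\<omega>[OF that] by (simp add: norm_left_mult)
  interpret I: similarity_ifs J ?f r "cball 0 L"
  proof
    show "dist (?f j x) (?f j z) = r * dist x z" if "j \<in> J" for j x z
      using norm_f[OF that, of "x - z"]
      by (simp add: f dist_norm matrix_vector_mult_diff_distrib scaleR_diff_right)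
    show "?f j x \<in> cball 0 L" if "j \<in> J" "x \<in> cball 0 L" for j x
    proof -
      have "norm (?f j x) \<le> r * norm x + 2 * m"
        unfolding f m_def using norm_triangle_mono[OF eq_refl[OF norm_f[OF that(1)]] norm_transl_le] .
      also have "\<dots> \<le> r * L + 2 * m" using that(2) r0 by simp
      finally show ?thesis using LL by simp
    qed
  qed (use r0 r1 L0 in \<open>auto simp: J_def\<close>)
  interpret I: separated_ifs J ?f r "cball 0 L" \<kappa> D
  proof
    show "0 < \<kappa>" using rL by (simp add: \<kappa>_def)
    show "0 < D" using D3 by simp
    show "\<kappa> \<le> dist (?f i x) (?f j z)"
      if "i \<in> J" "j \<in> J" "i \<noteq> j" "x \<in> cball 0 L" "z \<in> cball 0 L" for i j x z
    proof -
      let ?a = "r *\<^sub>R (left_mult (\<omega> i) *v x)" and ?b = "r *\<^sub>R (left_mult (\<omega> j) *v z)"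
      have "norm ?a \<le> r * L" "norm ?b \<le> r * L"
        using that(4,5) r0
        by (simp_all only: norm_f[OF that(1)] norm_f[OF that(2)] mem_cball_0 mult_left_mono less_imp_le)
      moreover have "norm (transl p i - transl p j) \<le> norm (?f i x - ?f j z) + norm (?b - ?a)"
        using norm_triangle_ineq[of "?f i x - ?f j z" "?b - ?a"] by (simp add: f algebra_simps)
      moreover have "norm (?b - ?a) \<le> norm ?b + norm ?a" by (rule norm_triangle_ineq4)
      ultimately show ?thesis using dist_transl_ge[OF that(1,2,3)[unfolded J_def]] by (simp add: dist_norm \<kappa>_def)
    qed
    have "r powr D = y powr (- 1)" using D3 y0 by (simp add: r_def powr_powr)
    thus "real (similarity_ifs.N J) * r powr D = 1"
      using y0 unfolding I.N_def card_J by (simp add: y_def powr_minus_divide add.commute)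
  qed
  have \<nu>: "\<nu> = I.nu" unfolding \<nu>_def J_def[symmetric] by (rule I.uniform_self_similar_measure_eq)
  have step: "(norm (ft I.nu \<xi>))\<^sup>2 \<le> (1 / (real p + 1)) * (\<Sum>\<alpha>\<in>generators p. (norm (ft I.nu ((r / sqrt (real p)) *\<^sub>R qact (qcnj \<alpha>) \<xi>)))\<^sup>2)" for \<xi>
  proof -
    let ?G = "\<lambda>w. norm (\<integral>x. cis (\<xi> \<bullet> (r *\<^sub>R (left_mult w *v x))) \<partial>I.nu)"
    have "ft I.nu \<xi> = (\<Sum>j\<in>J. \<integral>x. cis (\<xi> \<bullet> ?f j x) \<partial>I.nu) / of_nat I.N"
      unfolding ft_def by (rule I.integral_nu[where K=1]) (auto intro!: measurable_cis_inner)
    hence "norm (ft I.nu \<xi>) = norm (\<Sum>j\<in>J. \<integral>x. cis (\<xi> \<bullet> ?f j x) \<partial>I.nu) / (real p + 1)"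
      by (simp only: norm_divide norm_of_nat I.N_def card_J)
    also have "\<dots> \<le> (\<Sum>j\<in>J. ?G (\<omega> j)) / (real p + 1)"
    proof (intro divide_right_mono sum_norm_le)
      fix j
      have "(\<integral>x. cis (\<xi> \<bullet> ?f j x) \<partial>I.nu) = (\<integral>x. cis (\<xi> \<bullet> (r *\<^sub>R (left_mult (\<omega> j) *v x))) * cis (\<xi> \<bullet> transl p j) \<partial>I.nu)"
        by (simp add: f inner_add_right cis_mult)
      also have "\<dots> = (\<integral>x. cis (\<xi> \<bullet> (r *\<^sub>R (left_mult (\<omega> j) *v x))) \<partial>I.nu) * cis (\<xi> \<bullet> transl p j)"
        by (rule integral_mult_left_zero)
      finally show "norm (\<integral>x. cis (\<xi> \<bullet> ?f j x) \<partial>I.nu) \<le> ?G (\<omega> j)" by (simp add: norm_mult)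
    qed simp
    finally have "(norm (ft I.nu \<xi>))\<^sup>2 \<le> ((\<Sum>j\<in>J. ?G (\<omega> j)) / (real p + 1))\<^sup>2" by (intro power_mono) auto
    also have "\<dots> = (\<Sum>j\<in>J. ?G (\<omega> j))\<^sup>2 / (real p + 1)\<^sup>2" by (simp add: power_divide)
    also have "\<dots> \<le> ((\<Sum>j\<in>J. (?G (\<omega> j))\<^sup>2) * real (card J)) / (real p + 1)\<^sup>2"
      by (intro divide_right_mono sum_squared_le_sum_of_squares) auto
    also have "\<dots> = (1 / (real p + 1)) * (\<Sum>j\<in>J. (?G (\<omega> j))\<^sup>2)"
      unfolding card_J by (simp add: power2_eq_square)
    also have "(\<Sum>j\<in>J. (?G (\<omega> j))\<^sup>2) = (\<Sum>w\<in>Omega p. (?G w)\<^sup>2)"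
      by (rule sum.reindex_bij_betw[OF bij])
    also have "\<dots> = (\<Sum>\<alpha>\<in>generators p. (?G ((1 / sqrt (real p)) *\<^sub>R qvec \<alpha>))\<^sup>2)"
      unfolding Omega_eq by (subst sum.reindex[OF inj]) simp
    also have "\<dots> = (\<Sum>\<alpha>\<in>generators p. (norm (ft I.nu ((r / sqrt (real p)) *\<^sub>R qact (qcnj \<alpha>) \<xi>)))\<^sup>2)"
      unfolding ft_def left_mult_scaleR qact_def[symmetric] by (simp add: inner_qact)
    finally show ?thesis .
  qed
  \<comment> \<open>With this choice the powers of \<open>p + 1\<close> in the ratio \<open>\<theta>\<close> add up to \<open>- 1 / 8\<close>.\<close>
  define \<alpha> where "\<alpha> = 13 / 4 + 2 / D"
  have \<alpha>: "0 < \<alpha>" "\<alpha> \<le> 4" "\<alpha> < D"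
  proof -
    show "0 < \<alpha>" "\<alpha> \<le> 4" using D3 by (auto simp: \<alpha>_def field_simps)
    have "13 / 4 * D + 2 < D\<^sup>2" using Dsq \<open>D < 4\<close> by linarith
    thus "\<alpha> < D" using D3 by (simp add: \<alpha>_def field_simps power2_eq_square)
  qed
  have \<theta>: "2 * sqrt (real p) * sqrt (real p) powr (4 - \<alpha>) / (r * (real p + 1)) < 1"
  proof -
    have sp: "sqrt (real p) \<le> y powr (1 / 2)" using y0 by (simp add: powr_half_sqrt y_def)
    have "2 * sqrt (real p) * sqrt (real p) powr (4 - \<alpha>) \<le> 2 * y powr (1 / 2) * (y powr (1 / 2)) powr (4 - \<alpha>)"
      using sp \<alpha> sqrt_p by (intro mult_mono powr_mono2) auto
    also have "\<dots> = 2 * y powr (1 / 2 + (4 - \<alpha>) / 2)" by (simp add: powr_powr powr_add)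
    also have "1 / 2 + (4 - \<alpha>) / 2 = (1 - 1 / D) - 1 / 8" by (simp add: \<alpha>_def field_simps)
    also have "2 * y powr ((1 - 1 / D) - 1 / 8) = (2 / y powr (1 / 8)) * y powr (1 - 1 / D)"
      by (subst powr_diff) simp
    also have "\<dots> < 1 * y powr (1 - 1 / D)"
    proof (rule mult_strict_right_mono)
      have "(2 powr 8) powr (1 / 8) < y powr (1 / 8)" using y256 by (intro powr_less_mono2) auto
      thus "2 / y powr (1 / 8) < 1" by (simp add: powr_powr divide_less_eq)
    qed (use y0 in simp)
    also have "1 * y powr (1 - 1 / D) = r * (real p + 1)"
      using y0 by (simp add: r_def powr_diff powr_minus_divide y_def)
    finally show ?thesis using r0 by (simp add: divide_less_eq add_pos_nonneg)
  qed
  have L2: "(\<integral>\<^sup>+t. ennreal ((norm (ft I.nu (t *\<^sub>R u)))\<^sup>2) \<partial>lborel) < \<infinity>" if u: "norm u = 1" for u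
  proof (rule ft_line_square_integrable[OF I.nu.prob_space_axioms I.sets_nu _ \<open>prime p\<close> odd_p card_S r0 r1 u step \<alpha>(1,2) _ \<theta>])
    show "AE x in I.nu. norm x \<le> L" using I.AE_nu_B by simp
    show "(\<integral>\<^sup>+x. \<integral>\<^sup>+y. riesz_kernel \<alpha> x y \<partial>I.nu \<partial>I.nu) < \<infinity>" by (rule I.riesz_energy_finite[OF \<alpha>(1,3)])
  qed
  have "mutually_singular I.nu lborel" using \<open>D < 4\<close> by (intro I.mutually_singular_nu) simp
  thus ?thesis
    unfolding \<nu> using I.hausdorff_dim_measure_nu I.correlation_dim_nu \<open>D < 4\<close>
      projection_has_L2_density[OF I.nu.prob_space_axioms I.sets_nu _ L2] by simp
qed

end
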